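(* Let $(X,\mathcal F)$ be a compact foliated space that is strongly equicontinuous and quasi-effective. Assume that the space of leaves is connected (for example, if $\mathcal F$ is transitive, i.e. some leaf is dense, or if $X$ is connected). Then all leaves with trivial holonomy group determine the same coarse quasi-isometry type.
   Context: **Foliated spaces.** A locally compact Polish space $X$ is a foliated space if it has an open cover $\{U_i\}$ with homeomorphisms $\phi_i:U_i\to B_i\times Z_i$ (flow boxes), $B_i$ an open ball of finite radius in $\mathbb R^n$, $Z_i$ a Polish space, with coordinate changes $\phi_i\circ\phi_j^{-1}(x_j,z_j)=(x_i(x_j,z_j),z_i(z_j))$, $z_i$ continuous, and $x_i$ of class $C^k$ in the sense that its partial derivatives up to order $k$ in the $\mathbb R^n$-directions exist and are continuous in $(x_j,z_j)$. The sets $\phi_i^{-1}(B_i\times\{z\})$ are plaques. The leaves are the connected components of $X$ in the finer topology with basis the open subsets of plaques. The space of leaves is the quotient of $X$ by the partition into leaves, with the quotient topology. **Holonomy pseudogroup.** Let $p_i:U_i\to Z_i$ be the composite of $\phi_i$ with the projection $B_i\times Z_i\to Z_i$, and $Z_{i,j}=p_i(U_i\cap U_j)$. For a suitable (regular) cover there are homeomorphisms $h_{i,j}:Z_{i,j}\to Z_{j,i}$ with $p_j=h_{i,j}\circ p_i$ on $U_i\cap U_j$; then $(U_i,p_i,h_{i,j})$ is called a defining cocycle. The $h_{i,j}$ generate a pseudogroup $\mathcal H$ on $Z=\bigsqcup_iZ_i$, the holonomy pseudogroup. Leaves correspond bijectively to $\mathcal H$-orbits, via $L\mapsto\mathcal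 H(p_i(x))$ for $x\in L\cap U_i$. The holonomy group of a leaf is the group of germs of the corresponding orbit: the group of germs at a point $x$ of the orbit of all $h\in\mathcal H$ with $h(x)=x$ (independent of $x$ up to isomorphism). **Pseudogroups.** A pseudogroup of local transformations of a space $Z$ is a collection $\mathcal H$ of homeomorphisms between open subsets of $Z$ containing $\mathrm{id}_Z$ and closed under composition (wherever defined), inversion, restriction to open sets and combination (union) of maps. It is generated by $E\subset\mathcal H$ if all its elements are obtained from $E$ by these operations. $E$ is symmetric if $h\in E\Rightarrow h^{-1}\in E$. The orbit of $x$ is $\{h(x): h\in\mathcal H,\ x\in\operatorname{dom}h\}$. For a symmetric generating set $E$ and $x,y$ in the same orbit, $d_E(x,y)$ is the minimal $k$ such that some $h\in\mathcal H$ with $h(x)=y$ equals near $x$ a composite of $k$ elements of $E$ ($k=0$ for the identity germ). **Coarse quasi-isometry type.** A net in a metric space $M$ is a subset $A$ with $d(x,A)<C$ for some $C>0$ and all $x\in M$. Two metric spaces have the same coarse quasi-isometry type if there is a bi-Lipschitz bijection between a net of one and a net of the other. The coarse quasi-isometry type determined by a leaf of a compact foliated space is that of the corresponding $\mathcal H$-orbit with the metric $d_E$, $E=\{h_{i,j}\}$, for any finite defining cocycle $(U_i,p_i,h_{i,j})$ that is a shrinking of another defining cocycle $(\widetilde U_i,\tilde p_i,\tilde h_{i,j})$ (i.e. $\overline{U_i}\subset\widetilde U_i$ and $p_i$ is the restriction of $\tilde p_i$); it does not depend on this choice. **Quasi-local metrics.** A cover of a set $Z$ by quasi-locally equal metric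 spaces is a family $\{(Z_i,d_i)\}_{i\in I}$ of metric spaces with $Z=\bigcup_iZ_i$, each $Z_i\cap Z_j$ open in $(Z_i,d_i)$ and in $(Z_j,d_j)$, such that for all $\varepsilon>0$ there is $\delta(\varepsilon)>0$ so that: for all $i,j\in I$ and $z\in Z_i\cap Z_j$ there is an open neighborhood $U_{i,j,z}$ of $z$ in $Z_i\cap Z_j$ with $d_i(x,y)<\delta(\varepsilon)\Rightarrow d_j(x,y)<\varepsilon$ for all $\varepsilon>0$ and $x,y\in U_{i,j,z}$. Two such families are equivalent if their union is again such a family; an equivalence class $\mathfrak Q$ is a quasi-local metric. It induces a topology on $Z$ with base the open balls of all $(Z_i,d_i)$. **Strong equicontinuity.** A pseudogroup $\mathcal H$ on a space $Z$ is strongly equicontinuous if there are a quasi-local metric $\mathfrak Q$ inducing the topology of $Z$, some $\{(Z_i,d_i)\}_{i\in I}\in\mathfrak Q$ and a symmetric set $S$ of generators of $\mathcal H$, closed under compositions, such that for every $\varepsilon>0$ there is $\delta(\varepsilon)>0$ with $d_i(x,y)<\delta(\varepsilon)\Rightarrow d_j(h(x),h(y))<\varepsilon$ for all $h\in S$, $i,j\in I$ and $x,y\in Z_i\cap h^{-1}(Z_j\cap\operatorname{im}h)$. **Quasi-effectiveness.** $\mathcal H$ is quasi-effective if it is generated by some symmetric set $S$, closed under compositions, such that any transformation in $S$ is the identity on its domain if it is the identity on some non-empty open subset of its domain. A foliated space is strongly equicontinuous (resp. quasi-effective) if its holonomy pseudogroup is (this is independent of the chosen representative). *)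

theory Defs
  imports
    "HOL-Analysis.Analysis"
    "HOL-Algebra.Elementary_Groups"
    "HOL-Library.Extended_Nat"
begin

section \<open>Foliated spaces\<close>

definition polish :: "'a topology \<Rightarrow> bool" where
  "polish X \<longleftrightarrow> completely_metrizable_space X \<and> second_countable X"

definition open_ball :: "nat \<Rightarrow> (nat \<Rightarrow> real) \<Rightarrow> real \<Rightarrow> (nat \<Rightarrow> real) set" where
  "open_ball n a r =
    {x \<in> topspace (Euclidean_space n). sqrt (\<Sum>i<n. (x i - a i)\<^sup>2) < r}"

record ('x, 'z) flow_box =
  fb_dom :: "'x set"
  fb_ball :: "(nat \<Rightarrow> real) set"
  fb_trans :: "'z topology"
  fb_chart :: "'x \<Rightarrow> (nat \<Rightarrow> real) \<times> 'z"

definition fb_proj :: "('x, 'z) flow_box \<Rightarrow> 'x \<Rightarrow> 'z" where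
  "fb_proj b u = snd (fb_chart b u)"

definition fb_model :: "nat \<Rightarrow> ('x, 'z) flow_box \<Rightarrow> ((nat \<Rightarrow> real) \<times> 'z) topology" where
  "fb_model n b = prod_topology (subtopology (Euclidean_space n) (fb_ball b)) (fb_trans b)"

definition is_flow_box :: "nat \<Rightarrow> 'x topology \<Rightarrow> ('x, 'z) flow_box \<Rightarrow> bool" where
  "is_flow_box n X b \<longleftrightarrow>
     openin X (fb_dom b) \<and>
     (\<exists>a \<in> topspace (Euclidean_space n). \<exists>r>0. fb_ball b = open_ball n a r) \<and>
     polish (fb_trans b) \<and>
     homeomorphic_map (subtopology X (fb_dom b)) (fb_model n b) (fb_chart b)"

text \<open>
  Continuity of all partial derivatives up to order \<open>m\<close> in the first \<open>n\<close> Euclidean directions.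
  The space \<open>W\<close> is meant to be an open subspace of a product \<open>B \<times> Z\<close> with \<open>B\<close> an open ball, so that
  the two-sided derivatives below involve only values of \<open>f\<close> on \<open>W\<close>.
\<close>

primrec leafwise_C ::
    "nat \<Rightarrow> ((nat \<Rightarrow> real) \<times> 'z) topology \<Rightarrow> nat \<Rightarrow> ((nat \<Rightarrow> real) \<times> 'z \<Rightarrow> real) \<Rightarrow> bool" where
  "leafwise_C n W 0 f \<longleftrightarrow> continuous_map W euclideanreal f"
| "leafwise_C n W (Suc m) f \<longleftrightarrow>
     continuous_map W euclideanreal f \<and>
     (\<forall>i<n. \<exists>g. (\<forall>(x, z) \<in> topspace W.
                   ((\<lambda>t. f (x(i := t), z)) has_real_derivative g (x, z)) (at (x i))) \<and>
                leafwise_C n W m g)"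

text \<open>
  The change of coordinates from \<open>b\<close> to \<open>b'\<close> has the form \<open>(x, z) \<mapsto> (xi (x, z), zeta z)\<close>.
  As usual for foliated charts, this is a condition near each point of the overlap; a plaque
  of \<open>b\<close> may therefore meet several plaques of \<open>b'\<close>, which is excluded only for defining cocycles.
\<close>

definition coord_change ::
    "nat \<Rightarrow> enat \<Rightarrow> 'x topology \<Rightarrow> ('x, 'z) flow_box \<Rightarrow> ('x, 'w) flow_box \<Rightarrow> bool" where
  "coord_change n k X b b' \<longleftrightarrow>
     (\<forall>u \<in> fb_dom b \<inter> fb_dom b'. \<exists>N xi zeta.
        openin X N \<and> u \<in> N \<and> N \<subseteq> fb_dom b \<inter> fb_dom b' \<and>
        (\<forall>v\<in>N. fb_chart b' v = (xi (fb_chart b v), zeta (fb_proj b v))) \<and>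
        continuous_map (subtopology (fb_trans b) (fb_proj b ` N)) (fb_trans b') zeta \<and>
        (\<forall>i<n. \<forall>m. enat m \<le> k \<longrightarrow>
           leafwise_C n (subtopology (fb_model n b) (fb_chart b ` N)) m (\<lambda>w. xi w i)))"

definition foliated_atlas :: "nat \<Rightarrow> enat \<Rightarrow> 'x topology \<Rightarrow> ('x, 'z) flow_box set \<Rightarrow> bool" where
  "foliated_atlas n k X \<A> \<longleftrightarrow>
     (\<forall>b\<in>\<A>. is_flow_box n X b) \<and>
     (\<Union>b\<in>\<A>. fb_dom b) = topspace X \<and>
     (\<forall>b\<in>\<A>. \<forall>b'\<in>\<A>. coord_change n k X b b')"

definition foliated_space :: "nat \<Rightarrow> enat \<Rightarrow> 'x topology \<Rightarrow> ('x, 'z) flow_box set \<Rightarrow> bool" where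
  "foliated_space n k X \<A> \<longleftrightarrow>
     locally_compact_space X \<and> polish X \<and> foliated_atlas n k X \<A>"

text \<open>Two atlases, possibly with transversals in different types, defining the same structure.\<close>

definition compatible_atlases ::
    "nat \<Rightarrow> enat \<Rightarrow> 'x topology \<Rightarrow> ('x, 'z) flow_box set \<Rightarrow> ('x, 'w) flow_box set \<Rightarrow> bool" where
  "compatible_atlases n k X \<A> \<B> \<longleftrightarrow>
     (\<forall>b\<in>\<A>. \<forall>b'\<in>\<B>. coord_change n k X b b' \<and> coord_change n k X b' b)"

definition plaque :: "('x, 'z) flow_box \<Rightarrow> 'z \<Rightarrow> 'x set" where
  "plaque b z = {u \<in> fb_dom b. fb_proj b u = z}"

definition leaf_topology :: "'x topology \<Rightarrow> ('x, 'z) flow_box set \<Rightarrow> 'x topology" where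
  "leaf_topology X \<A> = topology_generated_by
     {P. \<exists>b\<in>\<A>. \<exists>z \<in> topspace (fb_trans b). openin (subtopology X (plaque b z)) P}"

definition leaves :: "'x topology \<Rightarrow> ('x, 'z) flow_box set \<Rightarrow> 'x set set" where
  "leaves X \<A> = connected_components_of (leaf_topology X \<A>)"

definition quotient_topology :: "'a topology \<Rightarrow> ('a \<Rightarrow> 'b) \<Rightarrow> 'b topology" where
  "quotient_topology X q =
     topology (\<lambda>V. V \<subseteq> q ` topspace X \<and> openin X {x \<in> topspace X. q x \<in> V})"

lemma openin_quotient_topology:
  "openin (quotient_topology X q) V \<longleftrightarrow>
     V \<subseteq> q ` topspace X \<and> openin X {x \<in> topspace X. q x \<in> V}"
proof -
  have "istopology (\<lambda>V. V \<subseteq> q ` topspace X \<and> openin X {x \<in> topspace X. q x \<in> V})"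
    unfolding istopology_def
  proof (rule conjI; intro allI impI)
    fix S T
    assume S: "S \<subseteq> q ` topspace X \<and> openin X {x \<in> topspace X. q x \<in> S}"
      and T: "T \<subseteq> q ` topspace X \<and> openin X {x \<in> topspace X. q x \<in> T}"
    have "{x \<in> topspace X. q x \<in> S \<inter> T} =
        {x \<in> topspace X. q x \<in> S} \<inter> {x \<in> topspace X. q x \<in> T}"
      by auto
    then show "S \<inter> T \<subseteq> q ` topspace X \<and> openin X {x \<in> topspace X. q x \<in> S \<inter> T}"
      using S T by auto
  next
    fix \<K>
    assume K: "\<forall>K\<in>\<K>. K \<subseteq> q ` topspace X \<and> openin X {x \<in> topspace X. q x \<in> K}"
    have "{x \<in> topspace X. q x \<in> \<Union>\<K>} = (\<Union>K\<in>\<K>. {x \<in> topspace X. q x \<in> K})"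
      by auto
    then show "\<Union>\<K> \<subseteq> q ` topspace X \<and> openin X {x \<in> topspace X. q x \<in> \<Union>\<K>}"
      using K by auto
  qed
  then show ?thesis
    by (simp add: quotient_topology_def topology_inverse')
qed

definition leaf_space :: "'x topology \<Rightarrow> ('x, 'z) flow_box set \<Rightarrow> 'x set topology" where
  "leaf_space X \<A> = quotient_topology X (connected_component_of_set (leaf_topology X \<A>))"


section \<open>Pseudogroups\<close>

text \<open>
  Local transformations are partial maps; \<open>g \<circ>\<^sub>m h\<close> is then composition wherever defined and
  \<open>h |` V\<close> is restriction.
\<close>

definition local_homeo :: "'p topology \<Rightarrow> ('p \<rightharpoonup> 'p) \<Rightarrow> bool" where
  "local_homeo Z h \<longleftrightarrow> openin Z (dom h) \<and> openin Z (ran h) \<and>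
     homeomorphic_map (subtopology Z (dom h)) (subtopology Z (ran h)) (\<lambda>x. the (h x))"

definition id_map :: "'p topology \<Rightarrow> ('p \<rightharpoonup> 'p)" where
  "id_map Z = Some |` topspace Z"

definition inv_map :: "('p \<rightharpoonup> 'p) \<Rightarrow> ('p \<rightharpoonup> 'p)" where
  "inv_map h = (\<lambda>y. if y \<in> ran h then Some (THE x. h x = Some y) else None)"

text \<open>The last rule is combination: a local homeomorphism that is a union of elements.\<close>

inductive_set generated_pseudogroup :: "'p topology \<Rightarrow> ('p \<rightharpoonup> 'p) set \<Rightarrow> ('p \<rightharpoonup> 'p) set"
  for Z :: "'p topology" and E :: "('p \<rightharpoonup> 'p) set" where
  gen: "h \<in> E \<Longrightarrow> h \<in> generated_pseudogroup Z E"
| ident: "id_map Z \<in> generated_pseudogroup Z E"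
| comp: "g \<in> generated_pseudogroup Z E \<Longrightarrow> h \<in> generated_pseudogroup Z E \<Longrightarrow>
    g \<circ>\<^sub>m h \<in> generated_pseudogroup Z E"
| inv: "h \<in> generated_pseudogroup Z E \<Longrightarrow> inv_map h \<in> generated_pseudogroup Z E"
| restr: "h \<in> generated_pseudogroup Z E \<Longrightarrow> openin Z V \<Longrightarrow> h |` V \<in> generated_pseudogroup Z E"
| union: "(\<forall>g\<in>G. g \<in> generated_pseudogroup Z E \<and> g \<subseteq>\<^sub>m h) \<Longrightarrow> dom h = (\<Union>g\<in>G. dom g) \<Longrightarrow>
    local_homeo Z h \<Longrightarrow> h \<in> generated_pseudogroup Z E"

definition symmetric_maps :: "('p \<rightharpoonup> 'p) set \<Rightarrow> bool" where
  "symmetric_maps S \<longleftrightarrow> (\<forall>h\<in>S. inv_map h \<in> S)"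

definition comp_closed :: "('p \<rightharpoonup> 'p) set \<Rightarrow> bool" where
  "comp_closed S \<longleftrightarrow> (\<forall>g\<in>S. \<forall>h\<in>S. g \<circ>\<^sub>m h \<in> S)"

definition pg_orbit :: "('p \<rightharpoonup> 'p) set \<Rightarrow> 'p \<Rightarrow> 'p set" where
  "pg_orbit H x = {y. \<exists>h\<in>H. h x = Some y}"

definition same_germ :: "'p topology \<Rightarrow> 'p \<Rightarrow> ('p \<rightharpoonup> 'p) \<Rightarrow> ('p \<rightharpoonup> 'p) \<Rightarrow> bool" where
  "same_germ Z x g h \<longleftrightarrow>
     (\<exists>V. openin Z V \<and> x \<in> V \<and> V \<subseteq> dom g \<inter> dom h \<and> (\<forall>y\<in>V. g y = h y))"

definition germ :: "'p topology \<Rightarrow> ('p \<rightharpoonup> 'p) set \<Rightarrow> 'p \<Rightarrow> ('p \<rightharpoonup> 'p) \<Rightarrow> ('p \<rightharpoonup> 'p) set" where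
  "germ Z H x h = {g\<in>H. same_germ Z x g h}"

definition germ_group :: "'p topology \<Rightarrow> ('p \<rightharpoonup> 'p) set \<Rightarrow> 'p \<Rightarrow> ('p \<rightharpoonup> 'p) set monoid" where
  "germ_group Z H x =
     \<lparr>carrier = {germ Z H x h | h. h \<in> H \<and> h x = Some x},
      mult = (\<lambda>a b. \<Union>g\<in>a. \<Union>h\<in>b. germ Z H x (g \<circ>\<^sub>m h)),
      one = germ Z H x (id_map Z)\<rparr>"

primrec composites :: "'p topology \<Rightarrow> ('p \<rightharpoonup> 'p) set \<Rightarrow> nat \<Rightarrow> ('p \<rightharpoonup> 'p) set" where
  "composites Z E 0 = {id_map Z}"
| "composites Z E (Suc m) = {g \<circ>\<^sub>m h | g h. g \<in> E \<and> h \<in> composites Z E m}"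

text \<open>Only meaningful for \<open>x\<close> and \<open>y\<close> in the same orbit.\<close>

definition gen_dist :: "'p topology \<Rightarrow> ('p \<rightharpoonup> 'p) set \<Rightarrow> 'p \<Rightarrow> 'p \<Rightarrow> real" where
  "gen_dist Z E x y = real (LEAST m. \<exists>h \<in> generated_pseudogroup Z E.
     h x = Some y \<and> (\<exists>g \<in> composites Z E m. same_germ Z x h g))"


section \<open>Strong equicontinuity and quasi-effectiveness\<close>

text \<open>
  A family of metric spaces is given by the set of its members, which loses nothing here since
  all the conditions depend only on the members and not on their indices.
\<close>

definition quasi_local_cover :: "'p set \<Rightarrow> 'p metric set \<Rightarrow> bool" where
  "quasi_local_cover S Q \<longleftrightarrow>
     S = (\<Union>m\<in>Q. mspace m) \<and>
     (\<forall>m\<in>Q. \<forall>m'\<in>Q. openin (mtopology_of m) (mspace m \<inter> mspace m') \<and>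
                     openin (mtopology_of m') (mspace m \<inter> mspace m')) \<and>
     (\<exists>\<delta>. (\<forall>\<epsilon>>0::real. \<delta> \<epsilon> > (0::real)) \<and>
       (\<forall>m\<in>Q. \<forall>m'\<in>Q. \<forall>z \<in> mspace m \<inter> mspace m'. \<exists>U.
          openin (mtopology_of m) U \<and> openin (mtopology_of m') U \<and>
          z \<in> U \<and> U \<subseteq> mspace m \<inter> mspace m' \<and>
          (\<forall>\<epsilon>>0. \<forall>x\<in>U. \<forall>y\<in>U. mdist m x y < \<delta> \<epsilon> \<longrightarrow> mdist m' x y < \<epsilon>)))"

definition quasi_local_equiv :: "'p set \<Rightarrow> 'p metric set \<Rightarrow> 'p metric set \<Rightarrow> bool" where
  "quasi_local_equiv S Q Q' \<longleftrightarrow>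
     quasi_local_cover S Q \<and> quasi_local_cover S Q' \<and> quasi_local_cover S (Q \<union> Q')"

definition quasi_local_metric :: "'p set \<Rightarrow> 'p metric set set \<Rightarrow> bool" where
  "quasi_local_metric S \<QQ> \<longleftrightarrow>
     (\<exists>Q. quasi_local_cover S Q \<and> \<QQ> = {Q'. quasi_local_equiv S Q Q'})"

definition quasi_local_topology :: "'p metric set set \<Rightarrow> 'p topology" where
  "quasi_local_topology \<QQ> = topology_generated_by
     {mball_of m x r | Q m x r. Q \<in> \<QQ> \<and> m \<in> Q \<and> x \<in> mspace m \<and> r > 0}"

definition strongly_equicontinuous :: "'p topology \<Rightarrow> ('p \<rightharpoonup> 'p) set \<Rightarrow> bool" where
  "strongly_equicontinuous Z H \<longleftrightarrow>
     (\<exists>\<QQ>. quasi_local_metric (topspace Z) \<QQ> \<and> quasi_local_topology \<QQ> = Z \<and>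
       (\<exists>Q\<in>\<QQ>. \<exists>S\<subseteq>H. symmetric_maps S \<and> comp_closed S \<and> generated_pseudogroup Z S = H \<and>
          (\<forall>\<epsilon>>0. \<exists>\<delta>>0. \<forall>h\<in>S. \<forall>m\<in>Q. \<forall>m'\<in>Q. \<forall>x y x' y'.
             x \<in> mspace m \<and> y \<in> mspace m \<and> h x = Some x' \<and> h y = Some y' \<and>
             x' \<in> mspace m' \<and> y' \<in> mspace m' \<and> mdist m x y < \<delta> \<longrightarrow> mdist m' x' y' < \<epsilon>)))"

definition quasi_effective :: "'p topology \<Rightarrow> ('p \<rightharpoonup> 'p) set \<Rightarrow> bool" where
  "quasi_effective Z H \<longleftrightarrow>
     (\<exists>S\<subseteq>H. symmetric_maps S \<and> comp_closed S \<and> generated_pseudogroup Z S = H \<and>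
       (\<forall>h\<in>S. (\<exists>V. openin Z V \<and> V \<noteq> {} \<and> V \<subseteq> dom h \<and> (\<forall>x\<in>V. h x = Some x)) \<longrightarrow>
               (\<forall>x \<in> dom h. h x = Some x)))"


section \<open>Coarse quasi-isometry type\<close>

definition is_net :: "'a set \<Rightarrow> ('a \<Rightarrow> 'a \<Rightarrow> real) \<Rightarrow> 'a set \<Rightarrow> bool" where
  "is_net M d A \<longleftrightarrow> A \<subseteq> M \<and> (\<exists>C>0. \<forall>x\<in>M. \<exists>a\<in>A. d x a < C)"

definition bi_lipschitz_bij ::
    "('a \<Rightarrow> 'a \<Rightarrow> real) \<Rightarrow> ('b \<Rightarrow> 'b \<Rightarrow> real) \<Rightarrow> 'a set \<Rightarrow> 'b set \<Rightarrow> ('a \<Rightarrow> 'b) \<Rightarrow> bool" where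
  "bi_lipschitz_bij d d' A B f \<longleftrightarrow> bij_betw f A B \<and>
     (\<exists>c\<ge>1. \<forall>x\<in>A. \<forall>y\<in>A. d x y / c \<le> d' (f x) (f y) \<and> d' (f x) (f y) \<le> c * d x y)"

definition same_coarse_qi_type ::
    "'a set \<Rightarrow> ('a \<Rightarrow> 'a \<Rightarrow> real) \<Rightarrow> 'b set \<Rightarrow> ('b \<Rightarrow> 'b \<Rightarrow> real) \<Rightarrow> bool" where
  "same_coarse_qi_type M d M' d' \<longleftrightarrow>
     (\<exists>A B f. is_net M d A \<and> is_net M' d' B \<and> bi_lipschitz_bij d d' A B f)"


section \<open>Defining cocycles and holonomy\<close>

record ('x, 'z, 'i) cocycle =
  idx :: "'i set"
  box :: "'i \<Rightarrow> ('x, 'z) flow_box"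
  trans_map :: "'i \<Rightarrow> 'i \<Rightarrow> 'z \<Rightarrow> 'z"

abbreviation cdom :: "('x, 'z, 'i) cocycle \<Rightarrow> 'i \<Rightarrow> 'x set" where
  "cdom C i \<equiv> fb_dom (box C i)"

abbreviation cproj :: "('x, 'z, 'i) cocycle \<Rightarrow> 'i \<Rightarrow> 'x \<Rightarrow> 'z" where
  "cproj C i \<equiv> fb_proj (box C i)"

abbreviation ctrans :: "('x, 'z, 'i) cocycle \<Rightarrow> 'i \<Rightarrow> 'z topology" where
  "ctrans C i \<equiv> fb_trans (box C i)"

definition overlap :: "('x, 'z, 'i) cocycle \<Rightarrow> 'i \<Rightarrow> 'i \<Rightarrow> 'z set" where
  "overlap C i j = cproj C i ` (cdom C i \<inter> cdom C j)"

definition defining_cocycle ::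
    "nat \<Rightarrow> enat \<Rightarrow> 'x topology \<Rightarrow> ('x, 'z) flow_box set \<Rightarrow> ('x, 'w, 'i) cocycle \<Rightarrow> bool" where
  "defining_cocycle n k X \<A> C \<longleftrightarrow>
     foliated_atlas n k X (box C ` idx C) \<and>
     compatible_atlases n k X \<A> (box C ` idx C) \<and>
     (\<forall>i \<in> idx C. \<forall>j \<in> idx C.
        homeomorphic_map (subtopology (ctrans C i) (overlap C i j))
                         (subtopology (ctrans C j) (overlap C j i)) (trans_map C i j) \<and>
        (\<forall>u \<in> cdom C i \<inter> cdom C j. cproj C j u = trans_map C i j (cproj C i u)))"

definition shrinking ::
    "'x topology \<Rightarrow> ('x, 'w, 'i) cocycle \<Rightarrow> ('x, 'w, 'i) cocycle \<Rightarrow> bool" where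
  "shrinking X C C' \<longleftrightarrow>
     idx C = idx C' \<and>
     (\<forall>i \<in> idx C. X closure_of cdom C i \<subseteq> cdom C' i \<and>
                  (\<forall>u \<in> cdom C i. cproj C i u = cproj C' i u))"

definition transversal :: "('x, 'z, 'i) cocycle \<Rightarrow> ('i \<times> 'z) topology" where
  "transversal C = sum_topology (ctrans C) (idx C)"

definition hol_map :: "('x, 'z, 'i) cocycle \<Rightarrow> 'i \<Rightarrow> 'i \<Rightarrow> ('i \<times> 'z \<rightharpoonup> 'i \<times> 'z)" where
  "hol_map C i j =
     (\<lambda>(l, z). if l = i \<and> z \<in> overlap C i j then Some (j, trans_map C i j z) else None)"

definition hol_gens :: "('x, 'z, 'i) cocycle \<Rightarrow> ('i \<times> 'z \<rightharpoonup> 'i \<times> 'z) set" where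
  "hol_gens C = {hol_map C i j | i j. i \<in> idx C \<and> j \<in> idx C}"

definition holonomy :: "('x, 'z, 'i) cocycle \<Rightarrow> ('i \<times> 'z \<rightharpoonup> 'i \<times> 'z) set" where
  "holonomy C = generated_pseudogroup (transversal C) (hol_gens C)"

text \<open>All choices of \<open>i\<close> and \<open>x \<in> L \<inter> U\<^sub>i\<close> give the same orbit when \<open>L\<close> is a leaf.\<close>

definition leaf_orbit :: "('x, 'z, 'i) cocycle \<Rightarrow> 'x set \<Rightarrow> ('i \<times> 'z) set" where
  "leaf_orbit C L = (\<Union>i \<in> idx C. \<Union>x \<in> L \<inter> cdom C i. pg_orbit (holonomy C) (i, cproj C i x))"

text \<open>The isomorphism class of the germ group does not depend on the point of the orbit.\<close>

definition trivial_holonomy_group :: "('x, 'z, 'i) cocycle \<Rightarrow> 'x set \<Rightarrow> bool" where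
  "trivial_holonomy_group C L \<longleftrightarrow>
     (\<exists>x \<in> leaf_orbit C L. trivial_group (germ_group (transversal C) (holonomy C) x))"

definition orbit_dist :: "('x, 'z, 'i) cocycle \<Rightarrow> 'i \<times> 'z \<Rightarrow> 'i \<times> 'z \<Rightarrow> real" where
  "orbit_dist C = gen_dist (transversal C) (hol_gens C)"

end

theory Submission
  imports Defs
begin

text \<open>
  Everything is expressed through chains of points of \<open>X\<close>: two points are joined by a step when they
  lie on a common plaque. On the leaf through \<open>y\<close> the step metric is coarsely the metric of the
  holonomy orbit of \<open>y\<close>, and the shrinking hypothesis together with compactness makes steps for the
  cocycle \<open>C\<close> and steps for a fine finite family of small charts comparable.

  If \<open>y\<close> and \<open>y'\<close> are close and have trivial holonomy, then strong equicontinuity allows every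
  holonomy transformation along a chain from \<open>y\<close> to be defined at \<open>y'\<close> too, with images that stay
  close. Mapping \<open>h y\<close> to \<open>h y'\<close> is well defined, because by quasi-effectiveness a transformation
  that is the identity near \<open>y\<close> is the identity at \<open>y'\<close>; it is a coarse equivalence of the two leaves.
  Points with trivial holonomy are dense by Baire's theorem, so the coarse types occurring near a
  point of \<open>X\<close> are all equal, and the sets of points with a given nearby coarse type split \<open>X\<close>
  into open unions of leaves. Connectedness of the leaf space leaves only one of them.
\<close>

section \<open>Coarse equivalence of graphs\<close>

text \<open>Errors must not accumulate along a chain. Transports therefore form a family closed
  under composition: each composite is compared with its two starting points at once, so a single
  \<delta> serves chains of every length, and the displacement stays below the fixed radius on which
  the next chart change is defined. The hypotheses do not come in one piece. Equicontinuity and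
  quasi-effectiveness each have their own generating family, neither of which has to contain the
  germs of identities, and both concern a cocycle \<open>R\<close> that may differ from the cocycle
  \<open>C\<close> that measures distances. Hence triviality of germs is carried from
  \<open>C\<close> to \<open>R\<close> through points of \<open>X\<close>, and a transport is a map
  controlled by both generating families at once. A point of a leaf lies in several charts, and its
  partner on a nearby leaf is determined only up to a plaque. Coarse equivalences are therefore
  relations, and a map is chosen only at the very end, on a net.\<close>

definition conn_graph :: "'a set \<Rightarrow> ('a \<times> 'a) set \<Rightarrow> bool" where
  "conn_graph M s \<longleftrightarrow> s `` M \<subseteq> M \<and> (\<forall>x\<in>M. (x, x) \<in> s) \<and> sym s \<and> (\<forall>x\<in>M. \<forall>y\<in>M. (x, y) \<in> s\<^sup>*)"

text \<open>Paths of length exactly \<open>c\<close> are used; on a reflexive graph this amounts to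
  length at most \<open>c\<close>. Since \<open>r\<close> is a relation, its converse expresses the
  opposite direction and no quasi-inverse has to be chosen.\<close>

definition coarse_lip :: "('a \<times> 'b) set \<Rightarrow> ('a \<times> 'a) set \<Rightarrow> ('b \<times> 'b) set \<Rightarrow> nat \<Rightarrow> bool" where
  "coarse_lip r s s' c \<longleftrightarrow>
     (\<forall>u u' v v'. (u, u') \<in> r \<longrightarrow> (v, v') \<in> r \<longrightarrow> (u, v) \<in> s \<longrightarrow> (u', v') \<in> s' ^^ c)"

definition coarse_equiv :: "'a set \<Rightarrow> ('a \<times> 'a) set \<Rightarrow> 'b set \<Rightarrow> ('b \<times> 'b) set \<Rightarrow> bool" where
  "coarse_equiv M s M' s' \<longleftrightarrow>
     (\<exists>r c. Domain r = M \<and> Range r = M' \<and> coarse_lip r s s' c \<and> coarse_lip (r\<inverse>) s' s c)"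

definition graph_dist :: "('a \<times> 'a) set \<Rightarrow> 'a \<Rightarrow> 'a \<Rightarrow> nat" where
  "graph_dist s x y = (LEAST m. (x, y) \<in> s ^^ m)"

lemma relpow_join: "(x, y) \<in> r ^^ k \<Longrightarrow> (y, z) \<in> r ^^ l \<Longrightarrow> (x, z) \<in> r ^^ (k + l)"
  by (auto simp: relpow_add)

lemma relpow_closed:
  assumes "s `` M \<subseteq> M" "x \<in> M" "(x, y) \<in> s ^^ k"
  shows "y \<in> M"
  using assms(3) by (induction k arbitrary: y) (use assms in auto)

lemma relpow_refl_mono:
  assumes "\<And>x. x \<in> M \<Longrightarrow> (x, x) \<in> s" "s `` M \<subseteq> M" "x \<in> M" "(x, y) \<in> s ^^ k" "k \<le> l"
  shows "(x, y) \<in> s ^^ l"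
  using assms(5)
proof (induction l rule: dec_induct)
  case (step l)
  have "y \<in> M" by (rule relpow_closed[OF assms(2-4)])
  then show ?case using step assms(1) by auto
qed (use assms in auto)

lemma sym_relpow: "sym s \<Longrightarrow> sym (s ^^ k)"
proof (induction k)
  case (Suc k)
  show ?case
  proof (rule symI)
    fix a b assume "(a, b) \<in> s ^^ Suc k"
    then obtain c where "(a, c) \<in> s ^^ k" "(c, b) \<in> s" by auto
    then have "(b, c) \<in> s" "(c, a) \<in> s ^^ k" using Suc by (auto dest: symD)
    then show "(b, a) \<in> s ^^ Suc k" by (rule relpow_Suc_I2)
  qed
qed (auto simp: sym_def)

lemma sym_coarse_equiv: "coarse_equiv M s M' s' \<Longrightarrow> coarse_equiv M' s' M s"
  unfolding coarse_equiv_def by (metis Domain_converse Range_converse converse_converse)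

text \<open>The factor \<open>Suc k\<close> instead of \<open>k\<close> pays for the ambiguity of
  \<open>r\<close>: already for \<open>k = 0\<close> the points \<open>u'\<close> and
  \<open>v'\<close> may be different partners of one point, and only the loop at that point bounds
  their distance.\<close>

lemma coarse_lip_relpow:
  assumes lip: "coarse_lip r s s' c" and dom: "Domain r = M" and M: "s `` M \<subseteq> M"
    and refl: "\<And>x. x \<in> M \<Longrightarrow> (x, x) \<in> s"
    and "(u, u') \<in> r" "(v, v') \<in> r" "(u, v) \<in> s ^^ k"
  shows "(u', v') \<in> s' ^^ (c * Suc k)"
  using assms(6,7)
proof (induction k arbitrary: v v')
  case 0
  then have "(u, v) \<in> s" using refl assms(5) dom by auto
  then show ?case using lip 0 assms(5) unfolding coarse_lip_def by auto
next
  case (Suc k)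
  then obtain w where w: "(u, w) \<in> s ^^ k" "(w, v) \<in> s" by auto
  have "w \<in> M" using relpow_closed[OF M _ w(1)] assms(5) dom by auto
  then obtain w' where w': "(w, w') \<in> r" using dom by auto
  have "(u', w') \<in> s' ^^ (c * Suc k)" using Suc.IH[OF w' w(1)] .
  moreover have "(w', v') \<in> s' ^^ c" using lip w(2) w' Suc.prems(1) unfolding coarse_lip_def by auto
  ultimately have "(u', v') \<in> s' ^^ (c * Suc k + c)" by (rule relpow_join)
  then show ?case by (simp add: algebra_simps)
qed

lemma coarse_lip_mono:
  assumes "coarse_lip r s s' c" "c \<le> d" "conn_graph M' s'" "Range r \<subseteq> M'"
  shows "coarse_lip r s s' d"
  using assms unfolding coarse_lip_def conn_graph_def
  by (meson Range.intros relpow_refl_mono subsetD)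

lemma coarse_lip_trans:
  assumes "coarse_lip r s s' c" "coarse_lip r' s' s'' c'"
    and "conn_graph M' s'" "Domain r' = M'"
  shows "coarse_lip (r O r') s s'' (c' * Suc c)"
  unfolding coarse_lip_def
proof (intro allI impI)
  fix u u' v v' assume "(u, u') \<in> r O r'" "(v, v') \<in> r O r'" "(u, v) \<in> s"
  then obtain a b where "(u, a) \<in> r" "(a, u') \<in> r'" "(v, b) \<in> r" "(b, v') \<in> r'" by auto
  moreover have "(a, b) \<in> s' ^^ c" using assms(1) calculation \<open>(u, v) \<in> s\<close> unfolding coarse_lip_def by auto
  ultimately show "(u', v') \<in> s'' ^^ (c' * Suc c)"
    using coarse_lip_relpow[OF assms(2,4)] assms(3) unfolding conn_graph_def by auto
qed

lemma coarse_equiv_trans: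
  assumes "coarse_equiv M s M' s'" "coarse_equiv M' s' M'' s''"
    and g: "conn_graph M s" "conn_graph M' s'" "conn_graph M'' s''"
  shows "coarse_equiv M s M'' s''"
proof -
  obtain r c where r: "Domain r = M" "Range r = M'" "coarse_lip r s s' c" "coarse_lip (r\<inverse>) s' s c"
    using assms(1) unfolding coarse_equiv_def by auto
  obtain r' c' where r': "Domain r' = M'" "Range r' = M''" "coarse_lip r' s' s'' c'" "coarse_lip (r'\<inverse>) s'' s' c'"
    using assms(2) unfolding coarse_equiv_def by auto
  define d where "d = max (c' * Suc c) (c * Suc c')"
  have 1: "Domain (r O r') = M" "Range (r O r') = M''" using r(1,2) r'(1,2) by blast+
  have "coarse_lip (r O r') s s'' d"
    by (rule coarse_lip_mono[OF coarse_lip_trans[OF r(3) r'(3) g(2) r'(1)] _ g(3)])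
      (use 1 in \<open>auto simp: d_def\<close>)
  moreover have "coarse_lip ((r'\<inverse>) O (r\<inverse>)) s'' s d"
    by (rule coarse_lip_mono[OF coarse_lip_trans[OF r'(4) r(4) g(2)] _ g(1)])
      (use r r' in \<open>auto simp: d_def\<close>)
  ultimately show ?thesis using 1 unfolding coarse_equiv_def by (metis converse_relcomp)
qed

lemma graph_dist_le: "(x, y) \<in> s ^^ m \<Longrightarrow> graph_dist s x y \<le> m"
  unfolding graph_dist_def by (rule Least_le)

lemma graph_dist_relpow:
  assumes "conn_graph M s" "x \<in> M" "y \<in> M"
  shows "(x, y) \<in> s ^^ graph_dist s x y"
proof -
  have "(x, y) \<in> s\<^sup>*" using assms unfolding conn_graph_def by auto
  then show ?thesis unfolding graph_dist_def by (metis LeastI rtrancl_imp_relpow)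
qed

lemma graph_dist_eq_0: "graph_dist s x x = 0"
  using graph_dist_le[where m = 0] by fastforce

lemma graph_dist_pos:
  assumes "conn_graph M s" "x \<in> M" "y \<in> M" "x \<noteq> y"
  shows "0 < graph_dist s x y"
  using graph_dist_relpow[OF assms(1-3)] assms(4) by (cases "graph_dist s x y") auto

lemma graph_dist_commute: "sym s \<Longrightarrow> graph_dist s x y = graph_dist s y x"
  unfolding graph_dist_def by (metis sym_relpow symD)

text \<open>Zorn's lemma: a maximal separated set is automatically a net. Both \<open>d x a\<close>
  and \<open>d a x\<close> occur because symmetry of \<open>d\<close> is not assumed here.\<close>

lemma exists_maximal_separated:
  fixes d :: "'a \<Rightarrow> 'a \<Rightarrow> nat"
  obtains A where "A \<subseteq> M" "\<And>x y. x \<in> A \<Longrightarrow> y \<in> A \<Longrightarrow> x \<noteq> y \<Longrightarrow> K < d x y"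
    "\<And>x. x \<in> M \<Longrightarrow> x \<notin> A \<Longrightarrow> \<exists>a\<in>A. d x a \<le> K \<or> d a x \<le> K"
proof -
  define F where "F = {A. A \<subseteq> M \<and> (\<forall>x\<in>A. \<forall>y\<in>A. x \<noteq> y \<longrightarrow> K < d x y)}"
  have "\<exists>A\<in>F. \<forall>B\<in>F. A \<subseteq> B \<longrightarrow> B = A"
  proof (rule subset_Zorn')
    fix \<C> assume "subset.chain F \<C>"
    then have sub: "\<C> \<subseteq> F" and lin: "\<And>A B. A \<in> \<C> \<Longrightarrow> B \<in> \<C> \<Longrightarrow> A \<subseteq> B \<or> B \<subseteq> A"
      by (auto simp: subset.chain_def)
    have "K < d x y" if xy: "x \<in> \<Union>\<C>" "y \<in> \<Union>\<C>" "x \<noteq> y" for x y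
    proof -
      obtain A where "A \<in> \<C>" "x \<in> A" "y \<in> A" using xy(1,2) lin by blast
      then show ?thesis using sub xy(3) unfolding F_def by blast
    qed
    moreover have "\<Union>\<C> \<subseteq> M" using sub unfolding F_def by blast
    ultimately show "\<Union>\<C> \<in> F" by (simp add: F_def)
  qed
  then obtain A where A: "A \<in> F" "\<And>B. B \<in> F \<Longrightarrow> A \<subseteq> B \<Longrightarrow> B = A" by blast
  show ?thesis
  proof
    show "A \<subseteq> M" "\<And>x y. x \<in> A \<Longrightarrow> y \<in> A \<Longrightarrow> x \<noteq> y \<Longrightarrow> K < d x y" using A(1) by (auto simp: F_def)
    show "\<exists>a\<in>A. d x a \<le> K \<or> d a x \<le> K" if "x \<in> M" "x \<notin> A" for x
    proof (rule ccontr)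
      assume "\<not> ?thesis"
      then have "insert x A \<in> F" using that A(1) unfolding F_def by (auto simp: not_le)
      then show False using A(2)[of "insert x A"] that by auto
    qed
  qed
qed

text \<open>The net is a maximal set \<open>A\<close> of points more than \<open>c\<close> apart.
  Two points of \<open>A\<close> with the same partner would be at distance at most
  \<open>c * Suc 0\<close>, so every selection \<open>f\<close> from \<open>r\<close> is injective
  on \<open>A\<close>.\<close>

lemma coarse_equiv_imp_same_coarse_qi_type:
  assumes ce: "coarse_equiv M s M' s'" and g: "conn_graph M s" "conn_graph M' s'"
    and d: "\<And>x y. x \<in> M \<Longrightarrow> y \<in> M \<Longrightarrow> d x y = real (graph_dist s x y)"
    and d': "\<And>x y. x \<in> M' \<Longrightarrow> y \<in> M' \<Longrightarrow> d' x y = real (graph_dist s' x y)"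
  shows "same_coarse_qi_type M d M' d'"
proof -
  obtain r c where r: "Domain r = M" "Range r = M'" "coarse_lip r s s' c" "coarse_lip (r\<inverse>) s' s c"
    using ce unfolding coarse_equiv_def by auto
  have up: "graph_dist s' u' v' \<le> c * Suc (graph_dist s u v)" if "(u, u') \<in> r" "(v, v') \<in> r" for u u' v v'
    using coarse_lip_relpow[OF r(3,1)] graph_dist_relpow[OF g(1)] g(1) that r(1)
    unfolding conn_graph_def by (intro graph_dist_le) blast
  have lo: "graph_dist s u v \<le> c * Suc (graph_dist s' u' v')" if "(u, u') \<in> r" "(v, v') \<in> r" for u u' v v'
  proof -
    have "(u', v') \<in> s' ^^ graph_dist s' u' v'" using graph_dist_relpow[OF g(2)] that r by auto
    then show ?thesis
      using coarse_lip_relpow[OF r(4)] g(2) that r(1,2)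
      unfolding conn_graph_def by (intro graph_dist_le) (metis Domain_converse converse_iff)
  qed
  obtain A where A: "A \<subseteq> M" "\<And>x y. x \<in> A \<Longrightarrow> y \<in> A \<Longrightarrow> x \<noteq> y \<Longrightarrow> c < graph_dist s x y"
    "\<And>x. x \<in> M \<Longrightarrow> x \<notin> A \<Longrightarrow> \<exists>a\<in>A. graph_dist s x a \<le> c \<or> graph_dist s a x \<le> c"
    using exists_maximal_separated[of M c "graph_dist s"] by metis
  have "\<forall>x\<in>M. \<exists>x'. (x, x') \<in> r" using r(1) by auto
  then obtain f where f: "\<And>x. x \<in> M \<Longrightarrow> (x, f x) \<in> r" by metis
  then have fM: "f x \<in> M'" if "x \<in> M" for x using that r(2) by auto
  have inj: "inj_on f A"
  proof (rule inj_onI, rule ccontr)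
    fix x y assume xy: "x \<in> A" "y \<in> A" "f x = f y" "x \<noteq> y"
    then have "graph_dist s x y \<le> c * Suc (graph_dist s' (f x) (f y))" using lo f A(1) by blast
    then show False using A(2) xy by (fastforce simp: graph_dist_eq_0)
  qed
  have net: "\<exists>a\<in>A. graph_dist s x a \<le> c" if "x \<in> M" for x
  proof (cases "x \<in> A")
    case True then show ?thesis using graph_dist_eq_0[of s x] by (metis le0)
  next
    case False
    then show ?thesis using A(3)[OF that] graph_dist_commute[of s] g(1) unfolding conn_graph_def by metis
  qed
  have "is_net M d A"
  proof -
    have "\<exists>a\<in>A. d x a < real c + 1" if "x \<in> M" for x
      using net[OF that] d that A(1) by (metis le_imp_less_Suc of_nat_Suc of_nat_less_iff add.commute subsetD)
    then show ?thesis unfolding is_net_def using A(1) by (intro conjI exI[of _ "real c + 1"]) auto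
  qed
  moreover have "is_net M' d' (f ` A)"
  proof -
    have "\<exists>b\<in>f`A. d' x' b < real (c * Suc c) + 1" if x': "x' \<in> M'" for x'
    proof -
      obtain x where x: "(x, x') \<in> r" using x' r(2) by blast
      then have "x \<in> M" using r(1) by auto
      then obtain a where a: "a \<in> A" "graph_dist s x a \<le> c" using net by auto
      have "graph_dist s' x' (f a) \<le> c * Suc (graph_dist s x a)" using up x f a A(1) by blast
      also have "\<dots> \<le> c * Suc c" using a by (intro mult_le_mono) auto
      finally have "real (graph_dist s' x' (f a)) < real (c * Suc c) + 1"
        by (metis add.commute le_imp_less_Suc of_nat_Suc of_nat_less_iff)
      then show ?thesis using d'[OF x' fM] a(1) A(1) by (metis imageI subsetD)
    qed
    moreover have "f ` A \<subseteq> M'" using fM A(1) by auto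
    ultimately show ?thesis unfolding is_net_def by (intro conjI exI[of _ "real (c * Suc c) + 1"]) (auto intro!: add_nonneg_pos simp del: mult_Suc_right of_nat_mult)
  qed
  moreover have "bi_lipschitz_bij d d' A (f ` A) f"
    unfolding bi_lipschitz_bij_def
  proof (intro conjI exI[of _ "real (2 * c + 1)"] ballI)
    show "bij_betw f A (f ` A)" using inj by (simp add: bij_betw_def)
    show "1 \<le> real (2 * c + 1)" by simp
    fix x y assume xy: "x \<in> A" "y \<in> A"
    then have M: "x \<in> M" "y \<in> M" using A(1) by auto
    have "graph_dist s x y \<le> (2 * c + 1) * graph_dist s' (f x) (f y) \<and>
          graph_dist s' (f x) (f y) \<le> (2 * c + 1) * graph_dist s x y"
    proof (cases "x = y")
      case False
      \<comment> \<open>Both distances are integers and positive, so the additive constant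
        \<open>c\<close> is at most \<open>c * ?k\<close> and \<open>c * ?l\<close>. This turns the
        coarse bounds into the factor \<open>2 * c\<close>; the extra 1 keeps the constant at least
        1 when \<open>c = 0\<close>.\<close>
      let ?k = "graph_dist s x y" and ?l = "graph_dist s' (f x) (f y)"
      have "f x \<noteq> f y" using False inj xy by (auto dest: inj_onD)
      then have "0 < ?l" "0 < ?k" using graph_dist_pos g fM M False by metis+
      then have "c \<le> c * ?l" "c \<le> c * ?k" by auto
      moreover have "?k \<le> c * ?l + c" "?l \<le> c * ?k + c" using lo up f M by (fastforce simp: add.commute)+
      ultimately have "?k \<le> 2 * (c * ?l)" "?l \<le> 2 * (c * ?k)" by linarith+
      then show ?thesis by (simp add: algebra_simps)
    qed (simp add: graph_dist_eq_0)
    then have "real (graph_dist s x y) \<le> real (2 * c + 1) * real (graph_dist s' (f x) (f y))"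
      "real (graph_dist s' (f x) (f y)) \<le> real (2 * c + 1) * real (graph_dist s x y)"
      by (metis of_nat_le_iff of_nat_mult)+
    then show "d x y / real (2 * c + 1) \<le> d' (f x) (f y)" "d' (f x) (f y) \<le> real (2 * c + 1) * d x y"
      using d[OF M] d'[OF fM fM, OF M] by (simp_all add: divide_le_eq mult.commute)
  qed
  ultimately show ?thesis unfolding same_coarse_qi_type_def by blast
qed

section \<open>Equicontinuous chains\<close>

text \<open>The metric core, free of topology: \<open>q a\<close> is the transverse coordinate of
  the chart \<open>N a\<close> and \<open>S\<close> the set of transports. The radius
  \<open>\<epsilon>0\<close> is uniform over charts and points, \<open>T\<close> holds the points at
  which a return map is forced to be the identity, and \<open>c\<close> is the number of steps that
  replace a plaque of \<open>N a\<close>. The relation spelled out in \<open>outer\<close> is the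
  one named \<open>Vstep\<close> below.\<close>

locale equicontinuous_chains =
  fixes A :: "'a set" and W V N :: "'a \<Rightarrow> 'x set" and q :: "'a \<Rightarrow> 'x \<Rightarrow> 't"
    and dst :: "'a \<Rightarrow> 't \<Rightarrow> 't \<Rightarrow> real" and S :: "('t \<rightharpoonup> 't) set" and T :: "'x set" and c :: nat
    and \<epsilon>0 :: real
  assumes nested: "\<And>a. a \<in> A \<Longrightarrow> W a \<subseteq> V a" "\<And>a. a \<in> A \<Longrightarrow> V a \<subseteq> N a"
    and cover: "\<And>a. a \<in> A \<Longrightarrow> V a \<subseteq> (\<Union>a\<in>A. W a)"
    and dst_commute: "\<And>a t t'. dst a t t' = dst a t' t"
    and S_comp: "\<And>f g. f \<in> S \<Longrightarrow> g \<in> S \<Longrightarrow> f \<circ>\<^sub>m g \<in> S"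
    and S_inj: "\<And>f t t' s. f \<in> S \<Longrightarrow> f t = Some s \<Longrightarrow> f t' = Some s \<Longrightarrow> t = t'"
    and equicont: "\<And>\<epsilon>. \<epsilon> > 0 \<Longrightarrow> \<exists>\<delta>>0. \<forall>h\<in>S. \<forall>a\<in>A. \<forall>b\<in>A. \<forall>x\<in>N a. \<forall>y\<in>N a. \<forall>x'\<in>N b. \<forall>y'\<in>N b.
        h (q a x) = Some (q b x') \<longrightarrow> h (q a y) = Some (q b y') \<longrightarrow> dst a (q a x) (q a y) < \<delta> \<longrightarrow>
        dst b (q b x') (q b y') < \<epsilon>"
    and \<epsilon>0_pos: "\<epsilon>0 > 0"
    and transition: "\<And>a b x. a \<in> A \<Longrightarrow> b \<in> A \<Longrightarrow> x \<in> V a \<Longrightarrow> x \<in> V b \<Longrightarrow>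
        \<exists>s\<in>S. s (q a x) = Some (q b x) \<and> (\<forall>u\<in>N a. dst a (q a x) (q a u) < \<epsilon>0 \<longrightarrow>
           (\<exists>w \<in> N a \<inter> N b. q a w = q a u \<and> s (q a u) = Some (q b w)))"
    and inner: "\<And>a x u. a \<in> A \<Longrightarrow> x \<in> W a \<Longrightarrow> u \<in> N a \<Longrightarrow> dst a (q a x) (q a u) < \<epsilon>0 \<Longrightarrow>
        \<exists>w\<in>V a. q a w = q a u"
    and rigid: "\<And>f a y t. f \<in> S \<Longrightarrow> a \<in> A \<Longrightarrow> y \<in> T \<Longrightarrow> y \<in> V a \<Longrightarrow> f (q a y) = Some (q a y) \<Longrightarrow>
        t \<in> dom f \<Longrightarrow> f t = Some t"
    and outer: "\<And>a x y. a \<in> A \<Longrightarrow> x \<in> N a \<Longrightarrow> y \<in> N a \<Longrightarrow> q a x = q a y \<Longrightarrow>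
        (x, y) \<in> {(x, y). \<exists>a\<in>A. x \<in> V a \<and> y \<in> V a \<and> q a x = q a y} ^^ c"
begin

definition Vstep :: "('x \<times> 'x) set" where
  "Vstep = {(x, y). \<exists>a\<in>A. x \<in> V a \<and> y \<in> V a \<and> q a x = q a y}"

lemma Nstep: "a \<in> A \<Longrightarrow> x \<in> N a \<Longrightarrow> y \<in> N a \<Longrightarrow> q a x = q a y \<Longrightarrow> (x, y) \<in> Vstep ^^ c"
  unfolding Vstep_def by (rule outer)

lemma Nstep_rtrancl: "a \<in> A \<Longrightarrow> x \<in> N a \<Longrightarrow> y \<in> N a \<Longrightarrow> q a x = q a y \<Longrightarrow> (x, y) \<in> Vstep\<^sup>*"
  using Nstep relpow_imp_rtrancl by metis

text \<open>Induction on the length, lengthening the chain at its end. The composite transport is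
  again in \<open>S\<close>, so equicontinuity bounds the distance at the end by
  \<open>\<epsilon>0\<close> whatever the length, and \<open>\<epsilon>0\<close> is exactly the room
  in which the next \<open>transition\<close> is defined.\<close>

lemma extend_chain:
  obtains \<delta> where "\<delta> > 0"
    "\<And>x x' a b. (x, x') \<in> Vstep\<^sup>* \<Longrightarrow> a \<in> A \<Longrightarrow> b \<in> A \<Longrightarrow> x \<in> V a \<Longrightarrow> x' \<in> V b \<Longrightarrow>
       \<exists>f\<in>S. f (q a x) = Some (q b x') \<and> (\<forall>u\<in>N a. dst a (q a x) (q a u) < \<delta> \<longrightarrow>
          (\<exists>w\<in>N b. f (q a u) = Some (q b w) \<and> dst b (q b x') (q b w) < \<epsilon>0 \<and> (u, w) \<in> Vstep\<^sup>*))"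
proof -
  obtain \<delta>' where \<delta>': "\<delta>' > 0" and eq: "\<And>h a b x y x' y'. h \<in> S \<Longrightarrow> a \<in> A \<Longrightarrow> b \<in> A \<Longrightarrow> x \<in> N a \<Longrightarrow> y \<in> N a \<Longrightarrow>
      x' \<in> N b \<Longrightarrow> y' \<in> N b \<Longrightarrow> h (q a x) = Some (q b x') \<Longrightarrow> h (q a y) = Some (q b y') \<Longrightarrow>
      dst a (q a x) (q a y) < \<delta>' \<Longrightarrow> dst b (q b x') (q b y') < \<epsilon>0"
    using equicont[OF \<epsilon>0_pos] by blast
  \<comment> \<open>\<open>\<delta>'\<close> keeps the images of all transports within
    \<open>\<epsilon>0\<close>; \<open>\<epsilon>0\<close> itself is the room for the very first
    transition.\<close>
  define \<delta> where "\<delta> = min \<delta>' \<epsilon>0"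
  have "\<exists>f\<in>S. f (q a x) = Some (q b x') \<and> (\<forall>u\<in>N a. dst a (q a x) (q a u) < \<delta> \<longrightarrow>
          (\<exists>w\<in>N b. f (q a u) = Some (q b w) \<and> dst b (q b x') (q b w) < \<epsilon>0 \<and> (u, w) \<in> Vstep\<^sup>*))"
    if "(x, x') \<in> Vstep ^^ k" "a \<in> A" "b \<in> A" "x \<in> V a" "x' \<in> V b" for k x x' a b
    using that
  proof (induction k arbitrary: x' b)
    case 0
    then have [simp]: "x' = x" by simp
    obtain s where s: "s \<in> S" "s (q a x) = Some (q b x)" "\<And>u. u \<in> N a \<Longrightarrow> dst a (q a x) (q a u) < \<epsilon>0 \<Longrightarrow>
           (\<exists>w \<in> N a \<inter> N b. q a w = q a u \<and> s (q a u) = Some (q b w))"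
      using transition[of a b x] 0 by auto
    show ?case
    proof (intro bexI[of _ s] conjI ballI impI)
      fix u assume u: "u \<in> N a" "dst a (q a x) (q a u) < \<delta>"
      then obtain w where w: "w \<in> N a" "w \<in> N b" "q a w = q a u" "s (q a u) = Some (q b w)"
        using s(3)[of u] by (auto simp: \<delta>_def)
      have "dst b (q b x) (q b w) < \<epsilon>0"
        using eq[OF s(1), of a b x u x w] 0 nested s(2) w u by (auto simp: \<delta>_def)
      then show "\<exists>w\<in>N b. s (q a u) = Some (q b w) \<and> dst b (q b x') (q b w) < \<epsilon>0 \<and> (u, w) \<in> Vstep\<^sup>*"
        using w Nstep_rtrancl[of a u w] 0 u by auto
    qed (use s in auto)
  next
    case (Suc k)
    then obtain y e where y: "(x, y) \<in> Vstep ^^ k" "e \<in> A" "y \<in> V e" "x' \<in> V e" "q e y = q e x'"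
      by (auto simp: Vstep_def)
    obtain f where f: "f \<in> S" "f (q a x) = Some (q e y)" "\<And>u. u\<in>N a \<Longrightarrow> dst a (q a x) (q a u) < \<delta> \<Longrightarrow>
          (\<exists>w\<in>N e. f (q a u) = Some (q e w) \<and> dst e (q e y) (q e w) < \<epsilon>0 \<and> (u, w) \<in> Vstep\<^sup>*)"
      using Suc.IH[OF y(1) \<open>a \<in> A\<close> y(2) \<open>x \<in> V a\<close> y(3)] by auto
    obtain s where s: "s \<in> S" "s (q e x') = Some (q b x')" "\<And>u. u \<in> N e \<Longrightarrow> dst e (q e x') (q e u) < \<epsilon>0 \<Longrightarrow>
           (\<exists>w \<in> N e \<inter> N b. q e w = q e u \<and> s (q e u) = Some (q b w))"
      using transition[of e b x'] Suc.prems y by auto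
    have sf: "s \<circ>\<^sub>m f \<in> S" "(s \<circ>\<^sub>m f) (q a x) = Some (q b x')"
      using S_comp s f y by (auto simp: map_comp_def)
    show ?case
    proof (intro bexI[OF _ sf(1)] conjI ballI impI sf(2))
      fix u assume u: "u \<in> N a" "dst a (q a x) (q a u) < \<delta>"
      then obtain w where w: "w \<in> N e" "f (q a u) = Some (q e w)" "dst e (q e y) (q e w) < \<epsilon>0" "(u, w) \<in> Vstep\<^sup>*"
        using f(3) by blast
      then obtain w' where w': "w' \<in> N e" "w' \<in> N b" "q e w' = q e w" "s (q e w) = Some (q b w')"
        using s(3)[of w] y by auto
      have sfu: "(s \<circ>\<^sub>m f) (q a u) = Some (q b w')" using w w' by (auto simp: map_comp_def)
      \<comment> \<open>Equicontinuity is applied to the whole composite and the initial distance.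
        Applied to \<open>s\<close> alone it would give a bound that deteriorates with every
        step.\<close>
      have "dst b (q b x') (q b w') < \<epsilon>0"
        using eq[OF sf(1) _ _ _ _ _ _ sf(2) sfu] Suc.prems nested w' u unfolding \<delta>_def by force
      moreover have "(u, w') \<in> Vstep\<^sup>*" using w(4) Nstep_rtrancl[of e w w'] w w' y by auto
      ultimately show "\<exists>w\<in>N b. (s \<circ>\<^sub>m f) (q a u) = Some (q b w) \<and> dst b (q b x') (q b w) < \<epsilon>0 \<and> (u, w) \<in> Vstep\<^sup>*"
        using w' sfu by auto
    qed
  qed
  then show ?thesis
    using that[of \<delta>] \<delta>' \<epsilon>0_pos rtrancl_imp_relpow unfolding \<delta>_def by (metis min_less_iff_conj)
qed

lemma Vstep_sym: "sym Vstep"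
  by (auto simp: Vstep_def sym_def)

lemma Vstep_closed: "x \<in> V a \<Longrightarrow> a \<in> A \<Longrightarrow> (x, y) \<in> Vstep\<^sup>* \<Longrightarrow> \<exists>b\<in>A. y \<in> W b"
proof -
  assume "x \<in> V a" "a \<in> A" and xy: "(x, y) \<in> Vstep\<^sup>*"
  from xy have "\<exists>b\<in>A. y \<in> V b" by cases (use \<open>x \<in> V a\<close> \<open>a \<in> A\<close> in \<open>auto simp: Vstep_def\<close>)
  then show ?thesis using cover by blast
qed

text \<open>The correspondence sending \<open>h y\<close> to \<open>h y'\<close>, read off in a
  chart that contains both images; \<open>h\<close> and the chart vary freely. Exchanging
  \<open>y\<close> and \<open>y'\<close> gives the converse relation, so one estimate will serve
  both directions.\<close>

definition follow :: "'a \<Rightarrow> 'x \<Rightarrow> 'x \<Rightarrow> ('x \<times> 'x) set" where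
  "follow a y y' = {(x, x'). (y, x) \<in> Vstep\<^sup>* \<and> (y', x') \<in> Vstep\<^sup>* \<and>
     (\<exists>b\<in>A. \<exists>h\<in>S. x \<in> V b \<and> x' \<in> V b \<and> h (q a y) = Some (q b x) \<and> h (q a y') = Some (q b x'))}"

lemma follow_converse: "(follow a y y')\<inverse> = follow a y' y"
  unfolding follow_def by fast

text \<open>The domain is the whole chain class because every transport from \<open>y\<close>
  extends to \<open>y'\<close>, and \<open>inner\<close> brings the image back into
  \<open>V b\<close>. For the Lipschitz bound, neighbours \<open>u\<close> and \<open>v\<close> are
  viewed in a common chart \<open>e\<close>: replacing \<open>u'\<close> by a point of
  \<open>N e\<close>, crossing a plaque of \<open>N e\<close>, and returning to \<open>v'\<close>
  cost \<open>c\<close> steps each.\<close>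

lemma follow_coarse:
  obtains \<delta> where "\<delta> > 0"
    "\<And>a y y'. a \<in> A \<Longrightarrow> y \<in> V a \<Longrightarrow> y' \<in> V a \<Longrightarrow> y \<in> T \<Longrightarrow> dst a (q a y) (q a y') < \<delta> \<Longrightarrow>
       Domain (follow a y y') = Vstep\<^sup>* `` {y} \<and> coarse_lip (follow a y y') Vstep Vstep (c + (c + c))"
proof -
  obtain \<delta>0 where \<delta>0: "\<delta>0 > 0" and ext: "\<And>x x' a b. (x, x') \<in> Vstep\<^sup>* \<Longrightarrow> a \<in> A \<Longrightarrow> b \<in> A \<Longrightarrow> x \<in> V a \<Longrightarrow> x' \<in> V b \<Longrightarrow>
       \<exists>f\<in>S. f (q a x) = Some (q b x') \<and> (\<forall>u\<in>N a. dst a (q a x) (q a u) < \<delta>0 \<longrightarrow>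
          (\<exists>w\<in>N b. f (q a u) = Some (q b w) \<and> dst b (q b x') (q b w) < \<epsilon>0 \<and> (u, w) \<in> Vstep\<^sup>*))"
    using extend_chain by blast
  \<comment> \<open>Below \<open>\<epsilon>0\<close> the change to the chart \<open>e\<close> is
    defined at the partner point; below \<open>\<delta>0\<close> the transport from \<open>e\<close>
    back to the chart \<open>a\<close> is defined there as well.\<close>
  define \<epsilon>1 where "\<epsilon>1 = min \<delta>0 \<epsilon>0"
  have "\<epsilon>1 > 0" using \<delta>0 \<epsilon>0_pos by (auto simp: \<epsilon>1_def)
  then obtain \<delta>' where \<delta>': "\<delta>' > 0" and eq: "\<And>h a b x y x' y'. h \<in> S \<Longrightarrow> a \<in> A \<Longrightarrow> b \<in> A \<Longrightarrow> x \<in> N a \<Longrightarrow> y \<in> N a \<Longrightarrow>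
      x' \<in> N b \<Longrightarrow> y' \<in> N b \<Longrightarrow> h (q a x) = Some (q b x') \<Longrightarrow> h (q a y) = Some (q b y') \<Longrightarrow>
      dst a (q a x) (q a y) < \<delta>' \<Longrightarrow> dst b (q b x') (q b y') < \<epsilon>1"
    using equicont[of \<epsilon>1] by blast
  define \<delta> where "\<delta> = min \<delta>' \<delta>0"
  have "Domain (follow a y y') = Vstep\<^sup>* `` {y} \<and> coarse_lip (follow a y y') Vstep Vstep (c + (c + c))"
    if a: "a \<in> A" "y \<in> V a" "y' \<in> V a" "y \<in> T" "dst a (q a y) (q a y') < \<delta>" for a y y'
  proof
    have "x \<in> Domain (follow a y y')" if yx: "(y, x) \<in> Vstep\<^sup>*" for x
    proof -
      obtain b where b: "b \<in> A" "x \<in> W b" using Vstep_closed a yx by blast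
      then have xV: "x \<in> V b" using nested by auto
      obtain f where f: "f \<in> S" "f (q a y) = Some (q b x)" "\<And>u. u \<in> N a \<Longrightarrow> dst a (q a y) (q a u) < \<delta>0 \<Longrightarrow>
          (\<exists>w\<in>N b. f (q a u) = Some (q b w) \<and> dst b (q b x) (q b w) < \<epsilon>0 \<and> (u, w) \<in> Vstep\<^sup>*)"
        using ext[OF yx a(1) b(1) a(2) xV] by blast
      obtain w where w: "w \<in> N b" "f (q a y') = Some (q b w)" "dst b (q b x) (q b w) < \<epsilon>0" "(y', w) \<in> Vstep\<^sup>*"
        using f(3)[of y'] a nested(2) unfolding \<delta>_def by auto
      obtain x' where x': "x' \<in> V b" "q b x' = q b w" using inner[OF b w(1,3)] by auto
      have "(y', x') \<in> Vstep\<^sup>*" using w(4) Nstep_rtrancl[of b w x'] b w x' nested by fastforce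
      then have "(x, x') \<in> follow a y y'"
        unfolding follow_def using yx b f(1,2) w(2) x' xV by (auto intro!: bexI[of _ b] bexI[of _ f])
      then show ?thesis by auto
    qed
    then show "Domain (follow a y y') = Vstep\<^sup>* `` {y}" by (auto simp: follow_def)
    show "coarse_lip (follow a y y') Vstep Vstep (c + (c + c))"
      unfolding coarse_lip_def
    proof (intro allI impI)
      fix u u' v v' assume uu: "(u, u') \<in> follow a y y'" and vv: "(v, v') \<in> follow a y y'" and "(u, v) \<in> Vstep"
      then obtain e where e: "e \<in> A" "u \<in> V e" "v \<in> V e" "q e u = q e v" unfolding Vstep_def by auto
      \<comment> \<open>The partner of a point of \<open>V e\<close> may leave \<open>V e\<close>,
        but it stays in \<open>N e\<close>; this is the room for which the larger charts
        exist.\<close>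
      have slide: "\<exists>h u1. h \<in> S \<and> u1 \<in> N e \<and> h (q a y) = Some (q e u) \<and> h (q a y') = Some (q e u1)
          \<and> (u', u1) \<in> Vstep ^^ c \<and> dst e (q e u) (q e u1) < \<delta>0"
        if uu: "(u, u') \<in> follow a y y'" and ue: "u \<in> V e" for u u'
      proof -
        obtain b h where b: "b \<in> A" "h \<in> S" "u \<in> V b" "u' \<in> V b" "h (q a y) = Some (q b u)" "h (q a y') = Some (q b u')"
          using uu unfolding follow_def by auto
        have "dst b (q b u) (q b u') < \<epsilon>0"
          using eq[of h a b y y' u u'] a b nested(2) unfolding \<delta>_def \<epsilon>1_def by auto
        moreover obtain s where s: "s \<in> S" "s (q b u) = Some (q e u)" "\<And>w. w \<in> N b \<Longrightarrow> dst b (q b u) (q b w) < \<epsilon>0 \<Longrightarrow>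
           (\<exists>w' \<in> N b \<inter> N e. q b w' = q b w \<and> s (q b w) = Some (q e w'))"
          using transition[OF b(1) e(1) b(3) ue] by blast
        ultimately obtain u1 where u1: "u1 \<in> N b" "u1 \<in> N e" "q b u1 = q b u'" "s (q b u') = Some (q e u1)"
          using nested(2) b by blast
        have 1: "s \<circ>\<^sub>m h \<in> S" "(s \<circ>\<^sub>m h) (q a y) = Some (q e u)" "(s \<circ>\<^sub>m h) (q a y') = Some (q e u1)"
          using b s u1 S_comp by auto
        have "dst e (q e u) (q e u1) < \<epsilon>1"
          using eq[OF 1(1) a(1) e(1) _ _ _ u1(2) 1(2,3)] a nested(2) ue e(1) unfolding \<delta>_def by auto
        moreover have "(u', u1) \<in> Vstep ^^ c" using Nstep[of b u' u1] b u1 nested(2) by auto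
        ultimately show ?thesis using 1 u1(2) unfolding \<epsilon>1_def by auto
      qed
      obtain h u1 where h: "h \<in> S" "u1 \<in> N e" "h (q a y) = Some (q e u)" "h (q a y') = Some (q e u1)"
          "(u', u1) \<in> Vstep ^^ c" "dst e (q e u) (q e u1) < \<delta>0"
        using slide[OF uu e(2)] by blast
      obtain g v1 where g: "g \<in> S" "v1 \<in> N e" "g (q a y) = Some (q e v)" "g (q a y') = Some (q e v1)"
          "(v', v1) \<in> Vstep ^^ c" "dst e (q e v) (q e v1) < \<delta>0"
        using slide[OF vv e(3)] by blast
      have "(y, u) \<in> Vstep\<^sup>*" using uu unfolding follow_def by auto
      then have "(u, y) \<in> Vstep\<^sup>*" using sym_rtrancl[OF Vstep_sym] by (auto dest: symD)
      then obtain k where k: "k \<in> S" "k (q e u) = Some (q a y)" "\<And>w. w\<in>N e \<Longrightarrow> dst e (q e u) (q e w) < \<delta>0 \<Longrightarrow> q e w \<in> dom k"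
        using ext[of u y e a] a e by (metis domI)
      text \<open>The transport \<open>k\<close> back to \<open>y\<close> is defined near \<open>q e u\<close>, so \<open>k \<circ>\<^sub>m f\<close> fixes \<open>q a y\<close> and by
        rigidity also \<open>q a y'\<close>; comparing \<open>h\<close> and \<open>g\<close> with \<open>k\<close> gives equal images of \<open>q a y'\<close>.\<close>
      have "k (q e w) = Some (q a y')"
        if "f \<in> S" "f (q a y) = Some (q e u)" "f (q a y') = Some (q e w)" "w \<in> N e" "dst e (q e u) (q e w) < \<delta>0" for f w
      proof -
        have "(k \<circ>\<^sub>m f) (q a y) = Some (q a y)" "k \<circ>\<^sub>m f \<in> S" using that k S_comp by auto
        moreover have "q a y' \<in> dom (k \<circ>\<^sub>m f)" using k(3)[of w] that by (auto simp: dom_def)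
        ultimately have "(k \<circ>\<^sub>m f) (q a y') = Some (q a y')" using rigid a by blast
        then show ?thesis using that by simp
      qed
      then have "q e u1 = q e v1" using S_inj[OF k(1)] h g e by metis
      then have "(u1, v1) \<in> Vstep ^^ c" using Nstep e h g by auto
      then have "(u1, v') \<in> Vstep ^^ (c + c)"
        using g(5) sym_relpow[OF Vstep_sym] relpow_join by (metis symD)
      then show "(u', v') \<in> Vstep ^^ (c + (c + c))" using relpow_join[OF h(5)] by blast
    qed
  qed
  then show ?thesis using that[of \<delta>] \<delta>' \<delta>0 by (auto simp: \<delta>_def)
qed

text \<open>\<open>follow_coarse\<close> uses rigidity at its first point only and gives one
  direction; the other comes from exchanging \<open>y\<close> and \<open>y'\<close>, so both have to
  lie in \<open>T\<close>.\<close>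

lemma nearby_coarse_equiv:
  "\<exists>\<delta>>0. \<forall>a\<in>A. \<forall>y\<in>V a \<inter> T. \<forall>y'\<in>V a \<inter> T. dst a (q a y) (q a y') < \<delta> \<longrightarrow>
     coarse_equiv (Vstep\<^sup>* `` {y}) Vstep (Vstep\<^sup>* `` {y'}) Vstep"
proof -
  obtain \<delta> where \<delta>: "\<delta> > 0" and *: "\<And>a y y'. a \<in> A \<Longrightarrow> y \<in> V a \<Longrightarrow> y' \<in> V a \<Longrightarrow> y \<in> T \<Longrightarrow> dst a (q a y) (q a y') < \<delta> \<Longrightarrow>
       Domain (follow a y y') = Vstep\<^sup>* `` {y} \<and> coarse_lip (follow a y y') Vstep Vstep (c + (c + c))"
    using follow_coarse by blast
  have "coarse_equiv (Vstep\<^sup>* `` {y}) Vstep (Vstep\<^sup>* `` {y'}) Vstep"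
    if a: "a \<in> A" "y \<in> V a \<inter> T" "y' \<in> V a \<inter> T" "dst a (q a y) (q a y') < \<delta>" for a y y'
  proof -
    have "dst a (q a y') (q a y) < \<delta>" using a(4) dst_commute by metis
    then show ?thesis
      unfolding coarse_equiv_def using *[of a y y'] *[of a y' y] a
      by (metis Domain_converse follow_converse IntD1 IntD2)
  qed
  then show ?thesis using \<delta> by blast
qed

end

section \<open>Germs in generated pseudogroups\<close>

text \<open>A homeomorphism between open sets, phrased by images and preimages of open sets instead
  of subspace topologies. Closure under composition, inversion and restriction then becomes a
  computation with sets.\<close>

definition partial_open_embedding :: "'p topology \<Rightarrow> ('p \<rightharpoonup> 'p) \<Rightarrow> bool" where
  "partial_open_embedding Z h \<longleftrightarrow>
     (\<forall>x y z. h x = Some z \<longrightarrow> h y = Some z \<longrightarrow> x = y) \<and>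
     dom h \<subseteq> topspace Z \<and> ran h \<subseteq> topspace Z \<and>
     (\<forall>V. openin Z V \<longrightarrow> openin Z {x. \<exists>y\<in>V. h x = Some y} \<and> openin Z {y. \<exists>x\<in>V. h x = Some y})"

lemma poe_inj: "partial_open_embedding Z h \<Longrightarrow> h x = Some z \<Longrightarrow> h y = Some z \<Longrightarrow> x = y"
  by (auto simp: partial_open_embedding_def)

lemma poe_topspace:
  "partial_open_embedding Z h \<Longrightarrow> h x = Some y \<Longrightarrow> x \<in> topspace Z"
  "partial_open_embedding Z h \<Longrightarrow> h x = Some y \<Longrightarrow> y \<in> topspace Z"
  by (auto simp: partial_open_embedding_def dom_def ran_def subset_iff)

lemma poe_preimage:
  "partial_open_embedding Z h \<Longrightarrow> openin Z V \<Longrightarrow> openin Z {x. \<exists>y\<in>V. h x = Some y}"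
  by (auto simp: partial_open_embedding_def)

lemma poe_image:
  "partial_open_embedding Z h \<Longrightarrow> openin Z V \<Longrightarrow> openin Z {y. \<exists>x\<in>V. h x = Some y}"
  by (auto simp: partial_open_embedding_def)

lemma poe_dom: assumes "partial_open_embedding Z h" shows "openin Z (dom h)"
proof -
  have "dom h = {x. \<exists>y\<in>topspace Z. h x = Some y}" using poe_topspace[OF assms] by auto
  then show ?thesis using poe_preimage[OF assms openin_topspace] by simp
qed

lemma local_homeo_imp_poe:
  assumes "local_homeo Z h" shows "partial_open_embedding Z h"
proof -
  have o: "openin Z (dom h)" "openin Z (ran h)"
    and hom: "homeomorphic_map (subtopology Z (dom h)) (subtopology Z (ran h)) (\<lambda>x. the (h x))"
    using assms by (auto simp: local_homeo_def)
  have sub: "dom h \<subseteq> topspace Z" "ran h \<subseteq> topspace Z" using o by (simp_all add: openin_subset)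
  have "inj_on (\<lambda>x. the (h x)) (dom h)"
    using homeomorphic_imp_injective_map[OF hom] sub by (simp add: Int_absorb1)
  then have inj: "x = y" if "h x = Some z" "h y = Some z" for x y z
    using that by (auto simp: inj_on_def dom_def)
  have "openin Z {x. \<exists>y\<in>V. h x = Some y} \<and> openin Z {y. \<exists>x\<in>V. h x = Some y}" if V: "openin Z V" for V
  proof
    have cm: "continuous_map (subtopology Z (dom h)) (subtopology Z (ran h)) (\<lambda>x. the (h x))"
      using hom by (rule homeomorphic_imp_continuous_map)
    have "openin (subtopology Z (ran h)) (ran h \<inter> V)" using V by (simp add: openin_subtopology_Int2)
    from openin_continuous_map_preimage[OF cm this]
    have "openin Z {x \<in> topspace (subtopology Z (dom h)). the (h x) \<in> ran h \<inter> V}"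
      using o(1) openin_trans_full by blast
    moreover have "{x \<in> topspace (subtopology Z (dom h)). the (h x) \<in> ran h \<inter> V} = {x. \<exists>y\<in>V. h x = Some y}"
      using sub by (auto simp: ranI)
    ultimately show "openin Z {x. \<exists>y\<in>V. h x = Some y}" by simp
    have "open_map (subtopology Z (dom h)) (subtopology Z (ran h)) (\<lambda>x. the (h x))"
      using hom by (rule homeomorphic_imp_open_map)
    moreover have "openin (subtopology Z (dom h)) (dom h \<inter> V)" using V by (simp add: openin_subtopology_Int2)
    ultimately have "openin (subtopology Z (ran h)) ((\<lambda>x. the (h x)) ` (dom h \<inter> V))"
      by (auto simp: open_map_def)
    then have "openin Z ((\<lambda>x. the (h x)) ` (dom h \<inter> V))" using o(2) openin_trans_full by blast
    moreover have "(\<lambda>x. the (h x)) ` (dom h \<inter> V) = {y. \<exists>x\<in>V. h x = Some y}" by force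
    ultimately show "openin Z {y. \<exists>x\<in>V. h x = Some y}" by simp
  qed
  then show ?thesis unfolding partial_open_embedding_def using inj sub by blast
qed

lemma inv_map_iff:
  assumes "\<And>x y z. h x = Some z \<Longrightarrow> h y = Some z \<Longrightarrow> x = y"
  shows "inv_map h y = Some x \<longleftrightarrow> h x = Some y"
proof
  assume "inv_map h y = Some x"
  then have y: "y \<in> ran h" and x: "x = (THE x. h x = Some y)" by (auto simp: inv_map_def split: if_splits)
  then obtain x' where "h x' = Some y" by (auto simp: ran_def)
  then show "h x = Some y" unfolding x by (rule theI) (use assms \<open>h x' = Some y\<close> in blast)
next
  assume h: "h x = Some y"
  then have "(THE x. h x = Some y) = x" using assms by blast
  then show "inv_map h y = Some x" using h by (auto simp: inv_map_def ran_def)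
qed

lemma poe_inv_map_iff: "partial_open_embedding Z h \<Longrightarrow> inv_map h y = Some x \<longleftrightarrow> h x = Some y"
  by (rule inv_map_iff) (rule poe_inj)

lemma poe_inv: assumes "partial_open_embedding Z h" shows "partial_open_embedding Z (inv_map h)"
  using assms poe_inv_map_iff[OF assms] unfolding partial_open_embedding_def dom_def ran_def
  by (simp add: subset_iff)

lemma poe_comp:
  assumes "partial_open_embedding Z g" "partial_open_embedding Z h"
  shows "partial_open_embedding Z (g \<circ>\<^sub>m h)"
proof -
  have "openin Z {x. \<exists>y\<in>V. (g \<circ>\<^sub>m h) x = Some y} \<and> openin Z {y. \<exists>x\<in>V. (g \<circ>\<^sub>m h) x = Some y}" if V: "openin Z V" for V
  proof
    have "{x. \<exists>y\<in>V. (g \<circ>\<^sub>m h) x = Some y} = {x. \<exists>z\<in>{z. \<exists>y\<in>V. g z = Some y}. h x = Some z}"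
      by (auto simp: map_comp_Some_iff)
    then show "openin Z {x. \<exists>y\<in>V. (g \<circ>\<^sub>m h) x = Some y}"
      using poe_preimage[OF assms(2) poe_preimage[OF assms(1) V]] by simp
    have "{y. \<exists>x\<in>V. (g \<circ>\<^sub>m h) x = Some y} = {y. \<exists>z\<in>{z. \<exists>x\<in>V. h x = Some z}. g z = Some y}"
      by (auto simp: map_comp_Some_iff)
    then show "openin Z {y. \<exists>x\<in>V. (g \<circ>\<^sub>m h) x = Some y}"
      using poe_image[OF assms(1) poe_image[OF assms(2) V]] by simp
  qed
  moreover have "dom (g \<circ>\<^sub>m h) \<subseteq> topspace Z" "ran (g \<circ>\<^sub>m h) \<subseteq> topspace Z"
    using poe_topspace[OF assms(1)] poe_topspace[OF assms(2)] by (auto simp: map_comp_Some_iff dom_def ran_def)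
  moreover have "x = y" if "(g \<circ>\<^sub>m h) x = Some z" "(g \<circ>\<^sub>m h) y = Some z" for x y z
    using that poe_inj[OF assms(1)] poe_inj[OF assms(2)] by (auto simp: map_comp_Some_iff)
  ultimately show ?thesis unfolding partial_open_embedding_def by blast
qed

lemma restrict_map_Some_iff: "(h |` V) x = Some y \<longleftrightarrow> x \<in> V \<and> h x = Some y"
  by (auto simp: restrict_map_def)

lemma poe_restrict:
  assumes "partial_open_embedding Z h" "openin Z U"
  shows "partial_open_embedding Z (h |` U)"
proof -
  have "openin Z {x. \<exists>y\<in>V. (h |` U) x = Some y} \<and> openin Z {y. \<exists>x\<in>V. (h |` U) x = Some y}" if V: "openin Z V" for V
  proof
    have "{x. \<exists>y\<in>V. (h |` U) x = Some y} = U \<inter> {x. \<exists>y\<in>V. h x = Some y}"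
      by (auto simp: restrict_map_Some_iff)
    then show "openin Z {x. \<exists>y\<in>V. (h |` U) x = Some y}"
      using poe_preimage[OF assms(1) V] assms(2) by auto
    have "{y. \<exists>x\<in>V. (h |` U) x = Some y} = {y. \<exists>x\<in>V \<inter> U. h x = Some y}"
      by (auto simp: restrict_map_Some_iff)
    then show "openin Z {y. \<exists>x\<in>V. (h |` U) x = Some y}"
      using poe_image[OF assms(1), of "V \<inter> U"] V assms(2) by auto
  qed
  moreover have "dom (h |` U) \<subseteq> topspace Z" "ran (h |` U) \<subseteq> topspace Z"
    using poe_topspace[OF assms(1)] by (auto simp: restrict_map_Some_iff dom_def ran_def)
  moreover have "x = y" if "(h |` U) x = Some z" "(h |` U) y = Some z" for x y z
    using that poe_inj[OF assms(1)] by (auto simp: restrict_map_Some_iff)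
  ultimately show ?thesis unfolding partial_open_embedding_def by blast
qed

lemma id_map_Some_iff [simp]: "id_map Z x = Some y \<longleftrightarrow> x \<in> topspace Z \<and> y = x"
  by (auto simp: id_map_def restrict_map_Some_iff)

lemma poe_id: "partial_open_embedding Z (id_map Z)"
proof -
  have "{x. \<exists>y\<in>V. id_map Z x = Some y} = V \<inter> topspace Z" "{y. \<exists>x\<in>V. id_map Z x = Some y} = V \<inter> topspace Z" for V
    by auto
  then show ?thesis unfolding partial_open_embedding_def by (auto simp: dom_def ran_def)
qed

lemma poe_generated:
  assumes "h \<in> generated_pseudogroup Z E" "\<And>e. e \<in> E \<Longrightarrow> partial_open_embedding Z e"
  shows "partial_open_embedding Z h"
  using assms(1)
  by induction (blast intro: assms(2) poe_id poe_comp poe_inv poe_restrict local_homeo_imp_poe)+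

lemma inv_map_id_map: "inv_map (id_map Z) = id_map Z"
proof
  fix x
  have "inv_map (id_map Z) x = Some y \<longleftrightarrow> id_map Z x = Some y" for y
    by (subst poe_inv_map_iff[OF poe_id]) auto
  then show "inv_map (id_map Z) x = id_map Z x" by (metis option.exhaust)
qed

section \<open>Calculus of germs and composites of generators\<close>

lemma same_germI:
  assumes "openin Z V" "x \<in> V" "\<And>y. y \<in> V \<Longrightarrow> y \<in> dom g" "\<And>y. y \<in> V \<Longrightarrow> g y = h y"
  shows "same_germ Z x g h"
  unfolding same_germ_def using assms by (intro exI[of _ V]) (auto simp: dom_def)

lemma same_germ_refl: "partial_open_embedding Z h \<Longrightarrow> h x = Some y \<Longrightarrow> same_germ Z x h h"
  by (rule same_germI[of Z "dom h"]) (auto intro: poe_dom)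

lemma same_germ_Some: "same_germ Z x g h \<Longrightarrow> g x = Some y \<Longrightarrow> h x = Some y"
  unfolding same_germ_def by metis

lemma same_germ_comp:
  assumes h: "same_germ Z x h h'" and g: "same_germ Z y g g'" and "h x = Some y"
    and poe: "partial_open_embedding Z h"
  shows "same_germ Z x (g \<circ>\<^sub>m h) (g' \<circ>\<^sub>m h')"
proof -
  obtain V where V: "openin Z V" "x \<in> V" "V \<subseteq> dom h \<inter> dom h'" "\<forall>y\<in>V. h y = h' y"
    using h unfolding same_germ_def by auto
  obtain W where W: "openin Z W" "y \<in> W" "W \<subseteq> dom g \<inter> dom g'" "\<forall>y\<in>W. g y = g' y"
    using g unfolding same_germ_def by auto
  show ?thesis
  proof (rule same_germI)
    show "openin Z (V \<inter> {x. \<exists>y\<in>W. h x = Some y})" using V poe_preimage[OF poe W(1)] by auto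
    show "x \<in> V \<inter> {x. \<exists>y\<in>W. h x = Some y}" using assms W V by auto
  next
    fix u assume u: "u \<in> V \<inter> {x. \<exists>y\<in>W. h x = Some y}"
    then show "u \<in> dom (g \<circ>\<^sub>m h)" using W by (auto simp: dom_def map_comp_def)
    show "(g \<circ>\<^sub>m h) u = (g' \<circ>\<^sub>m h') u" using u V(4) W(4) by (auto simp: map_comp_def split: option.splits)
  qed
qed

lemma same_germ_inv:
  assumes "same_germ Z x h h'" "h x = Some y" "partial_open_embedding Z h" "partial_open_embedding Z h'"
  shows "same_germ Z y (inv_map h) (inv_map h')"
proof -
  obtain V where V: "openin Z V" "x \<in> V" "V \<subseteq> dom h \<inter> dom h'" "\<forall>y\<in>V. h y = h' y"
    using assms unfolding same_germ_def by auto
  show ?thesis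
  proof (rule same_germI)
    show "openin Z {y. \<exists>x\<in>V. h x = Some y}" using V assms poe_image by blast
    show "y \<in> {y. \<exists>x\<in>V. h x = Some y}" using V assms by auto
  next
    fix u assume "u \<in> {y. \<exists>x\<in>V. h x = Some y}"
    then obtain v where v: "v \<in> V" "h v = Some u" by auto
    then have "inv_map h u = Some v" "inv_map h' u = Some v"
      using V(4) poe_inv_map_iff[OF assms(3)] poe_inv_map_iff[OF assms(4)] by auto
    then show "u \<in> dom (inv_map h)" "inv_map h u = inv_map h' u" by auto
  qed
qed

lemma same_germ_restrict:
  assumes "same_germ Z x h h'" "openin Z V" "x \<in> V"
  shows "same_germ Z x (h |` V) h'"
proof -
  obtain W where W: "openin Z W" "x \<in> W" "W \<subseteq> dom h \<inter> dom h'" "\<forall>y\<in>W. h y = h' y"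
    using assms unfolding same_germ_def by auto
  show ?thesis by (rule same_germI[of Z "W \<inter> V"]) (use W assms in \<open>auto simp: restrict_map_def dom_def\<close>)
qed

lemma same_germ_map_le:
  assumes "same_germ Z x g h'" "g \<subseteq>\<^sub>m h"
  shows "same_germ Z x h h'"
proof -
  obtain W where W: "openin Z W" "x \<in> W" "W \<subseteq> dom g \<inter> dom h'" "\<forall>y\<in>W. g y = h' y"
    using assms unfolding same_germ_def by auto
  then have h: "h y = g y" "g y = h' y" "y \<in> dom g" if "y \<in> W" for y
    using assms(2) that by (auto simp: map_le_def subset_iff)
  show ?thesis by (rule same_germI[OF W(1,2)]) (use h in \<open>auto simp: dom_def\<close>)
qed

lemma same_germ_trans:
  assumes "same_germ Z x f g" "same_germ Z x g h"
  shows "same_germ Z x f h"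
proof -
  obtain V where "openin Z V" "x \<in> V" "V \<subseteq> dom f \<inter> dom g" "\<forall>y\<in>V. f y = g y"
    using assms(1) unfolding same_germ_def by auto
  moreover obtain W where "openin Z W" "x \<in> W" "W \<subseteq> dom g \<inter> dom h" "\<forall>y\<in>W. g y = h y"
    using assms(2) unfolding same_germ_def by auto
  ultimately show ?thesis by (intro same_germI[of Z "V \<inter> W"]) auto
qed

lemma id_map_comp: "partial_open_embedding Z h \<Longrightarrow> id_map Z \<circ>\<^sub>m h = h"
  by (rule ext) (auto simp: map_comp_def id_map_def restrict_map_def split: option.splits dest: poe_topspace)

lemma comp_id_map: "partial_open_embedding Z h \<Longrightarrow> h \<circ>\<^sub>m id_map Z = h"
proof (rule ext)
  fix x assume "partial_open_embedding Z h"
  then have "x \<notin> topspace Z \<Longrightarrow> h x = None" by (metis option.exhaust poe_topspace(1))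
  then show "(h \<circ>\<^sub>m id_map Z) x = h x" by (auto simp: map_comp_def id_map_def restrict_map_def)
qed

lemma map_comp_assoc: "(f \<circ>\<^sub>m g) \<circ>\<^sub>m h = f \<circ>\<^sub>m (g \<circ>\<^sub>m h)"
  by (rule ext) (auto simp: map_comp_def split: option.splits)

lemma composites_in_generated: "g \<in> composites Z E m \<Longrightarrow> g \<in> generated_pseudogroup Z E"
  by (induction m arbitrary: g) (auto intro: generated_pseudogroup.intros)

lemma composites_comp:
  assumes "\<And>e. e \<in> E \<Longrightarrow> partial_open_embedding Z e" "g \<in> composites Z E m" "h \<in> composites Z E l"
  shows "g \<circ>\<^sub>m h \<in> composites Z E (m + l)"
  using assms(2)
proof (induction m arbitrary: g)
  case 0
  then show ?case
    using assms(3) id_map_comp[OF poe_generated[OF composites_in_generated]] assms(1) by fastforce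
next
  case (Suc m)
  then show ?case by (fastforce simp: map_comp_assoc)
qed

text \<open>Inversion reverses the order of the factors, whereas \<open>composites\<close> adds
  generators on the left only; \<open>composites_comp\<close> repairs this.\<close>

lemma composites_inv:
  assumes E: "\<And>e. e \<in> E \<Longrightarrow> partial_open_embedding Z e" "\<And>e. e \<in> E \<Longrightarrow> inv_map e \<in> E" "g \<in> composites Z E m"
  shows "inv_map g \<in> composites Z E m"
  using assms(3)
proof (induction m arbitrary: g)
  case 0
  then show ?case by (simp add: inv_map_id_map)
next
  case (Suc m)
  then obtain e h where eh: "g = e \<circ>\<^sub>m h" "e \<in> E" "h \<in> composites Z E m" by auto
  have poe: "partial_open_embedding Z e" "partial_open_embedding Z h"
    using eh(2) E(1) poe_generated[OF composites_in_generated[OF eh(3)]] by blast+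
  have "inv_map g y = (inv_map h \<circ>\<^sub>m inv_map e) y" for y
  proof -
    have "inv_map g y = Some x \<longleftrightarrow> (inv_map h \<circ>\<^sub>m inv_map e) y = Some x" for x
      using poe_inv_map_iff[OF poe_comp[OF poe]] poe_inv_map_iff[OF poe(1)] poe_inv_map_iff[OF poe(2)] eh(1)
      by (auto simp: map_comp_Some_iff)
    then show ?thesis by (metis option.exhaust)
  qed
  then have inv: "inv_map g = inv_map h \<circ>\<^sub>m inv_map e" by blast
  have "inv_map e \<circ>\<^sub>m id_map Z \<in> composites Z E 1" using E(2)[OF eh(2)] by auto
  then have "inv_map e \<in> composites Z E 1" using comp_id_map[OF poe_inv[OF poe(1)]] by simp
  then have "inv_map h \<circ>\<^sub>m inv_map e \<in> composites Z E (m + 1)"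
    using composites_comp[OF E(1) Suc.IH[OF eh(3)]] by blast
  then show ?case unfolding inv by simp
qed

text \<open>Restriction and combination do not change germs, and inversion stays among composites
  because \<open>E\<close> is symmetric. At the level of germs only composition of generators is
  left.\<close>

lemma generated_germ_composite:
  assumes "h \<in> generated_pseudogroup Z E" and E: "\<And>e. e \<in> E \<Longrightarrow> partial_open_embedding Z e" "\<And>e. e \<in> E \<Longrightarrow> inv_map e \<in> E"
    and "h x = Some y"
  shows "\<exists>m. \<exists>g\<in>composites Z E m. same_germ Z x h g"
  using assms(1,4)
proof (induction arbitrary: x y)
  case (gen h)
  have "h \<circ>\<^sub>m id_map Z \<in> composites Z E 1" using gen by auto
  then show ?case using comp_id_map[OF E(1)] gen same_germ_refl[OF E(1)] by metis
next
  case ident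
  then show ?case using same_germ_refl[OF poe_id] by (intro exI[of _ 0]) fastforce
next
  case (comp g h)
  then obtain z where z: "h x = Some z" "g z = Some y" by (auto simp: map_comp_Some_iff)
  obtain m h' where h': "h' \<in> composites Z E m" "same_germ Z x h h'" using comp.IH(2)[OF z(1)] by auto
  obtain l g' where g': "g' \<in> composites Z E l" "same_germ Z z g g'" using comp.IH(1)[OF z(2)] by auto
  show ?case using same_germ_comp[OF h'(2) g'(2) z(1) poe_generated[OF comp.hyps(2) E(1)]]
      composites_comp[OF E(1) g'(1) h'(1)] by blast
next
  case (inv h)
  have poe: "partial_open_embedding Z h" using poe_generated[OF inv.hyps E(1)] .
  then have hy: "h y = Some x" using inv.prems poe_inv_map_iff by metis
  obtain m h' where h': "h' \<in> composites Z E m" "same_germ Z y h h'" using inv.IH[OF hy] by auto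
  show ?case using same_germ_inv[OF h'(2) hy poe poe_generated[OF composites_in_generated[OF h'(1)] E(1)]]
      composites_inv[OF E h'(1)] by blast
next
  case (restr h V)
  then show ?case by (meson restrict_map_Some_iff same_germ_restrict)
next
  case (union G h)
  then have "x \<in> (\<Union>g\<in>G. dom g)" by (metis domI)
  then obtain g where g: "g \<in> G" "x \<in> dom g" by blast
  then show ?case using union.IH same_germ_map_le by (metis domD)
qed

section \<open>Orbits as graphs of generators\<close>

definition map_step :: "('p \<rightharpoonup> 'p) set \<Rightarrow> ('p \<times> 'p) set" where
  "map_step E = {(x, y). \<exists>e\<in>E. e x = Some y}"

lemma composites_relpow:
  "x \<in> topspace Z \<Longrightarrow> (\<exists>g\<in>composites Z E m. g x = Some y) \<longleftrightarrow> (x, y) \<in> map_step E ^^ m"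
proof (induction m arbitrary: y)
  case (Suc m)
  have "(\<exists>g\<in>composites Z E (Suc m). g x = Some y) \<longleftrightarrow>
      (\<exists>z. (\<exists>h\<in>composites Z E m. h x = Some z) \<and> (\<exists>e\<in>E. e z = Some y))"
    by (auto simp: map_comp_Some_iff) (metis map_comp_Some_iff)+
  then show ?case using Suc by (auto simp: map_step_def relcomp_unfold)
qed auto

text \<open>A composite is itself an element of the pseudogroup and has its own germ, so the germ
  clause in \<open>gen_dist\<close> merely asks for a composite that sends \<open>x\<close> to
  \<open>y\<close>. Word length of germs thus becomes a distance in a graph.\<close>

lemma gen_dist_eq:
  assumes E: "\<And>e. e \<in> E \<Longrightarrow> partial_open_embedding Z e" and x: "x \<in> topspace Z"
  shows "gen_dist Z E x y = real (graph_dist (map_step E) x y)"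
proof -
  have "(\<exists>h\<in>generated_pseudogroup Z E. h x = Some y \<and> (\<exists>g\<in>composites Z E m. same_germ Z x h g))
     \<longleftrightarrow> (\<exists>g\<in>composites Z E m. g x = Some y)" for m
  proof
    assume "\<exists>g\<in>composites Z E m. g x = Some y"
    then obtain g where g: "g \<in> composites Z E m" "g x = Some y" by blast
    then have "g \<in> generated_pseudogroup Z E" using composites_in_generated by blast
    moreover have "same_germ Z x g g" using same_germ_refl[OF poe_generated[OF calculation E] g(2)] .
    ultimately show "\<exists>h\<in>generated_pseudogroup Z E. h x = Some y \<and> (\<exists>g\<in>composites Z E m. same_germ Z x h g)"
      using g by blast
  next
    assume "\<exists>h\<in>generated_pseudogroup Z E. h x = Some y \<and> (\<exists>g\<in>composites Z E m. same_germ Z x h g)"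
    then obtain h g where "h x = Some y" "g \<in> composites Z E m" "same_germ Z x h g" by blast
    then show "\<exists>g\<in>composites Z E m. g x = Some y" using same_germ_Some[of Z x h g y] by blast
  qed
  then show ?thesis unfolding gen_dist_def graph_dist_def composites_relpow[OF x] by simp
qed

lemma pg_orbit_eq:
  assumes E: "\<And>e. e \<in> E \<Longrightarrow> partial_open_embedding Z e" "\<And>e. e \<in> E \<Longrightarrow> inv_map e \<in> E" and x: "x \<in> topspace Z"
  shows "pg_orbit (generated_pseudogroup Z E) x = (map_step E)\<^sup>* `` {x}"
proof -
  have "y \<in> pg_orbit (generated_pseudogroup Z E) x \<longleftrightarrow> (\<exists>m. \<exists>g\<in>composites Z E m. g x = Some y)" for y
    unfolding pg_orbit_def using generated_germ_composite[OF _ E] composites_in_generated same_germ_Some by fast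
  then show ?thesis using composites_relpow[OF x] by (auto simp: rtrancl_power)
qed

section \<open>Trivial germs, and germs generated by a composition-closed set\<close>

definition trivial_germs :: "'p topology \<Rightarrow> ('p \<rightharpoonup> 'p) set \<Rightarrow> 'p \<Rightarrow> bool" where
  "trivial_germs Z H x \<longleftrightarrow> (\<forall>h\<in>H. h x = Some x \<longrightarrow> same_germ Z x h (id_map Z))"

lemma trivial_group_imp_trivial_germs:
  assumes "trivial_group (germ_group Z H x)" "\<And>h. h \<in> H \<Longrightarrow> partial_open_embedding Z h"
  shows "trivial_germs Z H x"
  unfolding trivial_germs_def
proof (intro ballI impI)
  fix h assume h: "h \<in> H" "h x = Some x"
  then have "germ Z H x h \<in> carrier (germ_group Z H x)" unfolding germ_group_def by auto
  then have "germ Z H x h = germ Z H x (id_map Z)"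
    using assms(1) unfolding trivial_group_def by (auto simp: germ_group_def)
  moreover have "h \<in> germ Z H x h" using h same_germ_refl[OF assms(2)] by (auto simp: germ_def)
  ultimately show "same_germ Z x h (id_map Z)" by (auto simp: germ_def)
qed

text \<open>Conjugation: if \<open>f\<close> fixes \<open>y\<close>, then
  \<open>inv_map h \<circ>\<^sub>m (f \<circ>\<^sub>m h)\<close> fixes \<open>x\<close> and is the
  identity near it, and \<open>h\<close> carries that neighbourhood to one of
  \<open>y\<close>.\<close>

lemma trivial_germs_orbit:
  assumes x: "trivial_germs Z (generated_pseudogroup Z E) x" and E: "\<And>e. e \<in> E \<Longrightarrow> partial_open_embedding Z e"
    and h: "h \<in> generated_pseudogroup Z E" "h x = Some y"
  shows "trivial_germs Z (generated_pseudogroup Z E) y"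
  unfolding trivial_germs_def
proof (intro ballI impI)
  fix f assume f: "f \<in> generated_pseudogroup Z E" "f y = Some y"
  have poe: "partial_open_embedding Z h" "partial_open_embedding Z f" using poe_generated E h f by auto
  have "inv_map h \<circ>\<^sub>m (f \<circ>\<^sub>m h) \<in> generated_pseudogroup Z E"
    using f h by (auto intro: generated_pseudogroup.intros)
  moreover have "(inv_map h \<circ>\<^sub>m (f \<circ>\<^sub>m h)) x = Some x"
    using f h poe_inv_map_iff[OF poe(1)] by (auto simp: map_comp_Some_iff)
  ultimately have "same_germ Z x (inv_map h \<circ>\<^sub>m (f \<circ>\<^sub>m h)) (id_map Z)" using x by (auto simp: trivial_germs_def)
  then obtain V where V: "openin Z V" "x \<in> V" "V \<subseteq> dom (id_map Z)" "\<And>u. u \<in> V \<Longrightarrow> (inv_map h \<circ>\<^sub>m (f \<circ>\<^sub>m h)) u = id_map Z u"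
    unfolding same_germ_def by auto
  have *: "f w = Some w" if uw: "u \<in> V" "h u = Some w" for u w
  proof -
    have "(inv_map h \<circ>\<^sub>m (f \<circ>\<^sub>m h)) u = Some u" using V uw by (auto simp: subset_iff)
    then show ?thesis using uw poe_inv_map_iff[OF poe(1)] by (auto simp: map_comp_Some_iff)
  qed
  show "same_germ Z y f (id_map Z)"
  proof (rule same_germI)
    show "openin Z {w. \<exists>u\<in>V. h u = Some w}" using poe_image[OF poe(1) V(1)] .
    show "y \<in> {w. \<exists>u\<in>V. h u = Some w}" using V h by auto
  next
    fix w assume "w \<in> {w. \<exists>u\<in>V. h u = Some w}"
    then show "w \<in> dom f" "f w = id_map Z w" using * poe_topspace(2)[OF poe(1)] by (auto simp: id_map_def)
  qed
qed

text \<open>Words in \<open>S\<close> collapse to single elements of \<open>S\<close>, since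
  \<open>S\<close> is symmetric and closed under composition. The second alternative comes from the
  rule that puts the identity into every pseudogroup: \<open>S\<close> may have no member with the
  identity germ at \<open>x\<close>.\<close>

lemma generated_germ_comp_closed:
  assumes S: "\<And>s. s \<in> S \<Longrightarrow> partial_open_embedding Z s" "symmetric_maps S" "comp_closed S"
    and f: "f \<in> generated_pseudogroup Z S" "f x = Some y"
  shows "(\<exists>s\<in>S. same_germ Z x f s) \<or> same_germ Z x f (id_map Z)"
  using f
proof (induction arbitrary: x y)
  case (gen h)
  then show ?case using same_germ_refl[OF S(1)[OF gen.hyps] gen.prems] by blast
next
  case ident
  then show ?case using same_germ_refl[OF poe_id ident] by blast
next
  case (comp g h)
  then obtain z where z: "h x = Some z" "g z = Some y" by (auto simp: map_comp_Some_iff)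
  have poe: "partial_open_embedding Z h" "partial_open_embedding Z g" using poe_generated comp S by auto
  have c: "same_germ Z x (g \<circ>\<^sub>m h) (g' \<circ>\<^sub>m h')" if "same_germ Z x h h'" "same_germ Z z g g'" for g' h'
    using same_germ_comp[OF that z(1) poe(1)] .
  from comp.IH(2)[OF z(1)] comp.IH(1)[OF z(2)] show ?case
  proof (elim disjE bexE)
    fix s t assume "s \<in> S" "t \<in> S" "same_germ Z x h s" "same_germ Z z g t"
    then show ?thesis using c[of s t] S(3) unfolding comp_closed_def by blast
  next
    fix s assume "s \<in> S" "same_germ Z x h s" "same_germ Z z g (id_map Z)"
    then show ?thesis using c[of s "id_map Z"] id_map_comp[OF S(1)[of s]] by auto
  next
    fix t assume t: "same_germ Z x h (id_map Z)" "t \<in> S" "same_germ Z z g t"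
    then show ?thesis using c[of "id_map Z" t] comp_id_map[OF S(1)[of t]] by auto
  next
    assume "same_germ Z x h (id_map Z)" "same_germ Z z g (id_map Z)"
    then show ?thesis using c[of "id_map Z" "id_map Z"] by (simp add: comp_id_map[OF poe_id])
  qed
next
  case (inv h)
  have poe: "partial_open_embedding Z h" using poe_generated[OF inv.hyps S(1)] .
  then have hy: "h y = Some x" using inv.prems poe_inv_map_iff by metis
  from inv.IH[OF hy] show ?case
  proof (elim disjE bexE)
    fix s assume "s \<in> S" "same_germ Z y h s"
    then show ?thesis using same_germ_inv[OF _ hy poe S(1), of s] S(2) unfolding symmetric_maps_def by blast
  next
    assume i: "same_germ Z y h (id_map Z)"
    then show ?thesis using same_germ_inv[OF i hy poe poe_id] by (simp add: inv_map_id_map)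
  qed
next
  case (restr h V)
  then have hx: "h x = Some y" and V: "openin Z V" "x \<in> V" by (simp_all add: restrict_map_Some_iff)
  from restr.IH[OF hx] show ?case using same_germ_restrict[OF _ V] by blast
next
  case (union G h)
  then have "x \<in> (\<Union>g\<in>G. dom g)" by (metis domI)
  then obtain g y' where g: "g \<in> G" "g x = Some y'" by blast
  then have le: "g \<subseteq>\<^sub>m h" and IH: "(\<exists>s\<in>S. same_germ Z x g s) \<or> same_germ Z x g (id_map Z)"
    using union.IH by simp_all
  from IH show ?case using same_germ_map_le[OF _ le] by blast
qed

section \<open>Cocycles of submersions\<close>

text \<open>Both submersions have the same plaques near each common point. No map between their
  targets is required, so cocycles with unrelated transversals can be compared.\<close>

definition locally_equiv :: "'x topology \<Rightarrow> 'x set \<Rightarrow> ('x \<Rightarrow> 'p) \<Rightarrow> 'x set \<Rightarrow> ('x \<Rightarrow> 'q) \<Rightarrow> bool" where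
  "locally_equiv X D p D' p' \<longleftrightarrow> (\<forall>x\<in>D \<inter> D'. \<exists>G. openin X G \<and> x \<in> G \<and> G \<subseteq> D \<inter> D' \<and>
     (\<forall>u\<in>G. \<forall>v\<in>G. p u = p v \<longleftrightarrow> p' u = p' v))"

lemma locally_equivE:
  assumes "locally_equiv X D p D' p'" "x \<in> D" "x \<in> D'"
  obtains G where "openin X G" "x \<in> G" "G \<subseteq> D" "G \<subseteq> D'" "\<And>u v. u \<in> G \<Longrightarrow> v \<in> G \<Longrightarrow> p u = p v \<longleftrightarrow> p' u = p' v"
  using assms unfolding locally_equiv_def by (metis Int_iff le_inf_iff)

text \<open>
  \<open>P i\<close> is the projection of \<open>U i\<close> to the disjoint sum \<open>Z\<close> of the transversals, so that its value
  determines the index, and the last assumption says that plaques are connected.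
\<close>

locale transverse_cocycle =
  fixes X :: "'x topology" and I :: "'i set" and U :: "'i \<Rightarrow> 'x set" and P :: "'i \<Rightarrow> 'x \<Rightarrow> 'p"
    and Z :: "'p topology" and hm :: "'i \<Rightarrow> 'i \<Rightarrow> 'p \<rightharpoonup> 'p"
  assumes U_open: "\<And>i. i \<in> I \<Longrightarrow> openin X (U i)"
    and U_cover: "topspace X = (\<Union>i\<in>I. U i)"
    and P_open: "\<And>i G. i \<in> I \<Longrightarrow> openin X G \<Longrightarrow> openin Z (P i ` (G \<inter> U i))"
    and P_cont: "\<And>i G. i \<in> I \<Longrightarrow> openin Z G \<Longrightarrow> openin X {x \<in> U i. P i x \<in> G}"
    and Z_cover: "topspace Z = (\<Union>i\<in>I. P i ` U i)"
    and P_index: "\<And>i j x y. i \<in> I \<Longrightarrow> j \<in> I \<Longrightarrow> x \<in> U i \<Longrightarrow> y \<in> U j \<Longrightarrow> P i x = P j y \<Longrightarrow> i = j"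
    and hm_iff: "\<And>i j p p'. i \<in> I \<Longrightarrow> j \<in> I \<Longrightarrow> hm i j p = Some p' \<longleftrightarrow> (\<exists>u\<in>U i \<inter> U j. p = P i u \<and> p' = P j u)"
    and plaque_const: "\<And>i Q x x'. i \<in> I \<Longrightarrow> x \<in> U i \<Longrightarrow> x' \<in> U i \<Longrightarrow> P i x = P i x' \<Longrightarrow> Q x \<Longrightarrow>
        (\<And>w. w \<in> U i \<Longrightarrow> P i w = P i x \<Longrightarrow> \<exists>G. openin X G \<and> w \<in> G \<and>
           (\<forall>w1\<in>G \<inter> U i. \<forall>w2\<in>G \<inter> U i. P i w1 = P i x \<longrightarrow> P i w2 = P i x \<longrightarrow> Q w1 \<longrightarrow> Q w2)) \<Longrightarrow> Q x'"
begin

definition E :: "('p \<rightharpoonup> 'p) set" where "E = {hm i j | i j. i \<in> I \<and> j \<in> I}"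

abbreviation H :: "('p \<rightharpoonup> 'p) set" where "H \<equiv> generated_pseudogroup Z E"

definition cstep :: "('x \<times> 'x) set" where
  "cstep = {(x, x'). \<exists>i\<in>I. x \<in> U i \<and> x' \<in> U i \<and> P i x = P i x'}"

lemma hm_I: "i \<in> I \<Longrightarrow> j \<in> I \<Longrightarrow> u \<in> U i \<Longrightarrow> u \<in> U j \<Longrightarrow> hm i j (P i u) = Some (P j u)"
  using hm_iff by auto

lemma P_change: "i \<in> I \<Longrightarrow> j \<in> I \<Longrightarrow> u \<in> U i \<inter> U j \<Longrightarrow> v \<in> U i \<inter> U j \<Longrightarrow> P i u = P i v \<Longrightarrow> P j u = P j v"
  by (metis IntD1 IntD2 hm_I option.inject)

lemma P_topspace: "i \<in> I \<Longrightarrow> u \<in> U i \<Longrightarrow> P i u \<in> topspace Z"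
  using Z_cover by auto

lemma U_topspace: "i \<in> I \<Longrightarrow> u \<in> U i \<Longrightarrow> u \<in> topspace X"
  using U_cover by auto

lemma hm_poe: assumes "i \<in> I" "j \<in> I" shows "partial_open_embedding Z (hm i j)"
proof -
  have "openin Z {x. \<exists>y\<in>V. hm i j x = Some y} \<and> openin Z {y. \<exists>x\<in>V. hm i j x = Some y}" if V: "openin Z V" for V
  proof
    have "{x. \<exists>y\<in>V. hm i j x = Some y} = P i ` ({u \<in> U j. P j u \<in> V} \<inter> U i)"
      using assms by (auto simp: hm_iff)
    then show "openin Z {x. \<exists>y\<in>V. hm i j x = Some y}" using P_open P_cont assms V by simp
    have "{y. \<exists>x\<in>V. hm i j x = Some y} = P j ` ({u \<in> U i. P i u \<in> V} \<inter> U j)"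
      using assms by (auto simp: hm_iff)
    then show "openin Z {y. \<exists>x\<in>V. hm i j x = Some y}" using P_open P_cont assms V by simp
  qed
  moreover have "x = y" if "hm i j x = Some z" "hm i j y = Some z" for x y z
    using that P_change[of j i] assms by (auto simp: hm_iff)
  moreover have "dom (hm i j) \<subseteq> topspace Z" "ran (hm i j) \<subseteq> topspace Z"
    using assms P_topspace by (auto simp: dom_def ran_def hm_iff)
  ultimately show ?thesis unfolding partial_open_embedding_def by blast
qed

lemma E_poe: "e \<in> E \<Longrightarrow> partial_open_embedding Z e"
  using hm_poe by (auto simp: E_def)

lemma H_poe: "h \<in> H \<Longrightarrow> partial_open_embedding Z h"
  using poe_generated E_poe by blast

lemma hm_inv: assumes "i \<in> I" "j \<in> I" shows "inv_map (hm i j) = hm j i"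
proof
  fix y
  have "inv_map (hm i j) y = Some x \<longleftrightarrow> hm j i y = Some x" for x
    by (subst poe_inv_map_iff[OF hm_poe[OF assms]]) (use assms in \<open>auto simp: hm_iff\<close>)
  then show "inv_map (hm i j) y = hm j i y" by (metis option.exhaust)
qed

lemma E_inv: "e \<in> E \<Longrightarrow> inv_map e \<in> E"
  using hm_inv by (auto simp: E_def)

lemma hm_in_H: "i \<in> I \<Longrightarrow> j \<in> I \<Longrightarrow> hm i j \<in> H"
  by (rule generated_pseudogroup.gen) (auto simp: E_def)

lemma H_comp: "g \<in> H \<Longrightarrow> h \<in> H \<Longrightarrow> g \<circ>\<^sub>m h \<in> H"
  by (rule generated_pseudogroup.comp)

lemma estep_iff: "(p, p') \<in> map_step E \<longleftrightarrow> (\<exists>i\<in>I. \<exists>j\<in>I. \<exists>u\<in>U i \<inter> U j. p = P i u \<and> p' = P j u)"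
proof -
  have "(p, p') \<in> map_step E \<longleftrightarrow> (\<exists>i\<in>I. \<exists>j\<in>I. hm i j p = Some p')"
    unfolding map_step_def E_def by blast
  then show ?thesis by (simp add: hm_iff)
qed

lemma estep_I: "i \<in> I \<Longrightarrow> j \<in> I \<Longrightarrow> u \<in> U i \<Longrightarrow> u \<in> U j \<Longrightarrow> (P i u, P j u) \<in> map_step E"
  using estep_iff by blast

lemma cstep_sym: "sym cstep"
  by (auto simp: cstep_def sym_def)

lemma cstep_topspace: "(x, y) \<in> cstep \<Longrightarrow> x \<in> topspace X \<and> y \<in> topspace X"
  using U_topspace by (auto simp: cstep_def)

lemma cstep_rtrancl_topspace: "(x, y) \<in> cstep\<^sup>* \<Longrightarrow> x \<in> topspace X \<Longrightarrow> y \<in> topspace X"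
  by (erule rtranclE) (auto dest: cstep_topspace)

text \<open>A value of a generator is witnessed by a point \<open>u\<close> of the overlap, and
  \<open>u\<close> shares a plaque with \<open>x\<close> and another one with \<open>x'\<close>;
  hence two steps.\<close>

lemma estep_imp_cstep:
  assumes "(p, p') \<in> map_step E" "i \<in> I" "j \<in> I" "x \<in> U i" "x' \<in> U j" "p = P i x" "p' = P j x'"
  shows "(x, x') \<in> cstep ^^ 2"
proof -
  obtain i' j' u where u: "i' \<in> I" "j' \<in> I" "u \<in> U i' \<inter> U j'" "p = P i' u" "p' = P j' u"
    using assms(1) by (auto simp: estep_iff)
  have "i' = i" "j' = j" using P_index u assms by blast+
  then have "(x, u) \<in> cstep" "(u, x') \<in> cstep" using u assms by (auto simp: cstep_def)
  then show ?thesis by (auto simp: numeral_2_eq_2)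
qed

lemma cstep_imp_estep:
  assumes "(x, x') \<in> cstep" "i \<in> I" "j \<in> I" "x \<in> U i" "x' \<in> U j"
  shows "(P i x, P j x') \<in> map_step E ^^ 2"
proof -
  obtain l where l: "l \<in> I" "x \<in> U l" "x' \<in> U l" "P l x = P l x'" using assms(1) by (auto simp: cstep_def)
  then have "(P i x, P l x) \<in> map_step E" "(P l x, P j x') \<in> map_step E"
    using assms estep_I[of i l x] estep_I[of l j x'] by auto
  then show ?thesis by (auto simp: numeral_2_eq_2)
qed

text \<open>Defined by chains in \<open>X\<close>, hence without choosing a chart at
  \<open>y\<close>; \<open>Orb_eq\<close> identifies it with the orbit under the generators.\<close>

definition Orb :: "'x \<Rightarrow> 'p set" where
  "Orb y = {P i x | i x. i \<in> I \<and> x \<in> U i \<and> (y, x) \<in> cstep\<^sup>*}"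

lemma Orb_I: "i \<in> I \<Longrightarrow> x \<in> U i \<Longrightarrow> (y, x) \<in> cstep\<^sup>* \<Longrightarrow> P i x \<in> Orb y"
  by (auto simp: Orb_def)

lemma Orb_D:
  assumes "P i x \<in> Orb y" "i \<in> I" "x \<in> U i" shows "(y, x) \<in> cstep\<^sup>*"
proof -
  obtain j v where j: "P i x = P j v" "j \<in> I" "v \<in> U j" "(y, v) \<in> cstep\<^sup>*" using assms(1) by (auto simp: Orb_def)
  then have "i = j" using P_index assms by blast
  then have "(v, x) \<in> cstep" using j assms by (auto simp: cstep_def)
  then show ?thesis using j(4) by auto
qed

lemma Orb_eq:
  assumes "i \<in> I" "y \<in> U i"
  shows "Orb y = (map_step E)\<^sup>* `` {P i y}"
proof (intro subset_antisym subsetI)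
  fix p assume "p \<in> Orb y"
  then obtain j x where j: "p = P j x" "j \<in> I" "x \<in> U j" "(y, x) \<in> cstep\<^sup>*" by (auto simp: Orb_def)
  from j(4) have "\<forall>j\<in>I. x \<in> U j \<longrightarrow> (P i y, P j x) \<in> (map_step E)\<^sup>*"
  proof (induction rule: rtrancl_induct)
    case base
    then show ?case using assms estep_iff by blast
  next
    case (step x z)
    then obtain l where "l \<in> I" "x \<in> U l" using cstep_def by auto
    then show ?case using step cstep_imp_estep relpow_imp_rtrancl rtrancl_trans by metis
  qed
  then show "p \<in> (map_step E)\<^sup>* `` {P i y}" using j by auto
next
  fix p assume "p \<in> (map_step E)\<^sup>* `` {P i y}"
  then have "(P i y, p) \<in> (map_step E)\<^sup>*" by auto
  then show "p \<in> Orb y"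
  proof (induction rule: rtrancl_induct)
    case base
    then show ?case using assms by (auto intro: Orb_I)
  next
    case (step p p')
    then obtain l j u where "l \<in> I" "j \<in> I" "u \<in> U l \<inter> U j" "p = P l u" "p' = P j u" by (auto simp: estep_iff)
    then show ?case using step Orb_D Orb_I by blast
  qed
qed

lemma Orb_conn_graph:
  assumes "y \<in> topspace X" shows "conn_graph (Orb y) (map_step E)"
proof -
  obtain i where i: "i \<in> I" "y \<in> U i" using assms U_cover by auto
  have s: "sym (map_step E)" by (auto simp: sym_def estep_iff)
  have "(p, p') \<in> (map_step E)\<^sup>*" if "p \<in> Orb y" "p' \<in> Orb y" for p p'
    using that Orb_eq[OF i] sym_rtrancl[OF s] by (metis Image_singleton_iff rtrancl_trans symD)
  moreover have "(p, p) \<in> map_step E" if "p \<in> Orb y" for p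
    using that unfolding Orb_def estep_iff by auto
  ultimately show ?thesis unfolding conn_graph_def using s Orb_eq[OF i]
    by (auto intro: rtrancl_into_rtrancl)
qed

lemma Orb_subset: "Orb y \<subseteq> topspace Z"
  using P_topspace by (auto simp: Orb_def)

text \<open>Triviality at a single point of the orbit, matching the way a trivial holonomy group is
  stated; \<open>TH_germs\<close> spreads it by conjugation.\<close>

definition TH :: "'x \<Rightarrow> bool" where
  "TH x \<longleftrightarrow> (\<exists>p\<in>Orb x. trivial_germs Z H p)"

lemma TH_germs:
  assumes "TH x" "i \<in> I" "x \<in> U i" shows "trivial_germs Z H (P i x)"
proof -
  obtain p where p: "p \<in> Orb x" "trivial_germs Z H p" using assms by (auto simp: TH_def)
  then have "(P i x, p) \<in> (map_step E)\<^sup>*" using Orb_eq assms by auto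
  then have "(p, P i x) \<in> (map_step E)\<^sup>*"
    using Orb_conn_graph[of x] U_topspace assms sym_rtrancl unfolding conn_graph_def by (metis symD)
  then have "P i x \<in> pg_orbit H p" using pg_orbit_eq[OF E_poe E_inv] p(1) Orb_subset by blast
  then show ?thesis using trivial_germs_orbit[OF p(2) E_poe] unfolding pg_orbit_def by blast
qed

lemma Orb_cong: assumes "(x, y) \<in> cstep\<^sup>*" shows "Orb x = Orb y"
proof -
  have "(y, x) \<in> cstep\<^sup>*" using assms sym_rtrancl[OF cstep_sym] by (auto dest: symD)
  then show ?thesis using assms unfolding Orb_def by (metis (no_types, opaque_lifting) rtrancl_trans)
qed

lemma TH_cong: "(x, y) \<in> cstep\<^sup>* \<Longrightarrow> TH x \<longleftrightarrow> TH y"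
  unfolding TH_def using Orb_cong by simp

text \<open>Saturation along the plaques of \<open>U i\<close> preserves openness because
  \<open>P i\<close> is open and continuous. Neighbourhoods can thus be slid along a plaque from
  \<open>x\<close> to \<open>x'\<close>, which drives all continuation arguments below.\<close>

lemma plaque_nbhd:
  assumes "i \<in> I" "openin X G" "x \<in> G \<inter> U i" "x' \<in> U i" "P i x' = P i x"
  shows "openin X {w \<in> U i. P i w \<in> P i ` (G \<inter> U i)}" "x' \<in> {w \<in> U i. P i w \<in> P i ` (G \<inter> U i)}"
  using P_cont[OF assms(1) P_open[OF assms(1,2)]] assms by auto

end

section \<open>Comparison of two cocycles\<close>

text \<open>In the application \<open>C\<close> measures distances, while equicontinuity and
  quasi-effectiveness are known for \<open>R\<close>.\<close>

locale transverse_cocycle_pair =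
  C: transverse_cocycle X I U P Z hm + R: transverse_cocycle X J D Q T hr
  for X :: "'x topology" and I :: "'i set" and U :: "'i \<Rightarrow> 'x set" and P :: "'i \<Rightarrow> 'x \<Rightarrow> 'p"
    and Z :: "'p topology" and hm :: "'i \<Rightarrow> 'i \<Rightarrow> 'p \<rightharpoonup> 'p"
    and J :: "'j set" and D :: "'j \<Rightarrow> 'x set" and Q :: "'j \<Rightarrow> 'x \<Rightarrow> 'q"
    and T :: "'q topology" and hr :: "'j \<Rightarrow> 'j \<Rightarrow> 'q \<rightharpoonup> 'q" +
  assumes compat: "\<And>i j. i \<in> I \<Longrightarrow> j \<in> J \<Longrightarrow> locally_equiv X (U i) (P i) (D j) (Q j)"
begin

lemma chart_at:
  assumes "\<alpha> \<in> J" "x \<in> D \<alpha>" obtains i where "i \<in> I" "x \<in> U i"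
  using R.U_topspace[OF assms] C.U_cover by auto

text \<open>\<open>h\<close> and \<open>f\<close> describe the same holonomy along a leaf from
  \<open>x\<close> to \<open>y\<close> in the two cocycles. As there is no map between the
  transversals, agreement is tested on points of \<open>X\<close>. The implication goes from
  \<open>h\<close> to \<open>f\<close>, the direction in which triviality of germs is to be
  transferred.\<close>

definition represents :: "('p \<rightharpoonup> 'p) \<Rightarrow> ('q \<rightharpoonup> 'q) \<Rightarrow> 'i \<Rightarrow> 'j \<Rightarrow> 'x \<Rightarrow> 'i \<Rightarrow> 'j \<Rightarrow> 'x \<Rightarrow> bool" where
  "represents h f i \<alpha> x j \<beta> y \<longleftrightarrow> h \<in> C.H \<and> h (P i x) = Some (P j y) \<and>
     (\<exists>G G'. openin X G \<and> openin X G' \<and> x \<in> G \<and> y \<in> G' \<and>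
       (\<forall>u\<in>G \<inter> U i \<inter> D \<alpha>. \<forall>v\<in>G' \<inter> U j \<inter> D \<beta>. h (P i u) = Some (P j v) \<longrightarrow> f (Q \<alpha> u) = Some (Q \<beta> v)))"

lemma represents_comp:
  assumes h1: "represents h1 f1 i \<alpha> x l \<gamma> w" and h2: "represents h2 f2 l \<gamma> w j \<beta> y"
    and "i \<in> I" "l \<in> I" "\<gamma> \<in> J" "w \<in> U l" "w \<in> D \<gamma>" "x \<in> U i"
  shows "represents (h2 \<circ>\<^sub>m h1) (f2 \<circ>\<^sub>m f1) i \<alpha> x j \<beta> y"
proof -
  obtain G1 G1' where G1: "openin X G1" "openin X G1'" "x \<in> G1" "w \<in> G1'" "h1 \<in> C.H" "h1 (P i x) = Some (P l w)"
    "\<And>u v. u\<in>G1 \<inter> U i \<inter> D \<alpha> \<Longrightarrow> v\<in>G1' \<inter> U l \<inter> D \<gamma> \<Longrightarrow> h1 (P i u) = Some (P l v) \<Longrightarrow> f1 (Q \<alpha> u) = Some (Q \<gamma> v)"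
    using h1 unfolding represents_def by blast
  obtain G2 G2' where G2: "openin X G2" "openin X G2'" "w \<in> G2" "y \<in> G2'" "h2 \<in> C.H" "h2 (P l w) = Some (P j y)"
    "\<And>u v. u\<in>G2 \<inter> U l \<inter> D \<gamma> \<Longrightarrow> v\<in>G2' \<inter> U j \<inter> D \<beta> \<Longrightarrow> h2 (P l u) = Some (P j v) \<Longrightarrow> f2 (Q \<gamma> u) = Some (Q \<beta> v)"
    using h2 unfolding represents_def by blast
  \<comment> \<open>Projections of the points at which both descriptions are valid. Keeping only
    those \<open>u\<close> whose \<open>h1\<close>-image lies in \<open>B\<close> supplies an
    intermediate point \<open>z\<close> common to both.\<close>
  define B where "B = P l ` ((G1' \<inter> G2 \<inter> D \<gamma>) \<inter> U l)"
  have "openin Z B" unfolding B_def by (rule C.P_open) (use G1 G2 R.U_open assms in auto)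
  then have "openin Z {p. \<exists>p'\<in>B. h1 p = Some p'}" using poe_preimage C.H_poe G1(5) by blast
  then have o: "openin X {u \<in> U i. P i u \<in> {p. \<exists>p'\<in>B. h1 p = Some p'}}" using C.P_cont assms by blast
  define G where "G = G1 \<inter> {u \<in> U i. P i u \<in> {p. \<exists>p'\<in>B. h1 p = Some p'}}"
  have "P l w \<in> B" using G1 G2 assms by (auto simp: B_def)
  then have "openin X G" "x \<in> G" using G1 o assms by (auto simp: G_def)
  moreover have "(f2 \<circ>\<^sub>m f1) (Q \<alpha> u) = Some (Q \<beta> v)"
    if uv: "u \<in> G \<inter> U i \<inter> D \<alpha>" "v\<in>G2' \<inter> U j \<inter> D \<beta>" "(h2 \<circ>\<^sub>m h1) (P i u) = Some (P j v)" for u v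
  proof -
    obtain z where z: "z \<in> G1'" "z \<in> G2" "z \<in> D \<gamma>" "z \<in> U l" "h1 (P i u) = Some (P l z)"
      using uv(1) by (auto simp: G_def B_def)
    then have "h2 (P l z) = Some (P j v)" using uv(3) by simp
    then have "f2 (Q \<gamma> z) = Some (Q \<beta> v)" using G2(7) z uv(2) by blast
    moreover have "f1 (Q \<alpha> u) = Some (Q \<gamma> z)" using G1(7) z uv(1) by (auto simp: G_def)
    ultimately show ?thesis by simp
  qed
  moreover have "(h2 \<circ>\<^sub>m h1) (P i x) = Some (P j y)" using G1(6) G2(6) by simp
  ultimately show ?thesis unfolding represents_def using G1(5) G2(2,4,5) C.H_comp by blast
qed

lemma represents_inv:
  assumes "represents h f i \<alpha> x j \<beta> y" "partial_open_embedding T f"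
  shows "represents (inv_map h) (inv_map f) j \<beta> y i \<alpha> x"
proof -
  have poe: "partial_open_embedding Z h" using assms(1) C.H_poe by (auto simp: represents_def)
  show ?thesis
    using assms(1) unfolding represents_def poe_inv_map_iff[OF poe] poe_inv_map_iff[OF assms(2)]
    by (blast intro: generated_pseudogroup.inv)
qed

text \<open>Continuation along a plaque of \<open>D \<alpha>\<close>, which may cross many of the
  sets \<open>U i\<close>: each crossing composes \<open>h\<close> with a chart change of
  \<open>C\<close>, while nothing moves on the side of \<open>R\<close>. The induction principle
  \<open>plaque_const\<close> takes the place of a path.\<close>

lemma represents_plaque:
  assumes a: "\<alpha> \<in> J" and x: "x \<in> D \<alpha>" "x' \<in> D \<alpha>" "Q \<alpha> x = Q \<alpha> x'" and i: "i \<in> I" "x \<in> U i" and j: "j \<in> I" "x' \<in> U j"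
  shows "\<exists>h. represents h (id_map T) i \<alpha> x j \<alpha> x'"
proof -
  define good where "good x' \<longleftrightarrow> (\<forall>j\<in>I. x' \<in> U j \<longrightarrow> (\<exists>h. h \<in> C.H \<and> h (P i x) = Some (P j x') \<and>
     (\<exists>G G'. openin X G \<and> openin X G' \<and> x \<in> G \<and> x' \<in> G' \<and>
       (\<forall>u\<in>G \<inter> U i \<inter> D \<alpha>. \<forall>v\<in>G' \<inter> U j \<inter> D \<alpha>. h (P i u) = Some (P j v) \<longrightarrow> Q \<alpha> u = Q \<alpha> v))))" for x'
  have "good x'"
  proof (rule R.plaque_const[of \<alpha> x x' good])
    show "good x"
      unfolding good_def
    proof (intro ballI impI)
      fix j assume j: "j \<in> I" "x \<in> U j"
      obtain G where G: "openin X G" "x \<in> G" "G \<subseteq> U i" "G \<subseteq> D \<alpha>" "\<And>u v. u \<in> G \<Longrightarrow> v \<in> G \<Longrightarrow> P i u = P i v \<longleftrightarrow> Q \<alpha> u = Q \<alpha> v"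
        using locally_equivE[OF compat[OF i(1) a] i(2) x(1)] by metis
      have "Q \<alpha> u = Q \<alpha> v" if uv: "u \<in> G" "v \<in> G \<inter> U j" "hm i j (P i u) = Some (P j v)" for u v
      proof -
        obtain z where z: "z \<in> U i \<inter> U j" "P i u = P i z" "P j v = P j z" using uv(3) C.hm_iff i j by auto
        then have "P i v = P i z" using C.P_change[of j i v z] i j uv G by auto
        then have "P i u = P i v" using z by simp
        then show ?thesis using G(5) uv(1,2) by blast
      qed
      then show "\<exists>h. h \<in> C.H \<and> h (P i x) = Some (P j x) \<and>
         (\<exists>G G'. openin X G \<and> openin X G' \<and> x \<in> G \<and> x \<in> G' \<and>
         (\<forall>u\<in>G \<inter> U i \<inter> D \<alpha>. \<forall>v\<in>G' \<inter> U j \<inter> D \<alpha>. h (P i u) = Some (P j v) \<longrightarrow> Q \<alpha> u = Q \<alpha> v))"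
        using G i j C.hm_in_H[OF i(1) j(1)] C.hm_I[OF i(1) j(1) i(2) j(2)]
        by (intro exI[of _ "hm i j"] conjI exI[of _ G]) auto
    qed
  next
    fix w assume w: "w \<in> D \<alpha>" "Q \<alpha> w = Q \<alpha> x"
    obtain l where l: "l \<in> I" "w \<in> U l" using chart_at[OF a w(1)] by auto
    obtain G where G: "openin X G" "w \<in> G" "G \<subseteq> U l" "G \<subseteq> D \<alpha>" "\<And>u v. u \<in> G \<Longrightarrow> v \<in> G \<Longrightarrow> P l u = P l v \<longleftrightarrow> Q \<alpha> u = Q \<alpha> v"
      using locally_equivE[OF compat[OF l(1) a] l(2) w(1)] by metis
    have "good w2" if w12: "w1 \<in> G" "w2 \<in> G" "Q \<alpha> w1 = Q \<alpha> x" "Q \<alpha> w2 = Q \<alpha> x" "good w1" for w1 w2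
    proof -
      have Pw: "P l w2 = P l w1" using w12 G by auto
      have w1: "w1 \<in> U l" using w12(1) G(3) by auto
      obtain h G1 G1' where h: "h \<in> C.H" "h (P i x) = Some (P l w1)" "openin X G1" "openin X G1'" "x \<in> G1" "w1 \<in> G1'"
        "\<And>u v. u\<in>G1 \<inter> U i \<inter> D \<alpha> \<Longrightarrow> v\<in>G1' \<inter> U l \<inter> D \<alpha> \<Longrightarrow> h (P i u) = Some (P l v) \<Longrightarrow> Q \<alpha> u = Q \<alpha> v"
        using bspec[OF w12(5)[unfolded good_def] l(1)] w1 by blast
      show ?thesis unfolding good_def
      proof (intro ballI impI)
        fix j assume j: "j \<in> I" "w2 \<in> U j"
        \<comment> \<open>The neighbourhood \<open>G1'\<close> of \<open>w1\<close>, slid along the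
          plaque to \<open>w2\<close> inside \<open>G\<close>. Each \<open>v\<close> in it has a
          companion \<open>v1\<close> in \<open>G1'\<close> with the same projection.\<close>
        define G2 where "G2 = G \<inter> {v \<in> U l. P l v \<in> P l ` ((G1' \<inter> G) \<inter> U l)}"
        have G2: "openin X G2" "w2 \<in> G2"
        proof -
          have "openin X (G1' \<inter> G)" "w1 \<in> (G1' \<inter> G) \<inter> U l" "w2 \<in> U l"
            using h(4,6) G(1,3) w12(1,2) by auto
          from C.plaque_nbhd[OF l(1) this Pw] show "openin X G2" "w2 \<in> G2"
            using G(1) w12(2) by (auto simp: G2_def)
        qed
        have "Q \<alpha> u = Q \<alpha> v"
          if uv: "u \<in> G1 \<inter> U i \<inter> D \<alpha>" "v \<in> G2 \<inter> U j \<inter> D \<alpha>" "(hm l j \<circ>\<^sub>m h) (P i u) = Some (P j v)" for u v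
        proof -
          obtain p where p: "h (P i u) = Some p" "hm l j p = Some (P j v)" using uv(3) by (auto simp: map_comp_Some_iff)
          then obtain z where z: "z \<in> U l \<inter> U j" "p = P l z" "P j v = P j z" using C.hm_iff l j by auto
          then have lv: "P l v = P l z" using C.P_change[of j l v z] l j uv G by (auto simp: G2_def)
          obtain v1 where v1: "v1 \<in> G1'" "v1 \<in> G" "P l v = P l v1" using uv(2) by (auto simp: G2_def)
          have "Q \<alpha> u = Q \<alpha> v1" using h(7)[OF uv(1), of v1] v1 G p z lv by auto
          also have "\<dots> = Q \<alpha> v" using v1 G uv(2) by (auto simp: G2_def)
          finally show ?thesis .
        qed
        moreover have "(hm l j \<circ>\<^sub>m h) (P i x) = Some (P j w2)"
          using h(2) C.hm_I[of l j w2] l j w12 G Pw by auto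
        ultimately show "\<exists>h. h \<in> C.H \<and> h (P i x) = Some (P j w2) \<and>
         (\<exists>G G'. openin X G \<and> openin X G' \<and> x \<in> G \<and> w2 \<in> G' \<and>
         (\<forall>u\<in>G \<inter> U i \<inter> D \<alpha>. \<forall>v\<in>G' \<inter> U j \<inter> D \<alpha>. h (P i u) = Some (P j v) \<longrightarrow> Q \<alpha> u = Q \<alpha> v))"
          using h(3,5) G2 C.H_comp[OF C.hm_in_H[OF l(1) j(1)] h(1)]
          by (intro exI[of _ "hm l j \<circ>\<^sub>m h"] conjI exI[of _ G1] exI[of _ G2]) auto
      qed
    qed
    then show "\<exists>G. openin X G \<and> w \<in> G \<and> (\<forall>w1\<in>G \<inter> D \<alpha>. \<forall>w2\<in>G \<inter> D \<alpha>. Q \<alpha> w1 = Q \<alpha> x \<longrightarrow> Q \<alpha> w2 = Q \<alpha> x \<longrightarrow> good w1 \<longrightarrow> good w2)"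
      using G by (intro exI[of _ G]) blast
  qed (use a x in auto)
  then obtain h G G' where h: "h \<in> C.H" "h (P i x) = Some (P j x')" "openin X G" "openin X G'" "x \<in> G" "x' \<in> G'"
    and G: "\<forall>u\<in>G \<inter> U i \<inter> D \<alpha>. \<forall>v\<in>G' \<inter> U j \<inter> D \<alpha>. h (P i u) = Some (P j v) \<longrightarrow> Q \<alpha> u = Q \<alpha> v"
    using bspec[OF \<open>good x'\<close>[unfolded good_def] j(1)] j(2) by blast
  have "\<forall>u\<in>G \<inter> U i \<inter> D \<alpha>. \<forall>v\<in>G' \<inter> U j \<inter> D \<alpha>. h (P i u) = Some (P j v) \<longrightarrow> id_map T (Q \<alpha> u) = Some (Q \<alpha> v)"
    using G R.P_topspace[OF a] by auto
  then show ?thesis unfolding represents_def using h by blast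
qed

text \<open>At a fixed \<open>w\<close> in a fixed chart of \<open>C\<close> nothing moves, so a
  chart change of \<open>R\<close> corresponds to the identity.\<close>

lemma represents_change:
  assumes "\<alpha> \<in> J" "\<beta> \<in> J" "w \<in> D \<alpha>" "w \<in> D \<beta>" "l \<in> I" "w \<in> U l"
  shows "represents (id_map Z) (hr \<alpha> \<beta>) l \<alpha> w l \<beta> w"
proof -
  obtain G where G: "openin X G" "w \<in> G" "G \<subseteq> U l" "G \<subseteq> D \<alpha>" "\<And>u v. u \<in> G \<Longrightarrow> v \<in> G \<Longrightarrow> P l u = P l v \<longleftrightarrow> Q \<alpha> u = Q \<alpha> v"
    using locally_equivE[OF compat[of l \<alpha>], of w] assms by metis
  have "openin X (G \<inter> D \<beta>)" using G R.U_open assms by auto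
  moreover have "hr \<alpha> \<beta> (Q \<alpha> u) = Some (Q \<beta> v)"
    if uv: "u \<in> G \<inter> D \<beta>" "v \<in> G \<inter> D \<beta>" "id_map Z (P l u) = Some (P l v)" for u v
  proof -
    have "Q \<alpha> u = Q \<alpha> v" using uv G(5)[of u v] by simp
    then show ?thesis using uv R.hm_I[of \<alpha> \<beta> v] G(4) assms by auto
  qed
  ultimately show ?thesis
    unfolding represents_def using assms(3-6) G(2) C.P_topspace[of l w] generated_pseudogroup.ident[of Z C.E]
    by (intro conjI exI[of _ "G \<inter> D \<beta>"]) auto
qed

text \<open>The case of a generator carries the content: its value at \<open>Q \<alpha> x\<close> is
  witnessed by a point \<open>w\<close> of the overlap, so one follows a plaque from
  \<open>x\<close> to \<open>w\<close>, changes charts at \<open>w\<close>, and follows a plaque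
  from \<open>w\<close> to \<open>y\<close>. The other rules only compose, invert or shrink
  neighbourhoods.\<close>

lemma represents_exists:
  assumes "f \<in> R.H" "f (Q \<alpha> x) = Some (Q \<beta> y)" "\<alpha> \<in> J" "\<beta> \<in> J" "x \<in> D \<alpha>" "y \<in> D \<beta>" "i \<in> I" "j \<in> I" "x \<in> U i" "y \<in> U j"
  shows "\<exists>h. represents h f i \<alpha> x j \<beta> y"
  using assms
proof (induction arbitrary: i \<alpha> x j \<beta> y)
  case (gen f)
  then obtain \<gamma> \<delta> where f: "f = hr \<gamma> \<delta>" "\<gamma> \<in> J" "\<delta> \<in> J" by (auto simp: R.E_def)
  then obtain w where w: "w \<in> D \<gamma> \<inter> D \<delta>" "Q \<alpha> x = Q \<gamma> w" "Q \<beta> y = Q \<delta> w" using R.hm_iff gen.prems by auto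
  have [simp]: "\<gamma> = \<alpha>" "\<delta> = \<beta>" using R.P_index f w gen.prems by blast+
  obtain l where l: "l \<in> I" "w \<in> U l" using chart_at[of \<gamma> w] w f by auto
  obtain h1 where h1: "represents h1 (id_map T) i \<alpha> x l \<alpha> w"
    using represents_plaque[of \<alpha> x w i l] w gen.prems l by auto
  obtain h2 where h2: "represents h2 (id_map T) l \<beta> w j \<beta> y"
    using represents_plaque[of \<beta> w y l j] w gen.prems l by auto
  have "represents (id_map Z) f l \<alpha> w l \<beta> w"
    unfolding f(1) using represents_change[of \<alpha> \<beta> w l] w gen.prems l by auto
  from represents_comp[OF represents_comp[OF h1 this] h2]
  have "represents (h2 \<circ>\<^sub>m (id_map Z \<circ>\<^sub>m h1)) (id_map T \<circ>\<^sub>m (f \<circ>\<^sub>m id_map T)) i \<alpha> x j \<beta> y"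
    using w gen.prems l by auto
  then show ?case using comp_id_map[OF R.E_poe[OF gen.hyps]] id_map_comp[OF R.E_poe[OF gen.hyps]] by auto
next
  case ident
  then have "Q \<alpha> x = Q \<beta> y" by simp
  moreover have "\<alpha> = \<beta>" using R.P_index ident calculation by blast
  ultimately show ?case using represents_plaque[of \<alpha> x y i j] ident by auto
next
  case (comp g f)
  then obtain t where t: "f (Q \<alpha> x) = Some t" "g t = Some (Q \<beta> y)" by (auto simp: map_comp_Some_iff)
  then have "t \<in> topspace T" using poe_topspace(2)[OF R.H_poe[OF comp.hyps(2)]] by auto
  then obtain \<gamma> w where w: "\<gamma> \<in> J" "w \<in> D \<gamma>" "t = Q \<gamma> w" using R.Z_cover by auto
  obtain l where l: "l \<in> I" "w \<in> U l" using chart_at[OF w(1,2)] by auto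
  obtain h1 where h1: "represents h1 f i \<alpha> x l \<gamma> w"
    using comp.IH(2)[of \<alpha> x \<gamma> w i l] comp.prems w t l by auto
  obtain h2 where h2: "represents h2 g l \<gamma> w j \<beta> y"
    using comp.IH(1)[of \<gamma> w \<beta> y l j] comp.prems w t l by auto
  show ?case using represents_comp[OF h1 h2] comp.prems w l by auto
next
  case (inv f)
  have poe: "partial_open_embedding T f" using R.H_poe inv.hyps by auto
  then have "f (Q \<beta> y) = Some (Q \<alpha> x)" using inv.prems(1) poe_inv_map_iff by metis
  then obtain h where "represents h f j \<beta> y i \<alpha> x" using inv.IH[of \<beta> y \<alpha> x j i] inv.prems by auto
  then show ?case using represents_inv poe by blast
next
  case (restr f V)
  then have fx: "f (Q \<alpha> x) = Some (Q \<beta> y)" and V: "Q \<alpha> x \<in> V" by (auto simp: restrict_map_Some_iff)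
  obtain h where h: "represents h f i \<alpha> x j \<beta> y" using restr.IH[OF fx] restr.prems by auto
  have o: "openin X {u \<in> D \<alpha>. Q \<alpha> u \<in> V}" using R.P_cont restr by auto
  obtain G G' where G: "openin X G" "openin X G'" "x \<in> G" "y \<in> G'" "h \<in> C.H" "h (P i x) = Some (P j y)"
     "\<And>u v. u\<in>G \<inter> U i \<inter> D \<alpha> \<Longrightarrow> v\<in>G' \<inter> U j \<inter> D \<beta> \<Longrightarrow> h (P i u) = Some (P j v) \<Longrightarrow> f (Q \<alpha> u) = Some (Q \<beta> v)"
    using h unfolding represents_def by blast
  have "openin X (G \<inter> {u \<in> D \<alpha>. Q \<alpha> u \<in> V})" using o G by auto
  moreover have "x \<in> G \<inter> {u \<in> D \<alpha>. Q \<alpha> u \<in> V}" using G V restr.prems by auto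
  ultimately show ?case unfolding represents_def using G
    by (intro exI[of _ h] conjI exI[of _ "G \<inter> {u \<in> D \<alpha>. Q \<alpha> u \<in> V}"] exI[of _ G'])
      (auto simp: restrict_map_Some_iff)
next
  case (union F f)
  then have "Q \<alpha> x \<in> (\<Union>g\<in>F. dom g)" by (metis domI)
  then obtain g t where g: "g \<in> F" "g (Q \<alpha> x) = Some t" by blast
  then have le: "g \<subseteq>\<^sub>m f" and gR: "g \<in> R.H" using union.IH by simp_all
  have le': "f p = Some p'" if "g p = Some p'" for p p' using le that by (auto simp: map_le_def dom_def)
  then have "t = Q \<beta> y" using g union.prems by fastforce
  then obtain h where "represents h g i \<alpha> x j \<beta> y" using union.IH g union.prems by blast
  then show ?case unfolding represents_def using le' by meson
qed

text \<open>A map \<open>f\<close> of \<open>R\<close> that fixes \<open>Q \<alpha> x\<close> is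
  represented by some \<open>h\<close> of \<open>C\<close> that fixes \<open>P i x\<close>. The germ
  of \<open>h\<close> is trivial, and this forces \<open>f\<close> to fix the projections of all
  points near \<open>x\<close>.\<close>

lemma TH_transfer:
  assumes "C.TH x" "\<alpha> \<in> J" "x \<in> D \<alpha>"
  shows "trivial_germs T R.H (Q \<alpha> x)"
  unfolding trivial_germs_def
proof (intro ballI impI)
  fix f assume f: "f \<in> R.H" "f (Q \<alpha> x) = Some (Q \<alpha> x)"
  obtain i where i: "i \<in> I" "x \<in> U i" using chart_at[OF assms(2,3)] by auto
  obtain h G G' where h: "h \<in> C.H" "h (P i x) = Some (P i x)" "openin X G" "openin X G'" "x \<in> G" "x \<in> G'"
     "\<And>u v. u\<in>G \<inter> U i \<inter> D \<alpha> \<Longrightarrow> v\<in>G' \<inter> U i \<inter> D \<alpha> \<Longrightarrow> h (P i u) = Some (P i v) \<Longrightarrow> f (Q \<alpha> u) = Some (Q \<alpha> v)"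
    using represents_exists[OF f assms(2,2,3,3) i(1,1,2,2)] unfolding represents_def by blast
  have "same_germ Z (P i x) h (id_map Z)"
    using C.TH_germs[OF assms(1) i] h(1,2) unfolding trivial_germs_def by blast
  then obtain V where V: "openin Z V" "P i x \<in> V" "V \<subseteq> dom (id_map Z)" "\<And>p. p \<in> V \<Longrightarrow> h p = id_map Z p"
    unfolding same_germ_def by auto
  \<comment> \<open>Both neighbourhoods are intersected so that \<open>represents\<close> can be
    applied with \<open>u\<close> and \<open>v\<close> equal.\<close>
  define B where "B = (G \<inter> G' \<inter> {u \<in> U i. P i u \<in> V})"
  show "same_germ T (Q \<alpha> x) f (id_map T)"
  proof (rule same_germI)
    show "openin T (Q \<alpha> ` (B \<inter> D \<alpha>))"
      by (rule R.P_open) (use assms h C.P_cont[OF i(1) V(1)] in \<open>auto simp: B_def\<close>)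
    show "Q \<alpha> x \<in> Q \<alpha> ` (B \<inter> D \<alpha>)" using h V i assms by (auto simp: B_def)
  next
    fix t assume "t \<in> Q \<alpha> ` (B \<inter> D \<alpha>)"
    then obtain u where u: "u \<in> G" "u \<in> G'" "u \<in> U i" "P i u \<in> V" "u \<in> D \<alpha>" "t = Q \<alpha> u" by (auto simp: B_def)
    have "h (P i u) = Some (P i u)" using V(4)[OF u(4)] C.P_topspace[OF i(1) u(3)] by simp
    then have "f t = Some t" using h(7)[of u u] u by auto
    then show "t \<in> dom f" "f t = id_map T t" using poe_topspace(1)[OF R.H_poe[OF f(1)]] by (auto simp: id_map_def)
  qed
qed

end

section \<open>Flow boxes and leaves\<close>

text \<open>\<open>loc\<close> is symmetric in \<open>w1\<close> and \<open>w2\<close>, so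
  \<open>Q\<close> is locally constant on \<open>S\<close>. This is the form in which connectedness
  of plaques and of leaves is used throughout.\<close>

lemma connectedin_locally_constant:
  assumes S: "connectedin X S" and x: "x \<in> S" "x' \<in> S" "Q x"
    and loc: "\<And>w. w \<in> S \<Longrightarrow> \<exists>G. openin X G \<and> w \<in> G \<and> (\<forall>w1\<in>G \<inter> S. \<forall>w2\<in>G \<inter> S. Q w1 \<longrightarrow> Q w2)"
  shows "Q x'"
proof (rule ccontr)
  assume "\<not> Q x'"
  define E1 where "E1 = \<Union>{G. openin X G \<and> (\<forall>w\<in>G \<inter> S. Q w)}"
  define E2 where "E2 = \<Union>{G. openin X G \<and> (\<forall>w\<in>G \<inter> S. \<not> Q w)}"
  have 1: "w \<in> E1" if w: "w \<in> S" "Q w" for w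
  proof -
    obtain G where "openin X G" "w \<in> G" "\<forall>w1\<in>G \<inter> S. \<forall>w2\<in>G \<inter> S. Q w1 \<longrightarrow> Q w2" using loc[OF w(1)] by auto
    then show ?thesis using w unfolding E1_def by blast
  qed
  have 2: "w \<in> E2" if w: "w \<in> S" "\<not> Q w" for w
  proof -
    obtain G where "openin X G" "w \<in> G" "\<forall>w1\<in>G \<inter> S. \<forall>w2\<in>G \<inter> S. Q w1 \<longrightarrow> Q w2" using loc[OF w(1)] by auto
    then show ?thesis using w unfolding E2_def by blast
  qed
  have "openin X E1" "openin X E2" unfolding E1_def E2_def by auto
  moreover have "S \<subseteq> E1 \<union> E2" using 1 2 by blast
  moreover have "E1 \<inter> E2 \<inter> S = {}" unfolding E1_def E2_def by blast
  moreover have "E1 \<inter> S \<noteq> {}" "E2 \<inter> S \<noteq> {}" using 1 2 x \<open>\<not> Q x'\<close> by blast+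
  ultimately show False using S unfolding connectedin by blast
qed

text \<open>The ball is star-shaped: it is the union of the segments issuing from \<open>a\<close>.
  Coordinates from \<open>n\<close> on vanish at both ends of a segment, so the segment stays in
  \<open>Euclidean_space n\<close>.\<close>

lemma connectedin_open_ball:
  assumes a: "a \<in> topspace (Euclidean_space n)" "r > 0"
  shows "connectedin (Euclidean_space n) (open_ball n a r)"
proof -
  define seg where "seg x = (\<lambda>t i. a i + t * (x i - a i)) ` {0..1::real}" for x :: "nat \<Rightarrow> real"
  have seg: "connectedin (Euclidean_space n) (seg x)" "a \<in> seg x" "x \<in> seg x" "seg x \<subseteq> open_ball n a r"
    if x: "x \<in> open_ball n a r" for x
  proof -
    have z: "\<And>i. i \<ge> n \<Longrightarrow> x i = 0" "\<And>i. i \<ge> n \<Longrightarrow> a i = 0"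
      using x a by (auto simp: open_ball_def topspace_Euclidean_space)
    have "continuous_map euclideanreal (Euclidean_space n) (\<lambda>t i. a i + t * (x i - a i))"
      unfolding Euclidean_space_def continuous_map_in_subtopology continuous_map_componentwise
      using z by (auto intro!: continuous_intros)
    then show "connectedin (Euclidean_space n) (seg x)"
      unfolding seg_def by (rule connectedin_continuous_map_image) simp
    show "a \<in> seg x" unfolding seg_def by (rule image_eqI[of _ _ 0]) auto
    show "x \<in> seg x" unfolding seg_def by (rule image_eqI[of _ _ 1]) auto
    show "seg x \<subseteq> open_ball n a r"
    proof
      fix y assume "y \<in> seg x"
      then obtain t where t: "0 \<le> t" "t \<le> 1" "y = (\<lambda>i. a i + t * (x i - a i))" by (auto simp: seg_def)
      have "(\<Sum>i<n. (y i - a i)\<^sup>2) \<le> (\<Sum>i<n. (x i - a i)\<^sup>2)"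
      proof (rule sum_mono)
        fix i
        have "(t * (x i - a i))\<^sup>2 \<le> 1 * (x i - a i)\<^sup>2"
          unfolding power_mult_distrib using t by (intro mult_right_mono) (auto simp: power_le_one)
        then show "(y i - a i)\<^sup>2 \<le> (x i - a i)\<^sup>2" by (simp add: t(3))
      qed
      then have "sqrt (\<Sum>i<n. (y i - a i)\<^sup>2) < r" using x
        unfolding open_ball_def by (auto intro: le_less_trans[OF real_sqrt_le_mono])
      then show "y \<in> open_ball n a r" using z t(3) by (auto simp: open_ball_def topspace_Euclidean_space)
    qed
  qed
  have "a \<in> open_ball n a r" using a by (simp add: open_ball_def)
  then have "a \<in> \<Inter>(seg ` open_ball n a r)" using seg(2) by blast
  then have "connectedin (Euclidean_space n) (\<Union>(seg ` open_ball n a r))"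
    by (intro connectedin_Union) (use seg(1) in auto)
  moreover have "open_ball n a r = \<Union>(seg ` open_ball n a r)" using seg(3,4) by blast
  ultimately show ?thesis by simp
qed

section \<open>Projection and plaques of a single flow box\<close>

context
  fixes n :: nat and X :: "'x topology" and b :: "('x, 'z) flow_box"
  assumes fb: "is_flow_box n X b"
begin

lemma fb_open: "openin X (fb_dom b)"
  using fb by (auto simp: is_flow_box_def)

lemma fb_topspace: "topspace (subtopology X (fb_dom b)) = fb_dom b"
  using openin_subset[OF fb_open] by auto

lemma fb_hom: "homeomorphic_map (subtopology X (fb_dom b)) (fb_model n b) (fb_chart b)"
  using fb by (auto simp: is_flow_box_def)

lemma fb_ball_props: "fb_ball b \<subseteq> topspace (Euclidean_space n)" "fb_ball b \<noteq> {}" "connectedin (Euclidean_space n) (fb_ball b)"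
proof -
  obtain a r where ar: "a \<in> topspace (Euclidean_space n)" "r > 0" "fb_ball b = open_ball n a r"
    using fb by (auto simp: is_flow_box_def)
  then have "a \<in> fb_ball b" by (simp add: open_ball_def)
  then show "fb_ball b \<noteq> {}" by auto
  show "fb_ball b \<subseteq> topspace (Euclidean_space n)" unfolding ar(3) open_ball_def by auto
  show "connectedin (Euclidean_space n) (fb_ball b)" unfolding ar(3) by (rule connectedin_open_ball[OF ar(1,2)])
qed

lemma fb_model_topspace: "topspace (fb_model n b) = fb_ball b \<times> topspace (fb_trans b)"
  using fb_ball_props(1) by (auto simp: fb_model_def)

lemma fb_chart_image: "fb_chart b ` fb_dom b = fb_ball b \<times> topspace (fb_trans b)"
  using homeomorphic_imp_surjective_map[OF fb_hom] unfolding fb_topspace fb_model_topspace .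

lemma fb_proj_image: "fb_proj b ` fb_dom b = topspace (fb_trans b)"
proof -
  have "fb_proj b ` fb_dom b = snd ` fb_chart b ` fb_dom b" unfolding fb_proj_def by auto
  then show ?thesis using fb_ball_props(2) by (simp add: fb_chart_image)
qed

lemma fb_proj_continuous: "continuous_map (subtopology X (fb_dom b)) (fb_trans b) (fb_proj b)"
proof -
  have "continuous_map (subtopology X (fb_dom b)) (fb_trans b) (snd \<circ> fb_chart b)"
    using homeomorphic_imp_continuous_map[OF fb_hom] unfolding fb_model_def
    by (rule continuous_map_compose) (rule continuous_map_snd)
  then show ?thesis by (simp add: fb_proj_def[abs_def] comp_def)
qed

lemma fb_proj_preimage:
  assumes "openin (fb_trans b) V" shows "openin X {x \<in> fb_dom b. fb_proj b x \<in> V}"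
proof -
  have "openin (subtopology X (fb_dom b)) {x \<in> fb_dom b. fb_proj b x \<in> V}"
    using openin_continuous_map_preimage[OF fb_proj_continuous assms] unfolding fb_topspace .
  then show ?thesis using fb_open openin_trans_full by blast
qed

lemma fb_proj_open:
  assumes "openin X G" shows "openin (fb_trans b) (fb_proj b ` (G \<inter> fb_dom b))"
proof -
  have "open_map (subtopology X (fb_dom b)) (fb_trans b) (snd \<circ> fb_chart b)"
    using homeomorphic_imp_open_map[OF fb_hom] unfolding fb_model_def
    by (rule open_map_compose) (rule open_map_snd)
  moreover have "openin (subtopology X (fb_dom b)) (G \<inter> fb_dom b)" using assms by (simp add: openin_subtopology_Int)
  ultimately have "openin (fb_trans b) ((snd \<circ> fb_chart b) ` (G \<inter> fb_dom b))" unfolding open_map_def by blast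
  then show ?thesis by (simp add: fb_proj_def[abs_def] comp_def)
qed

lemma fb_plaque_connected:
  assumes z: "z \<in> topspace (fb_trans b)" shows "connectedin X (plaque b z)"
proof -
  obtain g where g: "homeomorphic_maps (subtopology X (fb_dom b)) (fb_model n b) (fb_chart b) g"
    using fb_hom unfolding homeomorphic_map_maps by auto
  have cg: "continuous_map (fb_model n b) (subtopology X (fb_dom b)) g"
    and gc: "\<And>x. x \<in> fb_dom b \<Longrightarrow> g (fb_chart b x) = x"
    and cg': "\<And>y. y \<in> fb_ball b \<times> topspace (fb_trans b) \<Longrightarrow> fb_chart b (g y) = y"
    using g unfolding homeomorphic_maps_def fb_model_topspace fb_topspace by auto
  have gd: "g y \<in> fb_dom b" if "y \<in> fb_ball b \<times> topspace (fb_trans b)" for y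
    using continuous_map_image_subset_topspace[OF cg] that unfolding fb_model_topspace fb_topspace by auto
  have "connectedin (subtopology (Euclidean_space n) (fb_ball b)) (fb_ball b)"
    using fb_ball_props by (simp add: connectedin_subtopology)
  then have "connectedin (fb_model n b) (fb_ball b \<times> {z})"
    unfolding fb_model_def connectedin_Times using z by simp
  then have "connectedin (subtopology X (fb_dom b)) (g ` (fb_ball b \<times> {z}))"
    using connectedin_continuous_map_image[OF cg] by blast
  moreover have "g ` (fb_ball b \<times> {z}) = plaque b z"
  proof
    show "g ` (fb_ball b \<times> {z}) \<subseteq> plaque b z" using gd cg' z by (auto simp: plaque_def fb_proj_def)
    show "plaque b z \<subseteq> g ` (fb_ball b \<times> {z})"
    proof
      fix x assume x: "x \<in> plaque b z"
      then have "fb_chart b x \<in> fb_ball b \<times> topspace (fb_trans b)" "snd (fb_chart b x) = z"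
        using fb_chart_image by (auto simp: plaque_def fb_proj_def)
      then have "fb_chart b x \<in> fb_ball b \<times> {z}" by (auto simp: mem_Times_iff)
      then show "x \<in> g ` (fb_ball b \<times> {z})" using x gc by (metis (no_types, lifting) image_eqI mem_Collect_eq plaque_def)
    qed
  qed
  ultimately show ?thesis by (simp add: connectedin_subtopology)
qed

lemma fb_plaque_const:
  assumes x: "x \<in> fb_dom b" "x' \<in> fb_dom b" "fb_proj b x = fb_proj b x'" "Q x"
    and loc: "\<And>w. w \<in> fb_dom b \<Longrightarrow> fb_proj b w = fb_proj b x \<Longrightarrow> \<exists>G. openin X G \<and> w \<in> G \<and>
           (\<forall>w1\<in>G \<inter> fb_dom b. \<forall>w2\<in>G \<inter> fb_dom b. fb_proj b w1 = fb_proj b x \<longrightarrow> fb_proj b w2 = fb_proj b x \<longrightarrow> Q w1 \<longrightarrow> Q w2)"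
  shows "Q x'"
proof (rule connectedin_locally_constant[where S = "plaque b (fb_proj b x)"])
  show "connectedin X (plaque b (fb_proj b x))" using x fb_proj_image by (intro fb_plaque_connected) auto
  fix w assume "w \<in> plaque b (fb_proj b x)"
  then show "\<exists>G. openin X G \<and> w \<in> G \<and> (\<forall>w1\<in>G \<inter> plaque b (fb_proj b x). \<forall>w2\<in>G \<inter> plaque b (fb_proj b x). Q w1 \<longrightarrow> Q w2)"
    using loc[of w] unfolding plaque_def by blast
qed (use x in \<open>auto simp: plaque_def\<close>)

end

lemma coord_change_local:
  assumes "coord_change n k X b b'" "x \<in> fb_dom b" "x \<in> fb_dom b'"
  shows "\<exists>G. openin X G \<and> x \<in> G \<and> G \<subseteq> fb_dom b \<inter> fb_dom b' \<and>
    (\<forall>u\<in>G. \<forall>v\<in>G. fb_proj b u = fb_proj b v \<longrightarrow> fb_proj b' u = fb_proj b' v)"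
proof -
  have "x \<in> fb_dom b \<inter> fb_dom b'" using assms by simp
  from bspec[OF assms(1)[unfolded coord_change_def] this]
  obtain N xi zeta where N: "openin X N" "x \<in> N" "N \<subseteq> fb_dom b \<inter> fb_dom b'"
    and ch: "\<forall>v\<in>N. fb_chart b' v = (xi (fb_chart b v), zeta (fb_proj b v))"
    by (elim exE conjE)
  have "fb_proj b' v = zeta (fb_proj b v)" if "v \<in> N" for v
    using bspec[OF ch that] by (simp add: fb_proj_def)
  then show ?thesis using N by (intro exI[of _ N]) simp
qed

text \<open>Each direction of the coordinate change yields one implication between equalities of
  projections; the equivalence holds on the intersection of the two neighbourhoods.\<close>

lemma compatible_atlases_locally_equiv:
  assumes "compatible_atlases n k X \<A> \<B>" "b \<in> \<A>" "b' \<in> \<B>"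
  shows "locally_equiv X (fb_dom b) (fb_proj b) (fb_dom b') (fb_proj b')"
  unfolding locally_equiv_def
proof
  fix x assume x: "x \<in> fb_dom b \<inter> fb_dom b'"
  have c: "coord_change n k X b b'" "coord_change n k X b' b" using assms by (auto simp: compatible_atlases_def)
  obtain G1 where G1: "openin X G1" "x \<in> G1" "G1 \<subseteq> fb_dom b \<inter> fb_dom b'"
    "\<forall>u\<in>G1. \<forall>v\<in>G1. fb_proj b u = fb_proj b v \<longrightarrow> fb_proj b' u = fb_proj b' v"
    using coord_change_local[OF c(1) IntD1[OF x] IntD2[OF x]] by blast
  obtain G2 where G2: "openin X G2" "x \<in> G2"
    "\<forall>u\<in>G2. \<forall>v\<in>G2. fb_proj b' u = fb_proj b' v \<longrightarrow> fb_proj b u = fb_proj b v"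
    using coord_change_local[OF c(2) IntD2[OF x] IntD1[OF x]] by blast
  have "fb_proj b u = fb_proj b v \<longleftrightarrow> fb_proj b' u = fb_proj b' v" if "u \<in> G1 \<inter> G2" "v \<in> G1 \<inter> G2" for u v
    using G1(4)[rule_format, of u v] G2(3)[rule_format, of u v] that by blast
  moreover have "openin X (G1 \<inter> G2)" "x \<in> G1 \<inter> G2" "G1 \<inter> G2 \<subseteq> fb_dom b \<inter> fb_dom b'"
    using G1(1-3) G2(1,2) by blast+
  ultimately show "\<exists>G. openin X G \<and> x \<in> G \<and> G \<subseteq> fb_dom b \<inter> fb_dom b' \<and>
      (\<forall>u\<in>G. \<forall>v\<in>G. fb_proj b u = fb_proj b v \<longleftrightarrow> fb_proj b' u = fb_proj b' v)"
    by blast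
qed

section \<open>Defining cocycles as transverse cocycles, and chains along leaves\<close>

definition cpt :: "('x, 'z, 'i) cocycle \<Rightarrow> 'i \<Rightarrow> 'x \<Rightarrow> 'i \<times> 'z" where
  "cpt C i x = (i, cproj C i x)"

lemma defining_cocycle_flow_box:
  "defining_cocycle n k X \<A> C \<Longrightarrow> i \<in> idx C \<Longrightarrow> is_flow_box n X (box C i)"
  by (auto simp: defining_cocycle_def foliated_atlas_def)

text \<open>Here charts and derivatives are left behind: what remains is the open continuous
  projections, the holonomy maps between them, and the connectedness of plaques.\<close>

lemma defining_cocycle_transverse:
  assumes dc: "defining_cocycle n k X \<A> C"
  shows "transverse_cocycle X (idx C) (cdom C) (cpt C) (transversal C) (hol_map C)"
proof
  note fb = defining_cocycle_flow_box[OF dc]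
  show "openin X (cdom C i)" if "i \<in> idx C" for i using fb_open[OF fb[OF that]] .
  show "topspace X = (\<Union>i\<in>idx C. cdom C i)" using dc by (auto simp: defining_cocycle_def foliated_atlas_def)
  show "openin (transversal C) (cpt C i ` (G \<inter> cdom C i))" if i: "i \<in> idx C" "openin X G" for i G
  proof -
    have "openin (ctrans C i) (cproj C i ` (G \<inter> cdom C i))" using fb_proj_open[OF fb[OF i(1)] i(2)] .
    then have "openin (transversal C) (Pair i ` (cproj C i ` (G \<inter> cdom C i)))"
      using open_map_component_injection[OF i(1), of "ctrans C"] unfolding transversal_def open_map_def by blast
    then show ?thesis by (simp add: image_image cpt_def[abs_def])
  qed
  show "openin X {x \<in> cdom C i. cpt C i x \<in> G}" if "i \<in> idx C" "openin (transversal C) G" for i G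
    using fb_proj_preimage[OF fb[OF that(1)], of "{z. (i, z) \<in> G}"] that
    unfolding transversal_def openin_sum_topology cpt_def by simp
  show "topspace (transversal C) = (\<Union>i\<in>idx C. cpt C i ` cdom C i)"
    unfolding transversal_def cpt_def using fb_proj_image[OF fb] by fastforce
  show "i = j" if "cpt C i x = cpt C j y" for i j x y using that by (auto simp: cpt_def)
  have hom: "cproj C j u = trans_map C i j (cproj C i u)"
    if "i \<in> idx C" "j \<in> idx C" "u \<in> cdom C i \<inter> cdom C j" for i j u
    using dc[unfolded defining_cocycle_def, THEN conjunct2, THEN conjunct2] that by blast
  show "hol_map C i j p = Some p' \<longleftrightarrow> (\<exists>u\<in>cdom C i \<inter> cdom C j. p = cpt C i u \<and> p' = cpt C j u)"
    if "i \<in> idx C" "j \<in> idx C" for i j p p'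
    using hom[OF that] by (cases p) (auto simp: hol_map_def overlap_def cpt_def split: if_splits)
  show "Q x'" if "i \<in> idx C" "x \<in> cdom C i" "x' \<in> cdom C i" "cpt C i x = cpt C i x'" "Q x"
        "\<And>w. w \<in> cdom C i \<Longrightarrow> cpt C i w = cpt C i x \<Longrightarrow> \<exists>G. openin X G \<and> w \<in> G \<and>
           (\<forall>w1\<in>G \<inter> cdom C i. \<forall>w2\<in>G \<inter> cdom C i. cpt C i w1 = cpt C i x \<longrightarrow> cpt C i w2 = cpt C i x \<longrightarrow> Q w1 \<longrightarrow> Q w2)"
    for i Q x x'
    using fb_plaque_const[OF fb[OF that(1)], of x x' Q] that(2-) unfolding cpt_def by simp
qed

text \<open>Both cocycles are compared with a flow box \<open>b\<close> of the given atlas, the only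
  structure known to be compatible with each of them.\<close>

lemma cocycles_locally_equiv:
  assumes dc: "defining_cocycle n k X \<A> C" "defining_cocycle n k X \<A> R" and cov: "(\<Union>b\<in>\<A>. fb_dom b) = topspace X"
    and ij: "i \<in> idx C" "j \<in> idx R"
  shows "locally_equiv X (cdom C i) (cpt C i) (cdom R j) (cpt R j)"
  unfolding locally_equiv_def
proof
  fix x assume x: "x \<in> cdom C i \<inter> cdom R j"
  then have "x \<in> topspace X" using fb_open[OF defining_cocycle_flow_box[OF dc(1) ij(1)]] openin_subset by blast
  then obtain b where b: "b \<in> \<A>" "x \<in> fb_dom b" using cov by auto
  have ca: "compatible_atlases n k X \<A> (box C ` idx C)" "compatible_atlases n k X \<A> (box R ` idx R)"
    using dc by (auto simp: defining_cocycle_def)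
  obtain G1 where G1: "openin X G1" "x \<in> G1" "G1 \<subseteq> fb_dom b \<inter> cdom C i"
    "\<forall>u\<in>G1. \<forall>v\<in>G1. fb_proj b u = fb_proj b v \<longleftrightarrow> cproj C i u = cproj C i v"
    using bspec[OF compatible_atlases_locally_equiv[OF ca(1) b(1), of "box C i", unfolded locally_equiv_def], of x] x b ij
    by auto
  obtain G2 where G2: "openin X G2" "x \<in> G2" "G2 \<subseteq> fb_dom b \<inter> cdom R j"
    "\<forall>u\<in>G2. \<forall>v\<in>G2. fb_proj b u = fb_proj b v \<longleftrightarrow> cproj R j u = cproj R j v"
    using bspec[OF compatible_atlases_locally_equiv[OF ca(2) b(1), of "box R j", unfolded locally_equiv_def], of x] x b ij
    by auto
  show "\<exists>G. openin X G \<and> x \<in> G \<and> G \<subseteq> cdom C i \<inter> cdom R j \<and> (\<forall>u\<in>G. \<forall>v\<in>G. cpt C i u = cpt C i v \<longleftrightarrow> cpt R j u = cpt R j v)"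
    using G1 G2 by (intro exI[of _ "G1 \<inter> G2"]) (auto simp: cpt_def)
qed

text \<open>Reachability by chains is locally constant in the leaf topology: a small piece of an
  atlas plaque is open there and lies in one plaque of \<open>C\<close>. A connected set therefore
  lies in one chain class.\<close>

lemma leaf_cstep:
  assumes fs: "foliated_atlas n k X \<A>" and dc: "defining_cocycle n k X \<A> C"
    and xy: "connected_component_of (leaf_topology X \<A>) x y"
  shows "(x, y) \<in> (transverse_cocycle.cstep (idx C) (cdom C) (cpt C))\<^sup>*"
proof -
  interpret C: transverse_cocycle X "idx C" "cdom C" "cpt C" "transversal C" "hol_map C"
    using defining_cocycle_transverse[OF dc] .
  let ?Y = "leaf_topology X \<A>"
  obtain S where S: "connectedin ?Y S" "x \<in> S" "y \<in> S" using xy unfolding connected_component_of_def by auto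
  show ?thesis
  proof (rule connectedin_locally_constant[OF S, of "\<lambda>w. (x, w) \<in> C.cstep\<^sup>*"])
    fix w assume "w \<in> S"
    then have "w \<in> topspace ?Y" using S(1) connectedin_subset_topspace by blast
    then obtain b z P where P: "b \<in> \<A>" "z \<in> topspace (fb_trans b)" "openin (subtopology X (plaque b z)) P" "w \<in> P"
      unfolding leaf_topology_def topology_generated_by_topspace by auto
    have wp: "w \<in> plaque b z" using openin_subset[OF P(3)] P(4) by auto
    then have wb: "w \<in> fb_dom b" by (auto simp: plaque_def)
    have "w \<in> topspace X" using fs P(1) wb by (auto simp: foliated_atlas_def)
    then obtain i where i: "i \<in> idx C" "w \<in> cdom C i" using C.U_cover by auto
    have ca: "compatible_atlases n k X \<A> (box C ` idx C)" using dc by (auto simp: defining_cocycle_def)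
    obtain G where G: "openin X G" "w \<in> G" "G \<subseteq> fb_dom b \<inter> cdom C i"
      "\<forall>u\<in>G. \<forall>v\<in>G. fb_proj b u = fb_proj b v \<longleftrightarrow> cproj C i u = cproj C i v"
      using bspec[OF compatible_atlases_locally_equiv[OF ca P(1), of "box C i", unfolded locally_equiv_def], of w] wb i
      by auto
    have "openin (subtopology X (plaque b z)) (G \<inter> plaque b z)" using G(1) by (simp add: openin_subtopology_Int)
    then have "openin ?Y (G \<inter> plaque b z)"
      unfolding leaf_topology_def by (intro topology_generated_by_Basis) (use P in blast)
    moreover have "(x, w2) \<in> C.cstep\<^sup>*" if w12: "w1 \<in> G \<inter> plaque b z" "w2 \<in> G \<inter> plaque b z" "(x, w1) \<in> C.cstep\<^sup>*" for w1 w2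
    proof -
      have "cproj C i w1 = cproj C i w2" using G(4)[rule_format, of w1 w2] w12 by (simp add: plaque_def)
      then have "(w1, w2) \<in> C.cstep" using w12 G(3) i unfolding C.cstep_def cpt_def by blast
      then show ?thesis using w12(3) by auto
    qed
    ultimately show "\<exists>G. openin ?Y G \<and> w \<in> G \<and> (\<forall>w1\<in>G \<inter> S. \<forall>w2\<in>G \<inter> S. (x, w1) \<in> C.cstep\<^sup>* \<longrightarrow> (x, w2) \<in> C.cstep\<^sup>*)"
      using G(2) wp by (intro exI[of _ "G \<inter> plaque b z"]) auto
  qed simp
qed

section \<open>Chain bounds and density of trivial holonomy\<close>

context transverse_cocycle
begin

context
  fixes A :: "'a set" and V :: "'a \<Rightarrow> 'x set" and q :: "'a \<Rightarrow> 'x \<Rightarrow> 't" and s :: "('x \<times> 'x) set"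
  assumes V_open: "\<And>a. a \<in> A \<Longrightarrow> openin X (V a)" and V_cover: "topspace X \<subseteq> (\<Union>a\<in>A. V a)"
    and V_equiv: "\<And>a i. a \<in> A \<Longrightarrow> i \<in> I \<Longrightarrow> locally_equiv X (U i) (P i) (V a) (q a)"
    and s_def: "s = {(x, y). \<exists>a\<in>A. x \<in> V a \<and> y \<in> V a \<and> q a x = q a y}"
begin

text \<open>Continuation along the plaque from \<open>x\<close> to \<open>x'\<close>: each small
  neighbourhood crossed costs one more step, and the bound holds uniformly for endpoints near
  \<open>x\<close> and near \<open>x'\<close>.\<close>

lemma local_chain_bound:
  assumes i: "i \<in> I" and x: "x \<in> U i" "x' \<in> U i" "P i x = P i x'"
  shows "\<exists>k G G'. openin X G \<and> openin X G' \<and> x \<in> G \<and> x' \<in> G' \<and>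
    (\<forall>u\<in>G \<inter> U i. \<forall>v\<in>G' \<inter> U i. P i u = P i v \<longrightarrow> (u, v) \<in> s ^^ k)"
proof -
  define good where "good y \<longleftrightarrow> (\<exists>k G G'. openin X G \<and> openin X G' \<and> x \<in> G \<and> y \<in> G' \<and>
    (\<forall>u\<in>G \<inter> U i. \<forall>v\<in>G' \<inter> U i. P i u = P i v \<longrightarrow> (u, v) \<in> s ^^ k))" for y
  have nb: "\<exists>G. openin X G \<and> w \<in> G \<and> G \<subseteq> U i \<and> (\<forall>u\<in>G. \<forall>v\<in>G. P i u = P i v \<longrightarrow> (u, v) \<in> s)" if w: "w \<in> U i" for w
  proof -
    obtain a where a: "a \<in> A" "w \<in> V a" using V_cover U_topspace[OF i w] by auto
    obtain G where G: "openin X G" "w \<in> G" "G \<subseteq> U i" "G \<subseteq> V a"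
      "\<And>u v. u \<in> G \<Longrightarrow> v \<in> G \<Longrightarrow> P i u = P i v \<longleftrightarrow> q a u = q a v"
      using locally_equivE[OF V_equiv[OF a(1) i] w a(2)] by metis
    have "(u, v) \<in> s" if "u \<in> G" "v \<in> G" "P i u = P i v" for u v
      using G(4) G(5)[OF that(1,2)] that a(1) unfolding s_def by auto
    then show ?thesis using G(1-3) by blast
  qed
  have "good x'"
  proof (rule plaque_const[OF i x, of good])
    obtain G where "openin X G" "x \<in> G" "G \<subseteq> U i" "\<forall>u\<in>G. \<forall>v\<in>G. P i u = P i v \<longrightarrow> (u, v) \<in> s"
      using nb[OF x(1)] by blast
    then show "good x" unfolding good_def by (intro exI[of _ 1] exI[of _ G]) auto
  next
    fix w assume w: "w \<in> U i" "P i w = P i x"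
    obtain G where G: "openin X G" "w \<in> G" "G \<subseteq> U i" "\<forall>u\<in>G. \<forall>v\<in>G. P i u = P i v \<longrightarrow> (u, v) \<in> s"
      using nb[OF w(1)] by blast
    have "good w2" if w12: "w1 \<in> G" "w2 \<in> G" "P i w1 = P i x" "P i w2 = P i x" "good w1" for w1 w2
    proof -
      obtain k G1 G1' where g: "openin X G1" "openin X G1'" "x \<in> G1" "w1 \<in> G1'"
        "\<forall>u\<in>G1 \<inter> U i. \<forall>v\<in>G1' \<inter> U i. P i u = P i v \<longrightarrow> (u, v) \<in> s ^^ k"
        using w12(5) unfolding good_def by blast
      define G2 where "G2 = G \<inter> {v \<in> U i. P i v \<in> P i ` ((G1' \<inter> G) \<inter> U i)}"
      have "openin X (G1' \<inter> G)" "w1 \<in> (G1' \<inter> G) \<inter> U i" "w2 \<in> U i" "P i w2 = P i w1"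
        using g(2,4) G(1,3) w12 by auto
      from plaque_nbhd[OF i this] have G2: "openin X G2" "w2 \<in> G2"
        using G(1) w12(2) by (auto simp: G2_def)
      have "(u, v) \<in> s ^^ Suc k" if uv: "u \<in> G1 \<inter> U i" "v \<in> G2 \<inter> U i" "P i u = P i v" for u v
      proof -
        obtain v1 where v1: "v1 \<in> G1'" "v1 \<in> G" "v1 \<in> U i" "P i v = P i v1" using uv(2) by (auto simp: G2_def)
        have "(u, v1) \<in> s ^^ k" using g(5)[rule_format, OF uv(1), of v1] v1 uv(3) by auto
        moreover have "(v1, v) \<in> s" using G(4)[rule_format, of v1 v] v1 uv(2) by (auto simp: G2_def)
        ultimately show ?thesis by auto
      qed
      then show "good w2" unfolding good_def using g(1,3) G2 by blast
    qed
    then show "\<exists>G. openin X G \<and> w \<in> G \<and> (\<forall>w1\<in>G \<inter> U i. \<forall>w2\<in>G \<inter> U i. P i w1 = P i x \<longrightarrow> P i w2 = P i x \<longrightarrow> good w1 \<longrightarrow> good w2)"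
      using G(1,2) by (intro exI[of _ G]) auto
  qed
  then show ?thesis unfolding good_def .
qed

text \<open>\<open>K \<times> K\<close> is covered by open sets with a bound each: around pairs on
  one plaque by \<open>local_chain_bound\<close>, around other pairs because the Hausdorff property
  keeps their projections apart. A finite subcover gives the maximum.\<close>

lemma compact_chain_bound:
  assumes haus: "Hausdorff_space Z" and i: "i \<in> I" and K: "compactin X K" "K \<subseteq> U i"
  shows "\<exists>k. \<forall>x\<in>K. \<forall>y\<in>K. P i x = P i y \<longrightarrow> (x, y) \<in> s ^^ k"
proof -
  define bounded where "bounded B k \<longleftrightarrow>
    (\<forall>u v. (u, v) \<in> B \<longrightarrow> u \<in> U i \<longrightarrow> v \<in> U i \<longrightarrow> P i u = P i v \<longrightarrow> (u, v) \<in> s ^^ k)" for B k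
  define \<U> where "\<U> = {B. openin (prod_topology X X) B \<and> (\<exists>k. bounded B k)}"
  have "(x, y) \<in> \<Union>\<U>" if xy: "x \<in> K" "y \<in> K" for x y
  proof -
    have xyU: "x \<in> U i" "y \<in> U i" using K(2) xy by auto
    show ?thesis
    proof (cases "P i x = P i y")
      case True
      obtain k G G' where G: "openin X G" "openin X G'" "x \<in> G" "y \<in> G'"
        "\<forall>u\<in>G \<inter> U i. \<forall>v\<in>G' \<inter> U i. P i u = P i v \<longrightarrow> (u, v) \<in> s ^^ k"
        using local_chain_bound[OF i xyU True] by blast
      then have "bounded (G \<times> G') k" unfolding bounded_def by blast
      then have "G \<times> G' \<in> \<U>" using G(1,2) by (auto simp: \<U>_def openin_prod_Times_iff)
      then show ?thesis using G(3,4) by blast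
    next
      case False
      then obtain B B' where B: "openin Z B" "openin Z B'" "P i x \<in> B" "P i y \<in> B'" "disjnt B B'"
        using haus[unfolded Hausdorff_space_def, rule_format, of "P i x" "P i y"] P_topspace[OF i] xyU by auto
      let ?G = "{x \<in> U i. P i x \<in> B}" and ?G' = "{x \<in> U i. P i x \<in> B'}"
      \<comment> \<open>No pair in this product has equal projections, so the bound is vacuous and 0
        is as good as any number.\<close>
      have "bounded (?G \<times> ?G') 0" using B(5) by (auto simp: bounded_def disjnt_iff)
      then have "?G \<times> ?G' \<in> \<U>"
        using P_cont[OF i B(1)] P_cont[OF i B(2)] by (auto simp: \<U>_def openin_prod_Times_iff)
      moreover have "(x, y) \<in> ?G \<times> ?G'" using B xyU by auto
      ultimately show ?thesis by blast
    qed
  qed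
  then have "K \<times> K \<subseteq> \<Union>\<U>" by auto
  moreover have "compactin (prod_topology X X) (K \<times> K)" using K(1) by (simp add: compactin_Times)
  moreover have "\<forall>B\<in>\<U>. openin (prod_topology X X) B" by (simp add: \<U>_def)
  ultimately obtain \<B> where \<B>: "finite \<B>" "\<B> \<subseteq> \<U>" "K \<times> K \<subseteq> \<Union>\<B>"
    unfolding compactin_def by meson
  have "\<forall>B\<in>\<B>. \<exists>k. bounded B k" using \<B>(2) by (auto simp: \<U>_def)
  then obtain k where k: "\<And>B. B \<in> \<B> \<Longrightarrow> bounded B (k B)" by metis
  \<comment> \<open>The 0 covers an empty subcover. Shorter chains are padded with loops, since
    \<open>s\<close> is reflexive on \<open>X\<close>.\<close>
  define m where "m = Max (insert 0 (k ` \<B>))"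
  have refl: "(x, x) \<in> s" if "x \<in> topspace X" for x using that V_cover s_def by auto
  have closed: "s `` topspace X \<subseteq> topspace X" using V_open openin_subset s_def by blast
  have "(x, y) \<in> s ^^ m" if xy: "x \<in> K" "y \<in> K" "P i x = P i y" for x y
  proof -
    obtain B where B: "B \<in> \<B>" "(x, y) \<in> B" using \<B>(3) xy(1,2) by blast
    have "(x, y) \<in> s ^^ k B" using k[OF B(1)] B(2) xy K(2) unfolding bounded_def by blast
    moreover have "k B \<le> m" unfolding m_def using \<B>(1) B(1) by (intro Max_ge) auto
    moreover have "x \<in> topspace X" using U_topspace[OF i] K(2) xy by auto
    ultimately show ?thesis using relpow_refl_mono[of "topspace X" s, OF refl closed] by simp
  qed
  then show ?thesis by blast
qed

end

text \<open>The pseudogroup may be uncountable, but a finite set of generators has only countably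
  many composites. This reduction makes Baire's theorem applicable.\<close>

lemma trivial_germs_compositesI:
  assumes "\<And>m g. g \<in> composites Z E m \<Longrightarrow> g p = Some p \<Longrightarrow> same_germ Z p g (id_map Z)"
  shows "trivial_germs Z H p"
  unfolding trivial_germs_def
proof (intro ballI impI)
  fix h assume h: "h \<in> H" "h p = Some p"
  obtain m g where g: "g \<in> composites Z E m" "same_germ Z p h g"
    using generated_germ_composite[OF h(1) E_poe E_inv h(2)] by blast
  show "same_germ Z p h (id_map Z)"
    by (rule same_germ_trans[OF g(2) assms[OF g(1) same_germ_Some[OF g(2) h(2)]]])
qed

text \<open>An open set inside the closure of \<open>B\<close> would meet \<open>B\<close> in some
  \<open>x\<close>. Near \<open>x\<close> the map \<open>g\<close> is defined, and by the Hausdorff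
  property its fixed points are closed there, so \<open>g\<close> is the identity near
  \<open>P i x\<close>, which contradicts \<open>x \<in> B\<close>.\<close>

lemma boundary_of_fixed_points_nowhere_dense:
  assumes haus: "Hausdorff_space Z" and i: "i \<in> I" and g: "partial_open_embedding Z g"
    and B: "B = {x \<in> U i. g (P i x) = Some (P i x) \<and> \<not> same_germ Z (P i x) g (id_map Z)}"
  shows "X interior_of (X closure_of B) = {}"
proof (rule ccontr)
  assume "X interior_of (X closure_of B) \<noteq> {}"
  then obtain G y where G: "openin X G" "y \<in> G" "G \<subseteq> X closure_of B" unfolding interior_of_def by auto
  then obtain x where x: "x \<in> B" "x \<in> G" unfolding closure_of_def by blast
  then have xi: "x \<in> U i" "g (P i x) = Some (P i x)" by (auto simp: B)
  define W where "W = G \<inter> {x \<in> U i. P i x \<in> dom g}"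
  have W: "openin X W" "x \<in> W" using G(1) P_cont[OF i poe_dom[OF g]] x xi by (auto simp: W_def)
  have fixed: "g (P i w) = Some (P i w)" if w: "w \<in> W" for w
  proof (rule ccontr)
    assume ne: "g (P i w) \<noteq> Some (P i w)"
    obtain p where p: "g (P i w) = Some p" and wi: "w \<in> U i" using w by (auto simp: W_def)
    then obtain C D where CD: "openin Z C" "openin Z D" "p \<in> C" "P i w \<in> D" "disjnt C D"
      using haus[unfolded Hausdorff_space_def, rule_format, of p "P i w"] P_topspace[OF i wi] poe_topspace(2)[OF g p] ne
      by auto
    define O' where "O' = {x \<in> U i. P i x \<in> D \<inter> {t. \<exists>t'\<in>C. g t = Some t'}}"
    have "openin X O'" unfolding O'_def using CD poe_preimage[OF g CD(1)] by (intro P_cont[OF i]) auto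
    moreover have "w \<in> O'" using CD p wi by (auto simp: O'_def)
    moreover have "w \<in> X closure_of B" using w G(3) by (auto simp: W_def)
    ultimately obtain v where "v \<in> B" "v \<in> O'" unfolding closure_of_def by blast
    then show False using CD(5) by (auto simp: O'_def B disjnt_iff)
  qed
  have "same_germ Z (P i x) g (id_map Z)"
  proof (rule same_germI)
    show "openin Z (P i ` (W \<inter> U i))" by (rule P_open[OF i W(1)])
    show "P i x \<in> P i ` (W \<inter> U i)" using W(2) xi by auto
    fix t assume "t \<in> P i ` (W \<inter> U i)"
    then show "t \<in> dom g" "g t = id_map Z t" using fixed P_topspace[OF i] by (auto simp: id_map_def)
  qed
  then show False using x by (auto simp: B)
qed

text \<open>Nontrivial germs at \<open>P i x\<close> put \<open>x\<close> into the nowhere dense set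
  of some chart and some composite. There are countably many such sets, so by Baire their closures
  cannot fill a nonempty open set.\<close>

lemma TH_dense:
  assumes X: "completely_metrizable_space X" and fin: "finite I" and haus: "Hausdorff_space Z"
    and W: "openin X W" "W \<noteq> {}"
  shows "\<exists>x\<in>W. TH x"
proof -
  have "finite (composites Z E m)" for m
  proof (induction m)
    case (Suc m)
    have "E = (\<lambda>(i, j). hm i j) ` (I \<times> I)" by (auto simp: E_def)
    then have "finite E" using fin by simp
    moreover have "composites Z E (Suc m) = (\<lambda>(g, h). g \<circ>\<^sub>m h) ` (E \<times> composites Z E m)" by auto
    ultimately show ?case using Suc by simp
  qed simp
  then have cnt: "countable (\<Union>m. composites Z E m)" by (auto intro: countable_finite)
  define B where "B i g = {x \<in> U i. g (P i x) = Some (P i x) \<and> \<not> same_germ Z (P i x) g (id_map Z)}" for i g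
  define \<G> where "\<G> = (\<lambda>(i, g). X closure_of B i g) ` (I \<times> (\<Union>m. composites Z E m))"
  have "X interior_of \<Union>\<G> = {}"
  proof (rule Baire_category_alt)
    show "countable \<G>" unfolding \<G>_def using cnt countable_finite[OF fin] by (intro countable_image countable_SIGMA)
    fix T assume "T \<in> \<G>"
    then obtain i m g where "i \<in> I" "g \<in> composites Z E m" "T = X closure_of B i g" by (auto simp: \<G>_def)
    then show "closedin X T \<and> X interior_of T = {}"
      using boundary_of_fixed_points_nowhere_dense[OF haus _ H_poe[OF composites_in_generated] B_def] by auto
  qed (use X in simp)
  then have "\<not> W \<subseteq> \<Union>\<G>" using W interior_of_maximal by fastforce
  then obtain x where x: "x \<in> W" "x \<notin> \<Union>\<G>" by auto
  have xX: "x \<in> topspace X" using x W openin_subset by auto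
  then obtain i where i: "i \<in> I" "x \<in> U i" using U_cover by auto
  have "trivial_germs Z H (P i x)"
  proof (rule trivial_germs_compositesI, rule ccontr)
    fix m g assume g: "g \<in> composites Z E m" "g (P i x) = Some (P i x)" "\<not> same_germ Z (P i x) g (id_map Z)"
    then have "x \<in> B i g" using i by (auto simp: B_def)
    moreover have "B i g \<subseteq> topspace X" using U_topspace[OF i(1)] by (auto simp: B_def)
    ultimately have "x \<in> X closure_of B i g" using closure_of_subset by blast
    then show False using x(2) i g(1) unfolding \<G>_def by blast
  qed
  then show ?thesis using x(1) Orb_I[OF i, of x] unfolding TH_def by blast
qed

end

section \<open>Quasi-local metrics\<close>

lemma centre_in_mball_of: assumes "x \<in> mspace m" "r > 0" shows "x \<in> mball_of m x r"
proof -
  have "mdist m x x = 0" using assms(1) by simp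
  then have "mdist m x x < r" using assms(2) by (simp only:)
  then show ?thesis using assms(1) by (simp only: in_mball_of simp_thms)
qed

lemma mtopology_of_ball:
  assumes "openin (mtopology_of m) U" "z \<in> U"
  obtains \<rho> where "\<rho> > 0" "mball_of m z \<rho> \<subseteq> U"
  using assms Metric_space.openin_mtopology[OF Metric_space_mspace_mdist, of m U]
  unfolding mtopology_of_def mball_of_def by blast

text \<open>The modulus \<open>\<delta>\<close> is common to all pairs of metrics; only the size of
  the neighbourhood, here turned into a ball, depends on the pair and the point.\<close>

lemma quasi_local_cover_nbhd:
  assumes "quasi_local_cover S Q"
  obtains \<delta> :: "real \<Rightarrow> real" where "\<And>\<epsilon>. \<epsilon> > 0 \<Longrightarrow> \<delta> \<epsilon> > 0"
    "\<And>m m' z. m \<in> Q \<Longrightarrow> m' \<in> Q \<Longrightarrow> z \<in> mspace m \<Longrightarrow> z \<in> mspace m' \<Longrightarrow> \<exists>\<rho>>0. mball_of m z \<rho> \<subseteq> mspace m' \<and>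
      (\<forall>\<epsilon>>0. \<forall>x\<in>mball_of m z \<rho>. \<forall>y\<in>mball_of m z \<rho>. mdist m x y < \<delta> \<epsilon> \<longrightarrow> mdist m' x y < \<epsilon>)"
proof -
  obtain \<delta> where \<delta>: "\<forall>\<epsilon>>0::real. \<delta> \<epsilon> > (0::real)"
    and U: "\<forall>m\<in>Q. \<forall>m'\<in>Q. \<forall>z \<in> mspace m \<inter> mspace m'. \<exists>U.
          openin (mtopology_of m) U \<and> openin (mtopology_of m') U \<and>
          z \<in> U \<and> U \<subseteq> mspace m \<inter> mspace m' \<and>
          (\<forall>\<epsilon>>0. \<forall>x\<in>U. \<forall>y\<in>U. mdist m x y < \<delta> \<epsilon> \<longrightarrow> mdist m' x y < \<epsilon>)"
    using assms unfolding quasi_local_cover_def by (elim conjE exE)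
  show ?thesis
  proof (rule that[of \<delta>])
    fix m m' z assume m: "m \<in> Q" "m' \<in> Q" "z \<in> mspace m" "z \<in> mspace m'"
    then have "z \<in> mspace m \<inter> mspace m'" by simp
    from bspec[OF bspec[OF bspec[OF U m(1)] m(2)] this] obtain V where
      V: "openin (mtopology_of m) V" "z \<in> V" "V \<subseteq> mspace m \<inter> mspace m'"
        "\<forall>\<epsilon>>0. \<forall>x\<in>V. \<forall>y\<in>V. mdist m x y < \<delta> \<epsilon> \<longrightarrow> mdist m' x y < \<epsilon>" by (elim exE conjE)
    obtain \<rho> where \<rho>: "\<rho> > 0" "mball_of m z \<rho> \<subseteq> V" using mtopology_of_ball[OF V(1,2)] .
    have "mball_of m z \<rho> \<subseteq> mspace m'" using \<rho>(2) V(3) by blast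
    moreover have "\<forall>\<epsilon>>0. \<forall>x\<in>mball_of m z \<rho>. \<forall>y\<in>mball_of m z \<rho>. mdist m x y < \<delta> \<epsilon> \<longrightarrow> mdist m' x y < \<epsilon>"
      using V(4) \<rho>(2) by blast
    ultimately show "\<exists>\<rho>>0. mball_of m z \<rho> \<subseteq> mspace m' \<and>
      (\<forall>\<epsilon>>0. \<forall>x\<in>mball_of m z \<rho>. \<forall>y\<in>mball_of m z \<rho>. mdist m x y < \<delta> \<epsilon> \<longrightarrow> mdist m' x y < \<epsilon>)"
      using \<rho>(1) by blast
  qed (use \<delta> in simp)
qed

lemma quasi_local_cover_ball:
  assumes "quasi_local_cover S Q" "m \<in> Q" "m' \<in> Q" "z \<in> mspace m" "z \<in> mspace m'" "\<epsilon> > 0"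
  obtains \<rho> where "\<rho> > 0" "mball_of m z \<rho> \<subseteq> mball_of m' z \<epsilon>"
proof -
  obtain \<delta> :: "real \<Rightarrow> real" where \<delta>: "\<And>\<epsilon>. \<epsilon> > 0 \<Longrightarrow> \<delta> \<epsilon> > 0"
    and b: "\<And>m m' z. m \<in> Q \<Longrightarrow> m' \<in> Q \<Longrightarrow> z \<in> mspace m \<Longrightarrow> z \<in> mspace m' \<Longrightarrow> \<exists>\<rho>>0. mball_of m z \<rho> \<subseteq> mspace m' \<and>
      (\<forall>\<epsilon>>0. \<forall>x\<in>mball_of m z \<rho>. \<forall>y\<in>mball_of m z \<rho>. mdist m x y < \<delta> \<epsilon> \<longrightarrow> mdist m' x y < \<epsilon>)"
    using quasi_local_cover_nbhd[OF assms(1)] by blast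
  obtain \<rho> where \<rho>: "\<rho> > 0" "mball_of m z \<rho> \<subseteq> mspace m'"
    "\<forall>\<epsilon>>0. \<forall>x\<in>mball_of m z \<rho>. \<forall>y\<in>mball_of m z \<rho>. mdist m x y < \<delta> \<epsilon> \<longrightarrow> mdist m' x y < \<epsilon>"
    using b[OF assms(2-5)] by (elim exE conjE)
  have "mball_of m z (min \<rho> (\<delta> \<epsilon>)) \<subseteq> mball_of m' z \<epsilon>"
  proof
    fix y assume y: "y \<in> mball_of m z (min \<rho> (\<delta> \<epsilon>))"
    have "z \<in> mball_of m z \<rho>" by (rule centre_in_mball_of[OF assms(4) \<rho>(1)])
    moreover have "y \<in> mball_of m z \<rho>" "mdist m z y < \<delta> \<epsilon>" using y by auto
    ultimately have "mdist m' z y < \<epsilon>" "y \<in> mspace m'" using \<rho>(2,3) assms(6) by blast+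
    then show "y \<in> mball_of m' z \<epsilon>" using assms(5) by simp
  qed
  then show ?thesis using that[of "min \<rho> (\<delta> \<epsilon>)"] \<rho>(1) \<delta>[OF assms(6)] by simp
qed

locale quasi_local_space =
  fixes T :: "'t topology" and \<QQ> :: "'t metric set set" and Q :: "'t metric set"
  assumes qlm: "quasi_local_metric (topspace T) \<QQ>" and top: "quasi_local_topology \<QQ> = T" and Q: "Q \<in> \<QQ>"
begin

lemma cover: "quasi_local_cover (topspace T) Q"
  using qlm Q unfolding quasi_local_metric_def quasi_local_equiv_def by auto

lemma topspace_eq: "topspace T = (\<Union>m\<in>Q. mspace m)"
  using cover unfolding quasi_local_cover_def by (elim conjE)

lemma mball_open: assumes "m \<in> Q" shows "openin T (mball_of m x r)"
proof (cases "x \<in> mspace m \<and> r > 0")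
  case True
  then show ?thesis unfolding top[symmetric] quasi_local_topology_def
    by (intro topology_generated_by_Basis) (use assms Q in blast)
next
  case False
  have "mball_of m x r = {}"
  proof (rule equals0I)
    fix y assume "y \<in> mball_of m x r"
    then have "x \<in> mspace m" "mdist m x y < r" by simp_all
    then show False using False mdist_nonneg[of m x y] by linarith
  qed
  then show ?thesis by simp
qed

lemma mspace_open: assumes "m \<in> Q" shows "openin T (mspace m)"
proof -
  have "(\<Union>x\<in>mspace m. mball_of m x 1) = mspace m" using centre_in_mball_of[of _ m 1] by auto
  moreover have "openin T (\<Union>x\<in>mspace m. mball_of m x 1)"
    by (rule openin_Union) (use mball_open[OF assms] in auto)
  ultimately show ?thesis by (rule subst)
qed

text \<open>The topology is generated by the balls of all metrics in the whole class, yet the balls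
  of any one metric of \<open>Q\<close> already form neighbourhood bases on its space. The induction
  is carried out for the fixed point \<open>t\<close>.\<close>

lemma ball_in_open:
  assumes G: "openin T G" "t \<in> G" and m: "m \<in> Q" "t \<in> mspace m"
  shows "\<exists>\<rho>>0. mball_of m t \<rho> \<subseteq> G"
proof -
  obtain Q0 where Q0: "quasi_local_cover (topspace T) Q0" "\<QQ> = {Q'. quasi_local_equiv (topspace T) Q0 Q'}"
    using qlm unfolding quasi_local_metric_def by auto
  have un: "quasi_local_cover (topspace T) (Q0 \<union> Q')" if "Q' \<in> \<QQ>" for Q'
    using that Q0(2) by (simp add: quasi_local_equiv_def)
  have "generate_topology_on {mball_of m x r | Q m x r. Q \<in> \<QQ> \<and> m \<in> Q \<and> x \<in> mspace m \<and> r > 0} G"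
    using G(1) unfolding top[symmetric] quasi_local_topology_def by (rule openin_topology_generated_by)
  then have "t \<in> G \<longrightarrow> (\<exists>\<rho>>0. mball_of m t \<rho> \<subseteq> G)"
  proof (induction rule: generate_topology_on.induct)
    case Empty
    show ?case by simp
  next
    case (Int a b)
    show ?case
    proof
      assume "t \<in> a \<inter> b"
      then have ab: "t \<in> a" "t \<in> b" by simp_all
      obtain \<rho> where \<rho>: "\<rho> > 0" "mball_of m t \<rho> \<subseteq> a" using mp[OF Int.IH(1) ab(1)] by (elim exE conjE)
      obtain \<rho>' where \<rho>': "\<rho>' > 0" "mball_of m t \<rho>' \<subseteq> b" using mp[OF Int.IH(2) ab(2)] by (elim exE conjE)
      have "mball_of m t (min \<rho> \<rho>') \<subseteq> mball_of m t \<rho> \<inter> mball_of m t \<rho>'" by auto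
      then show "\<exists>\<rho>>0. mball_of m t \<rho> \<subseteq> a \<inter> b" using \<rho> \<rho>' by (intro exI[of _ "min \<rho> \<rho>'"]) auto
    qed
  next
    case (UN K)
    show ?case
    proof
      assume "t \<in> \<Union>K"
      then obtain k where k: "k \<in> K" "t \<in> k" by auto
      obtain \<rho> where "\<rho> > 0" "mball_of m t \<rho> \<subseteq> k" using mp[OF UN.IH[OF k(1)] k(2)] by (elim exE conjE)
      then show "\<exists>\<rho>>0. mball_of m t \<rho> \<subseteq> \<Union>K" using k(1) by (intro exI[of _ \<rho>]) auto
    qed
  next
    case (Basis s)
    show ?case
    proof
      assume ts: "t \<in> s"
      obtain Q' m' x' r where s: "s = mball_of m' x' r" "Q' \<in> \<QQ>" "m' \<in> Q'"
        using Basis by (elim CollectE exE conjE)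
      have t: "x' \<in> mspace m'" "t \<in> mspace m'" "mdist m' x' t < r" using ts s(1) by auto
      have "t \<in> topspace T" using topspace_eq m by blast
      \<comment> \<open>Only unions with the reference family \<open>Q0\<close> are known to be
        quasi-local covers, so \<open>m'\<close> and \<open>m\<close> are compared through a metric
        \<open>m0\<close> of \<open>Q0\<close>.\<close>
      then obtain m0 where m0: "m0 \<in> Q0" "t \<in> mspace m0"
        using Q0(1) unfolding quasi_local_cover_def by auto
      have pos: "r - mdist m' x' t > 0" using t by simp
      obtain \<rho>0 where \<rho>0: "\<rho>0 > 0" "mball_of m0 t \<rho>0 \<subseteq> mball_of m' t (r - mdist m' x' t)"
        by (rule quasi_local_cover_ball[OF un[OF s(2)] UnI1[OF m0(1)] UnI2[OF s(3)] m0(2) t(2) pos])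
      obtain \<rho> where \<rho>: "\<rho> > 0" "mball_of m t \<rho> \<subseteq> mball_of m0 t \<rho>0"
        by (rule quasi_local_cover_ball[OF un[OF Q] UnI2[OF m(1)] UnI1[OF m0(1)] m(2) m0(2) \<rho>0(1)])
      have "mball_of m' t (r - mdist m' x' t) \<subseteq> s"
      proof
        fix y assume "y \<in> mball_of m' t (r - mdist m' x' t)"
        then show "y \<in> s" using mdist_triangle[of x' m' t y] t s(1) by auto
      qed
      then show "\<exists>\<rho>>0. mball_of m t \<rho> \<subseteq> s" using \<rho> \<rho>0 by (intro exI[of _ \<rho>]) auto
    qed
  qed
  then show ?thesis using G(2) by blast
qed

end

section \<open>Separation, nested finite covers and uniform radii\<close>

lemma Hausdorff_space_sum_topology:
  assumes "\<And>i. i \<in> I \<Longrightarrow> Hausdorff_space (Y i)"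
  shows "Hausdorff_space (sum_topology Y I)"
  unfolding Hausdorff_space_def
proof (intro allI impI)
  fix p q assume pq: "p \<in> topspace (sum_topology Y I) \<and> q \<in> topspace (sum_topology Y I) \<and> p \<noteq> q"
  obtain i x j y where p: "p = (i, x)" "q = (j, y)" by (cases p, cases q)
  have i: "i \<in> I" "x \<in> topspace (Y i)" "j \<in> I" "y \<in> topspace (Y j)" using pq p by auto
  have o: "openin (sum_topology Y I) (Pair i ` V)" if "i \<in> I" "openin (Y i) V" for i V
    using open_map_component_injection[OF that(1), of Y] that(2) unfolding open_map_def by blast
  show "\<exists>U V. openin (sum_topology Y I) U \<and> openin (sum_topology Y I) V \<and> p \<in> U \<and> q \<in> V \<and> disjnt U V"
  proof (cases "i = j")
    case True
    then obtain U V where "openin (Y i) U" "openin (Y i) V" "x \<in> U" "y \<in> V" "disjnt U V"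
      using assms[OF i(1), unfolded Hausdorff_space_def, rule_format, of x y] i pq p by auto
    then show ?thesis using o[OF i(1)] p True
      by (intro exI[of _ "Pair i ` U"] exI[of _ "Pair i ` V"]) (auto simp: disjnt_iff)
  next
    case False
    then show ?thesis using o[OF i(1) openin_topspace] o[OF i(3) openin_topspace] i p
      by (intro exI[of _ "Pair i ` topspace (Y i)"] exI[of _ "Pair j ` topspace (Y j)"]) (auto simp: disjnt_iff)
  qed
qed

text \<open>Regularity is applied three times at every point before compactness selects finitely
  many members of the innermost family, so one finite index set serves all layers.\<close>

lemma nested_finite_cover:
  assumes cpt: "compact_space X" and reg: "regular_space X"
    and M: "\<forall>x\<in>topspace X. openin X (M x) \<and> x \<in> M x"
  shows "\<exists>A N V W. finite A \<and> A \<subseteq> topspace X \<and> topspace X \<subseteq> (\<Union>a\<in>A. W a) \<and>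
    (\<forall>a\<in>A. openin X (N a) \<and> openin X (V a) \<and> openin X (W a) \<and>
       X closure_of N a \<subseteq> M a \<and> X closure_of V a \<subseteq> N a \<and> X closure_of W a \<subseteq> V a)"
proof -
  have shrink: "\<exists>U. openin X U \<and> x \<in> U \<and> X closure_of U \<subseteq> G" if G: "openin X G" "x \<in> G" for x G
  proof -
    have "neighbourhood_base_of (closedin X) X" using reg neighbourhood_base_of_closedin by blast
    then obtain U V where "openin X U" "closedin X V" "x \<in> U" "U \<subseteq> V" "V \<subseteq> G"
      using G unfolding neighbourhood_base_of by meson
    then show ?thesis using closure_of_minimal by (metis order_trans)
  qed
  have "\<forall>x\<in>topspace X. \<exists>U. openin X U \<and> x \<in> U \<and> X closure_of U \<subseteq> M x" using shrink M by blast
  then obtain N where N: "\<And>x. x \<in> topspace X \<Longrightarrow> openin X (N x) \<and> x \<in> N x \<and> X closure_of N x \<subseteq> M x" by metis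
  then have "\<forall>x\<in>topspace X. \<exists>U. openin X U \<and> x \<in> U \<and> X closure_of U \<subseteq> N x" using shrink by blast
  then obtain V where V: "\<And>x. x \<in> topspace X \<Longrightarrow> openin X (V x) \<and> x \<in> V x \<and> X closure_of V x \<subseteq> N x" by metis
  then have "\<forall>x\<in>topspace X. \<exists>U. openin X U \<and> x \<in> U \<and> X closure_of U \<subseteq> V x" using shrink by blast
  then obtain W where W: "\<And>x. x \<in> topspace X \<Longrightarrow> openin X (W x) \<and> x \<in> W x \<and> X closure_of W x \<subseteq> V x" by metis
  have "\<forall>U\<in>W ` topspace X. openin X U" "topspace X \<subseteq> \<Union>(W ` topspace X)" using W by auto
  then obtain \<F> where \<F>: "finite \<F>" "\<F> \<subseteq> W ` topspace X" "topspace X \<subseteq> \<Union>\<F>"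
    using cpt unfolding compact_space_def compactin_def by meson
  then obtain A where A: "finite A" "A \<subseteq> topspace X" "\<F> = W ` A" using finite_subset_image by meson
  have "\<forall>a\<in>A. openin X (N a) \<and> openin X (V a) \<and> openin X (W a) \<and>
       X closure_of N a \<subseteq> M a \<and> X closure_of V a \<subseteq> N a \<and> X closure_of W a \<subseteq> V a"
    using N V W A(2) by (simp add: subset_iff)
  then show ?thesis using A(1,2) \<F>(3) A(3) by (intro exI conjI) auto
qed

lemma finite_common_radius:
  assumes "finite F" "\<And>f. f \<in> F \<Longrightarrow> \<exists>\<epsilon>>0::real. P f \<epsilon>" "\<And>f \<epsilon> \<epsilon>'. P f \<epsilon> \<Longrightarrow> 0 < \<epsilon>' \<Longrightarrow> \<epsilon>' \<le> \<epsilon> \<Longrightarrow> P f \<epsilon>'"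
  shows "\<exists>\<epsilon>>0. \<forall>f\<in>F. P f \<epsilon>"
  using assms(1,2)
proof (induction F)
  case empty
  then show ?case by (intro exI[of _ 1]) auto
next
  case (insert f F)
  obtain \<epsilon> where "\<epsilon> > 0" "\<forall>f\<in>F. P f \<epsilon>" using insert.IH insert.prems by blast
  moreover obtain \<epsilon>' where "\<epsilon>' > 0" "P f \<epsilon>'" using insert.prems by blast
  ultimately have e: "\<epsilon> > 0" "\<forall>f\<in>F. P f \<epsilon>" "\<epsilon>' > 0" "P f \<epsilon>'" by simp_all
  have "\<forall>f\<in>insert f F. P f (min \<epsilon> \<epsilon>')"
    using e assms(3)[of _ \<epsilon> "min \<epsilon> \<epsilon>'"] assms(3)[of f \<epsilon>' "min \<epsilon> \<epsilon>'"] by auto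
  then show ?case using e by (intro exI[of _ "min \<epsilon> \<epsilon>'"]) auto
qed

text \<open>A Lebesgue number argument in the transverse metric: only half of the radius is used
  around a centre \<open>b\<close>, and the other half is left to the points near
  \<open>b\<close>.\<close>

lemma compact_common_radius:
  assumes K: "compactin X K" "K \<subseteq> N" and q: "q ` N \<subseteq> mspace m"
    and o: "\<And>t r. openin X {x \<in> N. q x \<in> mball_of m t r}"
    and P: "\<And>x. x \<in> K \<Longrightarrow> \<exists>\<rho>>0. P (mball_of m (q x) \<rho>)" and mono: "\<And>B B'. P B \<Longrightarrow> B' \<subseteq> B \<Longrightarrow> P B'"
  shows "\<exists>\<epsilon>>0. \<forall>x\<in>K. P (mball_of m (q x) \<epsilon>)"
proof -
  obtain \<rho> where \<rho>: "\<And>x. x \<in> K \<Longrightarrow> \<rho> x > 0 \<and> P (mball_of m (q x) (\<rho> x))" using P by metis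
  define G where "G x = {y \<in> N. q y \<in> mball_of m (q x) (\<rho> x / 2)}" for x
  have "\<forall>U\<in>G ` K. openin X U" unfolding G_def using o by blast
  moreover have "K \<subseteq> \<Union>(G ` K)"
  proof
    fix x assume x: "x \<in> K"
    have qx: "q x \<in> mspace m" using x K(2) q by blast
    have "q x \<in> mball_of m (q x) (\<rho> x / 2)" using \<rho>[OF x] by (intro centre_in_mball_of[OF qx]) simp
    then show "x \<in> \<Union>(G ` K)" using x K(2) by (auto simp: G_def)
  qed
  ultimately obtain \<F> where \<F>: "finite \<F>" "\<F> \<subseteq> G ` K" "K \<subseteq> \<Union>\<F>" using K(1) unfolding compactin_def by meson
  then obtain B where B: "finite B" "B \<subseteq> K" "\<F> = G ` B" using finite_subset_image by meson
  define \<epsilon> where "\<epsilon> = Min (insert 1 ((\<lambda>x. \<rho> x / 2) ` B))"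
  have "\<epsilon> > 0" unfolding \<epsilon>_def using B(1,2) \<rho> by (subst Min_gr_iff) auto
  moreover have "P (mball_of m (q x) \<epsilon>)" if x: "x \<in> K" for x
  proof -
    obtain b where b: "b \<in> B" "x \<in> G b" using x \<F>(3) B(3) by blast
    have le: "\<epsilon> \<le> \<rho> b / 2" unfolding \<epsilon>_def using B(1) b(1) by (intro Min_le) auto
    have "mball_of m (q x) \<epsilon> \<subseteq> mball_of m (q b) (\<rho> b)"
    proof
      fix y assume y: "y \<in> mball_of m (q x) \<epsilon>"
      then show "y \<in> mball_of m (q b) (\<rho> b)"
        using b(2) le mdist_triangle[of "q b" m "q x" y] by (auto simp: G_def)
    qed
    then show ?thesis using mono \<rho> b(1) B(2) by blast
  qed
  ultimately show ?thesis by blast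
qed

section \<open>Families of small charts\<close>

lemma map_leI: "(\<And>x y. f x = Some y \<Longrightarrow> g x = Some y) \<Longrightarrow> f \<subseteq>\<^sub>m g"
  by (auto simp: map_le_def dom_def)

lemma map_leD: "f \<subseteq>\<^sub>m g \<Longrightarrow> f x = Some y \<Longrightarrow> g x = Some y"
  by (auto simp: map_le_def dom_def)

lemma map_le_comp: "f \<subseteq>\<^sub>m f' \<Longrightarrow> g \<subseteq>\<^sub>m g' \<Longrightarrow> f \<circ>\<^sub>m g \<subseteq>\<^sub>m f' \<circ>\<^sub>m g'"
  by (rule map_leI) (auto simp: map_comp_Some_iff dest: map_leD)

lemma map_le_Some_comp: "f \<subseteq>\<^sub>m Some \<Longrightarrow> f \<circ>\<^sub>m g \<subseteq>\<^sub>m g"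
  by (rule map_leI) (auto simp: map_comp_Some_iff dest: map_leD)

lemma map_le_comp_Some: "g \<subseteq>\<^sub>m Some \<Longrightarrow> f \<circ>\<^sub>m g \<subseteq>\<^sub>m f"
  by (rule map_leI) (auto simp: map_comp_Some_iff dest: map_leD)

text \<open>The quantifier over all \<open>B\<subseteq>V\<close> allows several such neighbourhoods
  to be intersected later.\<close>

lemma same_germ_restrict_le:
  assumes "same_germ Z x f g"
  shows "\<exists>V. openin Z V \<and> x \<in> V \<and> (\<forall>B\<subseteq>V. f |` B \<subseteq>\<^sub>m g)"
proof -
  obtain V where V: "openin Z V" "x \<in> V" "\<forall>y\<in>V. f y = g y" using assms unfolding same_germ_def by auto
  show ?thesis
    by (intro exI[of _ V] conjI V(1,2)) (use V(3) in \<open>auto intro!: map_leI simp: restrict_map_Some_iff subset_iff\<close>)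
qed

lemma (in transverse_cocycle) P_compact:
  assumes i: "i \<in> I" and K: "compactin X K" "K \<subseteq> U i" shows "compactin Z (P i ` K)"
proof -
  have "openin (subtopology X (U i)) {x \<in> U i. P i x \<in> G}" if "openin Z G" for G
    using P_cont[OF i that] by (intro openin_open_subtopology[THEN iffD2]) (auto simp: U_open[OF i])
  moreover have "topspace (subtopology X (U i)) = U i" using openin_subset[OF U_open[OF i]] by auto
  ultimately have "continuous_map (subtopology X (U i)) Z (P i)"
    using P_topspace[OF i] unfolding continuous_map by auto
  moreover have "compactin (subtopology X (U i)) K" using K by (simp add: compactin_subtopology)
  ultimately show ?thesis by (rule image_compactin[rotated])
qed

text \<open>
  The sets \<open>W a\<close> cover \<open>X\<close>, the sets \<open>V a\<close> define the steps, and \<open>N a\<close> leaves room for chains that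
  are only close to chains of \<open>V\<close>-steps.
\<close>

locale small_chart_family =
  transverse_cocycle_pair X I U P Z hm J D Q T hr + quasi_local_space T \<QQ> MM
  for X :: "'x topology" and I :: "'i set" and U :: "'i \<Rightarrow> 'x set" and P :: "'i \<Rightarrow> 'x \<Rightarrow> 'p"
    and Z :: "'p topology" and hm :: "'i \<Rightarrow> 'i \<Rightarrow> 'p \<rightharpoonup> 'p"
    and J :: "'j set" and D :: "'j \<Rightarrow> 'x set" and Q :: "'j \<Rightarrow> 'x \<Rightarrow> 'q"
    and T :: "'q topology" and hr :: "'j \<Rightarrow> 'j \<Rightarrow> 'q \<rightharpoonup> 'q"
    and \<QQ> :: "'q metric set set" and MM :: "'q metric set" +
  fixes S1 S2 :: "('q \<rightharpoonup> 'q) set" and A :: "'a set" and N V W :: "'a \<Rightarrow> 'x set" and q :: "'a \<Rightarrow> 'x \<Rightarrow> 'q"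
    and \<alpha> :: "'a \<Rightarrow> 'j" and m :: "'a \<Rightarrow> 'q metric" and small :: "'q set \<Rightarrow> bool" and c :: nat
  assumes S1: "S1 \<subseteq> R.H" "symmetric_maps S1" "comp_closed S1" "generated_pseudogroup T S1 = R.H"
    and S1_equicont: "\<And>\<epsilon>. \<epsilon> > 0 \<Longrightarrow> \<exists>\<delta>>0. \<forall>h\<in>S1. \<forall>m\<in>MM. \<forall>m'\<in>MM. \<forall>x y x' y'.
             x \<in> mspace m \<and> y \<in> mspace m \<and> h x = Some x' \<and> h y = Some y' \<and>
             x' \<in> mspace m' \<and> y' \<in> mspace m' \<and> mdist m x y < \<delta> \<longrightarrow> mdist m' x' y' < \<epsilon>"
    and S2: "S2 \<subseteq> R.H" "symmetric_maps S2" "comp_closed S2" "generated_pseudogroup T S2 = R.H"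
    and S2_effective: "\<And>h B. h \<in> S2 \<Longrightarrow> openin T B \<Longrightarrow> B \<noteq> {} \<Longrightarrow> B \<subseteq> dom h \<Longrightarrow> \<forall>x\<in>B. h x = Some x \<Longrightarrow> \<forall>x\<in>dom h. h x = Some x"
    and compact: "compact_space X" and fin: "finite A"
    and open_sets: "\<And>a. a \<in> A \<Longrightarrow> openin X (N a)" "\<And>a. a \<in> A \<Longrightarrow> openin X (V a)" "\<And>a. a \<in> A \<Longrightarrow> openin X (W a)"
    and closures: "\<And>a. a \<in> A \<Longrightarrow> X closure_of V a \<subseteq> N a" "\<And>a. a \<in> A \<Longrightarrow> X closure_of W a \<subseteq> V a"
    and W_cover: "topspace X \<subseteq> (\<Union>a\<in>A. W a)"
    and q_def: "\<And>a. a \<in> A \<Longrightarrow> q a = Q (\<alpha> a)" and \<alpha>: "\<And>a. a \<in> A \<Longrightarrow> \<alpha> a \<in> J" and m: "\<And>a. a \<in> A \<Longrightarrow> m a \<in> MM"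
    and N_dom: "\<And>a. a \<in> A \<Longrightarrow> N a \<subseteq> D (\<alpha> a)" and N_mspace: "\<And>a. a \<in> A \<Longrightarrow> q a ` N a \<subseteq> mspace (m a)"
    and small_subset: "\<And>B B'. small B \<Longrightarrow> B' \<subseteq> B \<Longrightarrow> small B'"
    and small_local: "\<And>t. t \<in> topspace T \<Longrightarrow> \<exists>B. openin T B \<and> t \<in> B \<and> small B"
    and small_equicont: "\<And>\<epsilon>. \<epsilon> > 0 \<Longrightarrow> \<exists>\<delta>>0. \<forall>B a b x y. small B \<longrightarrow> a \<in> A \<longrightarrow> b \<in> A \<longrightarrow> x \<in> B \<longrightarrow> y \<in> B \<longrightarrow>
        x \<in> q a ` N a \<inter> q b ` N b \<longrightarrow> y \<in> q a ` N a \<inter> q b ` N b \<longrightarrow> mdist (m a) x y < \<delta> \<longrightarrow> mdist (m b) x y < \<epsilon>"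
    and N_cstep: "\<And>a x y. a \<in> A \<Longrightarrow> x \<in> N a \<Longrightarrow> y \<in> N a \<Longrightarrow> q a x = q a y \<Longrightarrow> (x, y) \<in> C.cstep"
    and cstep_V: "C.cstep \<subseteq> {(x, y). \<exists>a\<in>A. x \<in> V a \<and> y \<in> V a \<and> q a x = q a y} ^^ c"
begin

text \<open>
  Germs of the identity need not be represented in \<open>S1\<close> or \<open>S2\<close> (at points outside the domains of
  their members), so identities are added; they are only locally equicontinuous, hence \<open>small\<close>.
\<close>

definition S where
  "S = {f. partial_open_embedding T f \<and> ((\<exists>s\<in>S1. f \<subseteq>\<^sub>m s) \<or> (f \<subseteq>\<^sub>m Some \<and> small (dom f))) \<and>
      ((\<exists>s\<in>S2. f \<subseteq>\<^sub>m s) \<or> f \<subseteq>\<^sub>m Some)}"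

lemma S_comp: assumes f: "f \<in> S" and g: "g \<in> S" shows "f \<circ>\<^sub>m g \<in> S"
proof -
  have poe: "partial_open_embedding T (f \<circ>\<^sub>m g)" using f g poe_comp by (auto simp: S_def)
  \<comment> \<open>\<open>S'\<close> stands for \<open>S1\<close> or \<open>S2\<close>. In the
    first case \<open>Q'\<close> is the smallness of the domain of \<open>g\<close>, in the second
    it is \<open>True\<close>.\<close>
  have comp: "(\<exists>s\<in>S'. f \<circ>\<^sub>m g \<subseteq>\<^sub>m s) \<or> f \<circ>\<^sub>m g \<subseteq>\<^sub>m Some \<and> Q'"
    if S': "comp_closed S'" and cases: "(\<exists>s\<in>S'. f \<subseteq>\<^sub>m s) \<or> f \<subseteq>\<^sub>m Some" "(\<exists>s\<in>S'. g \<subseteq>\<^sub>m s) \<or> g \<subseteq>\<^sub>m Some \<and> Q'"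
    for S' Q'
    using cases
  proof (elim disjE bexE conjE)
    fix s s' assume s: "s \<in> S'" "f \<subseteq>\<^sub>m s" "s' \<in> S'" "g \<subseteq>\<^sub>m s'"
    then have "s \<circ>\<^sub>m s' \<in> S'" using S' by (simp add: comp_closed_def)
    then show ?thesis using map_le_comp[OF s(2,4)] by auto
  next
    fix s assume "f \<subseteq>\<^sub>m Some" "s \<in> S'" "g \<subseteq>\<^sub>m s"
    then show ?thesis using map_le_Some_comp map_le_trans by metis
  next
    fix s assume "g \<subseteq>\<^sub>m Some" "s \<in> S'" "f \<subseteq>\<^sub>m s"
    then show ?thesis using map_le_comp_Some map_le_trans by metis
  next
    assume id: "f \<subseteq>\<^sub>m Some" "g \<subseteq>\<^sub>m Some" and Q'
    then show ?thesis using map_le_trans[OF map_le_Some_comp[OF id(1)] id(2)] by simp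
  qed
  have "(\<exists>s\<in>S1. f \<circ>\<^sub>m g \<subseteq>\<^sub>m s) \<or> f \<circ>\<^sub>m g \<subseteq>\<^sub>m Some \<and> small (dom g)"
    by (rule comp[OF S1(3)]) (use f g in \<open>auto simp: S_def\<close>)
  moreover have "dom (f \<circ>\<^sub>m g) \<subseteq> dom g" by (auto simp: map_comp_Some_iff dom_def)
  ultimately have "(\<exists>s\<in>S1. f \<circ>\<^sub>m g \<subseteq>\<^sub>m s) \<or> f \<circ>\<^sub>m g \<subseteq>\<^sub>m Some \<and> small (dom (f \<circ>\<^sub>m g))"
    using small_subset by blast
  moreover have "(\<exists>s\<in>S2. f \<circ>\<^sub>m g \<subseteq>\<^sub>m s) \<or> f \<circ>\<^sub>m g \<subseteq>\<^sub>m Some \<and> True"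
    by (rule comp[OF S2(3)]) (use f g in \<open>simp_all add: S_def\<close>)
  ultimately show ?thesis using poe by (simp add: S_def)
qed

text \<open>A germ is the identity or agrees with a member of \<open>S1\<close>, and likewise for
  \<open>S2\<close>. Intersecting the two neighbourhoods with a small one yields a representative
  that meets all conditions of \<open>S\<close>.\<close>

lemma S_germ:
  assumes f: "f \<in> R.H" "f t = Some t'"
  obtains G where "openin T G" "t \<in> G" "f |` G \<in> S"
proof -
  have poe: "partial_open_embedding T f" using R.H_poe[OF f(1)] .
  obtain B where B: "openin T B" "t \<in> B" "small B" using small_local[OF poe_topspace(1)[OF poe f(2)]] by blast
  have germ: "\<exists>G. openin T G \<and> t \<in> G \<and> (\<forall>B\<subseteq>G. (\<exists>s\<in>S'. f |` B \<subseteq>\<^sub>m s) \<or> f |` B \<subseteq>\<^sub>m Some)"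
    if S': "S' \<subseteq> R.H" "symmetric_maps S'" "comp_closed S'" "generated_pseudogroup T S' = R.H" for S'
  proof -
    have "\<And>s. s \<in> S' \<Longrightarrow> partial_open_embedding T s" using S'(1) R.H_poe by blast
    then have "(\<exists>s\<in>S'. same_germ T t f s) \<or> same_germ T t f (id_map T)"
      using generated_germ_comp_closed[OF _ S'(2,3)] f S'(4) by simp
    then show ?thesis
    proof (elim disjE bexE)
      fix s assume s: "s \<in> S'" "same_germ T t f s"
      obtain G where G: "openin T G" "t \<in> G" "\<forall>B\<subseteq>G. f |` B \<subseteq>\<^sub>m s"
        using same_germ_restrict_le[OF s(2)] by (elim exE conjE)
      then show ?thesis using s(1) by (intro exI[of _ G]) blast
    next
      assume i: "same_germ T t f (id_map T)"
      obtain G where G: "openin T G" "t \<in> G" "\<forall>B\<subseteq>G. f |` B \<subseteq>\<^sub>m id_map T"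
        using same_germ_restrict_le[OF i] by (elim exE conjE)
      have "id_map T \<subseteq>\<^sub>m Some" by (rule map_leI) simp
      then have "\<forall>B\<subseteq>G. f |` B \<subseteq>\<^sub>m Some" using G(3) map_le_trans by blast
      then show ?thesis using G(1,2) by (intro exI[of _ G]) blast
    qed
  qed
  obtain G1 where G1: "openin T G1" "t \<in> G1" "\<forall>B\<subseteq>G1. (\<exists>s\<in>S1. f |` B \<subseteq>\<^sub>m s) \<or> f |` B \<subseteq>\<^sub>m Some"
    using germ[OF S1] by (elim exE conjE)
  obtain G2 where G2: "openin T G2" "t \<in> G2" "\<forall>B\<subseteq>G2. (\<exists>s\<in>S2. f |` B \<subseteq>\<^sub>m s) \<or> f |` B \<subseteq>\<^sub>m Some"
    using germ[OF S2] by (elim exE conjE)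
  define G where "G = B \<inter> G1 \<inter> G2"
  have G: "openin T G" "t \<in> G" using B G1 G2 by (auto simp: G_def)
  have sub: "G \<subseteq> G1" "G \<subseteq> G2" by (auto simp: G_def)
  have "dom (f |` G) \<subseteq> B" by (auto simp: G_def)
  then have "small (dom (f |` G))" by (rule small_subset[OF B(3)])
  then have "f |` G \<in> S"
    unfolding S_def using G1(3)[rule_format, OF sub(1)] G2(3)[rule_format, OF sub(2)] poe_restrict[OF poe G(1)] by blast
  then show ?thesis using that G by blast
qed

lemma V_N: assumes "a \<in> A" shows "V a \<subseteq> N a"
  by (rule order_trans[OF closure_of_subset[OF openin_subset[OF open_sets(2)[OF assms]]] closures(1)[OF assms]])

lemma W_V: assumes "a \<in> A" shows "W a \<subseteq> V a"
  by (rule order_trans[OF closure_of_subset[OF openin_subset[OF open_sets(3)[OF assms]]] closures(2)[OF assms]])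

lemma q_ball_open:
  assumes "a \<in> A" "openin X G" "G \<subseteq> N a" shows "openin X {x \<in> G. q a x \<in> mball_of (m a) t r}"
proof -
  have "{x \<in> G. q a x \<in> mball_of (m a) t r} = G \<inter> {x \<in> D (\<alpha> a). Q (\<alpha> a) x \<in> mball_of (m a) t r}"
    using N_dom[OF assms(1)] assms(3) q_def[OF assms(1)] by auto
  then show ?thesis using assms R.P_cont[OF \<alpha>[OF assms(1)] mball_open[OF m[OF assms(1)]]] by auto
qed

lemma q_open: assumes "a \<in> A" "openin X G" "G \<subseteq> N a" shows "openin T (q a ` G)"
proof -
  have "G \<inter> D (\<alpha> a) = G" using N_dom assms by blast
  then show ?thesis using R.P_open[OF \<alpha>[OF assms(1)] assms(2)] by (simp add: q_def[OF assms(1)])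
qed

text \<open>Maps below a member of \<open>S1\<close> are controlled by strong equicontinuity. An
  identity still changes the metric from \<open>m a\<close> to \<open>m b\<close>, and this is
  controlled only on small domains.\<close>

lemma S_equicont:
  assumes "\<epsilon> > 0"
  shows "\<exists>\<delta>>0. \<forall>h\<in>S. \<forall>a\<in>A. \<forall>b\<in>A. \<forall>x\<in>N a. \<forall>y\<in>N a. \<forall>x'\<in>N b. \<forall>y'\<in>N b.
        h (q a x) = Some (q b x') \<longrightarrow> h (q a y) = Some (q b y') \<longrightarrow> mdist (m a) (q a x) (q a y) < \<delta> \<longrightarrow>
        mdist (m b) (q b x') (q b y') < \<epsilon>"
proof -
  obtain \<delta>1 where \<delta>1: "\<delta>1 > 0" "\<forall>h\<in>S1. \<forall>m\<in>MM. \<forall>m'\<in>MM. \<forall>x y x' y'.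
             x \<in> mspace m \<and> y \<in> mspace m \<and> h x = Some x' \<and> h y = Some y' \<and>
             x' \<in> mspace m' \<and> y' \<in> mspace m' \<and> mdist m x y < \<delta>1 \<longrightarrow> mdist m' x' y' < \<epsilon>"
    using S1_equicont[OF assms] by (elim exE conjE)
  obtain \<delta>2 where \<delta>2: "\<delta>2 > 0" "\<forall>B a b x y. small B \<longrightarrow> a \<in> A \<longrightarrow> b \<in> A \<longrightarrow> x \<in> B \<longrightarrow> y \<in> B \<longrightarrow>
        x \<in> q a ` N a \<inter> q b ` N b \<longrightarrow> y \<in> q a ` N a \<inter> q b ` N b \<longrightarrow> mdist (m a) x y < \<delta>2 \<longrightarrow> mdist (m b) x y < \<epsilon>"
    using small_equicont[OF assms] by (elim exE conjE)
  have "mdist (m b) (q b x') (q b y') < \<epsilon>"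
    if h: "h \<in> S" and ab: "a \<in> A" "b \<in> A" and x: "x \<in> N a" "y \<in> N a" "x' \<in> N b" "y' \<in> N b"
      and hx: "h (q a x) = Some (q b x')" "h (q a y) = Some (q b y')" and d: "mdist (m a) (q a x) (q a y) < min \<delta>1 \<delta>2"
    for h a b x y x' y'
  proof -
    have ms: "q a x \<in> mspace (m a)" "q a y \<in> mspace (m a)" "q b x' \<in> mspace (m b)" "q b y' \<in> mspace (m b)"
      using N_mspace ab x by blast+
    have "(\<exists>s\<in>S1. h \<subseteq>\<^sub>m s) \<or> (h \<subseteq>\<^sub>m Some \<and> small (dom h))" using h by (simp add: S_def)
    then show ?thesis
    proof (elim disjE bexE conjE)
      fix s assume s: "s \<in> S1" "h \<subseteq>\<^sub>m s"
      show ?thesis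
        using \<delta>1(2)[rule_format, OF s(1) m[OF ab(1)] m[OF ab(2)], of "q a x" "q a y" "q b x'" "q b y'"]
          ms d map_leD[OF s(2) hx(1)] map_leD[OF s(2) hx(2)] by simp
    next
      assume s: "h \<subseteq>\<^sub>m Some" "small (dom h)"
      have e: "q b x' = q a x" "q b y' = q a y" using map_leD[OF s(1) hx(1)] map_leD[OF s(1) hx(2)] by simp_all
      have "q a x \<in> q a ` N a \<inter> q b ` N b" "q a y \<in> q a ` N a \<inter> q b ` N b" using x e by (metis IntI imageI)+
      moreover have "q a x \<in> dom h" "q a y \<in> dom h" using hx by auto
      ultimately show ?thesis
        using \<delta>2(2)[rule_format, OF s(2) ab, of "q a x" "q a y"] d e by simp
    qed
  qed
  then show ?thesis using \<delta>1(1) \<delta>2(1) by (intro exI[of _ "min \<delta>1 \<delta>2"]) simp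
qed

text \<open>Trivial holonomy makes \<open>s1\<close>, and hence \<open>f\<close>, the identity near
  \<open>q a y\<close>. Then \<open>s2\<close> is the identity on a nonempty open set, so
  quasi-effectiveness makes it the identity everywhere, including at the possibly distant point
  \<open>t\<close>.\<close>

lemma S_rigid:
  assumes f: "f \<in> S" and a: "a \<in> A" and y: "C.TH y" "y \<in> V a" "f (q a y) = Some (q a y)" and t: "t \<in> dom f"
  shows "f t = Some t"
proof (cases "f \<subseteq>\<^sub>m Some")
  case True
  then show ?thesis using t by (auto simp: map_le_def)
next
  case False
  then obtain s1 s2 where s: "s1 \<in> S1" "f \<subseteq>\<^sub>m s1" "s2 \<in> S2" "f \<subseteq>\<^sub>m s2" using f by (auto simp: S_def)
  have yD: "y \<in> D (\<alpha> a)" using y(2) V_N[OF a] N_dom[OF a] by auto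
  have "s1 (q a y) = Some (q a y)" using map_leD[OF s(2) y(3)] .
  then have "same_germ T (q a y) s1 (id_map T)"
    using TH_transfer[OF y(1) \<alpha>[OF a] yD] s(1) S1(1) q_def[OF a] unfolding trivial_germs_def by auto
  then obtain B where B: "openin T B" "q a y \<in> B" "B \<subseteq> dom (id_map T)" "\<forall>x\<in>B. s1 x = id_map T x"
    unfolding same_germ_def by auto
  have fix1: "f x = Some x" if x: "x \<in> B \<inter> dom f" for x
  proof -
    obtain z where z: "f x = Some z" using x by auto
    then have "id_map T x = Some z" using map_leD[OF s(2) z] B(4) x by auto
    then show ?thesis using z by simp
  qed
  have "\<forall>x\<in>dom s2. s2 x = Some x"
  proof (rule S2_effective[OF s(3)])
    show "openin T (B \<inter> dom f)" using B(1) poe_dom f by (auto simp: S_def)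
    show "B \<inter> dom f \<noteq> {}" using B(2) y(3) by auto
    show "B \<inter> dom f \<subseteq> dom s2" using map_le_implies_dom_le[OF s(4)] by auto
    show "\<forall>x\<in>B \<inter> dom f. s2 x = Some x" using fix1 map_leD[OF s(4)] by blast
  qed
  moreover obtain z where z: "f t = Some z" using t by auto
  ultimately show ?thesis using map_leD[OF s(4) z] by (metis domI)
qed

section \<open>Uniform radii for the small charts\<close>

lemma closure_compact: "compactin X (X closure_of G)"
  by (intro closedin_compact_space compact closedin_closure_of)

text \<open>\<open>S\<close> contains only small pieces of chart changes, so \<open>s\<close>
  depends on \<open>x\<close>; what compactness makes uniform is the radius. Closures of the sets
  \<open>V\<close> are taken in order to have compactness.\<close>

lemma transition_radius:
  assumes ab: "a \<in> A" "b \<in> A"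
  shows "\<exists>\<epsilon>>0. \<forall>x\<in>X closure_of V a \<inter> X closure_of V b. \<exists>s\<in>S. \<forall>t\<in>mball_of (m a) (q a x) \<epsilon>.
    \<exists>w\<in>N a \<inter> N b. q a w = t \<and> s t = Some (q b w)"
proof (rule compact_common_radius[where N = "N a"])
  show "compactin X (X closure_of V a \<inter> X closure_of V b)"
    by (intro closedin_compact_space compact closedin_Int closedin_closure_of)
  show "X closure_of V a \<inter> X closure_of V b \<subseteq> N a" using closures(1) ab by auto
  show "q a ` N a \<subseteq> mspace (m a)" using N_mspace ab by auto
  show "openin X {x \<in> N a. q a x \<in> mball_of (m a) t r}" for t r using q_ball_open[OF ab(1) open_sets(1)] ab by auto
  fix x assume "x \<in> X closure_of V a \<inter> X closure_of V b"
  then have x: "x \<in> N a" "x \<in> N b" using closures(1) ab by auto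
  have hr: "hr (\<alpha> a) (\<alpha> b) (q a w) = Some (q b w)" if "w \<in> N a" "w \<in> N b" for w
    using R.hm_I[OF \<alpha>[OF ab(1)] \<alpha>[OF ab(2)]] that N_dom ab by (auto simp: q_def)
  obtain G where G: "openin T G" "q a x \<in> G" "hr (\<alpha> a) (\<alpha> b) |` G \<in> S"
    using S_germ[OF R.hm_in_H[OF \<alpha>[OF ab(1)] \<alpha>[OF ab(2)]] hr[OF x]] by blast
  have "openin T (q a ` (N a \<inter> N b))" using q_open[OF ab(1)] open_sets(1) ab by auto
  then have "openin T (G \<inter> q a ` (N a \<inter> N b))" "q a x \<in> G \<inter> q a ` (N a \<inter> N b)" using G x by auto
  then obtain \<rho> where \<rho>: "\<rho> > 0" "mball_of (m a) (q a x) \<rho> \<subseteq> G \<inter> q a ` (N a \<inter> N b)"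
    using ball_in_open m[OF ab(1)] N_mspace[OF ab(1)] x by blast
  have "\<exists>w\<in>N a \<inter> N b. q a w = t \<and> (hr (\<alpha> a) (\<alpha> b) |` G) t = Some (q b w)" if t: "t \<in> mball_of (m a) (q a x) \<rho>" for t
  proof -
    obtain w where w: "w \<in> N a \<inter> N b" "t = q a w" "t \<in> G" using subsetD[OF \<rho>(2) t] by blast
    then show ?thesis using hr[of w] by (auto simp: restrict_map_Some_iff)
  qed
  then show "\<exists>\<rho>>0. \<exists>s\<in>S. \<forall>t\<in>mball_of (m a) (q a x) \<rho>. \<exists>w\<in>N a \<inter> N b. q a w = t \<and> s t = Some (q b w)"
    using \<rho>(1) G(3) by blast
qed blast

lemma inner_radius:
  assumes a: "a \<in> A"
  shows "\<exists>\<epsilon>>0. \<forall>x\<in>X closure_of W a. \<forall>t\<in>mball_of (m a) (q a x) \<epsilon>. \<exists>w\<in>V a. q a w = t"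
proof (rule compact_common_radius[where N = "N a"])
  show "compactin X (X closure_of W a)" by (rule closure_compact)
  show "X closure_of W a \<subseteq> N a" using closures(2) V_N a by blast
  show "q a ` N a \<subseteq> mspace (m a)" using N_mspace a by auto
  show "openin X {x \<in> N a. q a x \<in> mball_of (m a) t r}" for t r using q_ball_open[OF a open_sets(1)] a by auto
  fix x assume "x \<in> X closure_of W a"
  then have x: "x \<in> V a" using closures(2) a by auto
  have "openin T (q a ` V a)" "q a x \<in> q a ` V a" using q_open[OF a open_sets(2) V_N] a x by auto
  then obtain \<rho> where \<rho>: "\<rho> > 0" "mball_of (m a) (q a x) \<rho> \<subseteq> q a ` V a"
    using ball_in_open m[OF a] N_mspace[OF a] V_N[OF a] x by blast
  then show "\<exists>\<rho>>0. \<forall>t\<in>mball_of (m a) (q a x) \<rho>. \<exists>w\<in>V a. q a w = t" by blast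
qed blast

lemma common_radius:
  obtains \<epsilon> where "\<epsilon> > 0"
    "\<And>a b x. a \<in> A \<Longrightarrow> b \<in> A \<Longrightarrow> x \<in> V a \<Longrightarrow> x \<in> V b \<Longrightarrow> \<exists>s\<in>S. \<forall>t\<in>mball_of (m a) (q a x) \<epsilon>.
       \<exists>w\<in>N a \<inter> N b. q a w = t \<and> s t = Some (q b w)"
    "\<And>a x t. a \<in> A \<Longrightarrow> x \<in> W a \<Longrightarrow> t \<in> mball_of (m a) (q a x) \<epsilon> \<Longrightarrow> \<exists>w\<in>V a. q a w = t"
proof -
  have ball: "mball_of (m a) z \<epsilon>' \<subseteq> mball_of (m a) z \<epsilon>" if "\<epsilon>' \<le> \<epsilon>" for a z \<epsilon> \<epsilon>'
    using that by auto
  define good where "good f \<epsilon> \<longleftrightarrow> (case f of (a, b) \<Rightarrow> \<forall>x\<in>X closure_of V a \<inter> X closure_of V b.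
    \<exists>s\<in>S. \<forall>t\<in>mball_of (m a) (q a x) \<epsilon>. \<exists>w\<in>N a \<inter> N b. q a w = t \<and> s t = Some (q b w))" for f \<epsilon>
  have "\<exists>\<epsilon>>0. \<forall>f\<in>A \<times> A. good f \<epsilon>"
  proof (rule finite_common_radius)
    show "finite (A \<times> A)" using fin by simp
    show "\<exists>\<epsilon>>0. good f \<epsilon>" if "f \<in> A \<times> A" for f
      using that transition_radius unfolding good_def by (cases f) auto
    show "good f \<epsilon>'" if "good f \<epsilon>" "\<epsilon>' \<le> \<epsilon>" for f \<epsilon> \<epsilon>'
      using that ball[OF that(2)] unfolding good_def by (cases f) (simp only: prod.case, meson subsetD)
  qed
  then obtain \<epsilon>1 where e1: "\<epsilon>1 > 0" "\<And>a b x. a \<in> A \<Longrightarrow> b \<in> A \<Longrightarrow> x \<in> X closure_of V a \<inter> X closure_of V b \<Longrightarrow>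
    \<exists>s\<in>S. \<forall>t\<in>mball_of (m a) (q a x) \<epsilon>1. \<exists>w\<in>N a \<inter> N b. q a w = t \<and> s t = Some (q b w)"
    unfolding good_def by fastforce
  have "\<exists>\<epsilon>>0. \<forall>a\<in>A. \<forall>x\<in>X closure_of W a. \<forall>t\<in>mball_of (m a) (q a x) \<epsilon>. \<exists>w\<in>V a. q a w = t"
    by (rule finite_common_radius[OF fin inner_radius]) (use ball in blast)+
  then obtain \<epsilon>2 where e2: "\<epsilon>2 > 0" "\<And>a x t. a \<in> A \<Longrightarrow> x \<in> X closure_of W a \<Longrightarrow> t \<in> mball_of (m a) (q a x) \<epsilon>2 \<Longrightarrow> \<exists>w\<in>V a. q a w = t"
    by blast
  show ?thesis
  proof (rule that[of "min \<epsilon>1 \<epsilon>2"])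
    fix a b x assume x: "a \<in> A" "b \<in> A" "x \<in> V a" "x \<in> V b"
    then have "x \<in> X closure_of V a \<inter> X closure_of V b"
      using closure_of_subset[OF openin_subset[OF open_sets(2)]] by blast
    from e1(2)[OF x(1,2) this] show "\<exists>s\<in>S. \<forall>t\<in>mball_of (m a) (q a x) (min \<epsilon>1 \<epsilon>2).
       \<exists>w\<in>N a \<inter> N b. q a w = t \<and> s t = Some (q b w)"
      using ball[of "min \<epsilon>1 \<epsilon>2" \<epsilon>1 a "q a x"] by (meson min.cobounded1 subsetD)
  next
    fix a x t assume x: "a \<in> A" "x \<in> W a" "t \<in> mball_of (m a) (q a x) (min \<epsilon>1 \<epsilon>2)"
    then have "x \<in> X closure_of W a" using closure_of_subset[OF openin_subset[OF open_sets(3)]] by blast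
    then show "\<exists>w\<in>V a. q a w = t" using e2(2) x by auto
  qed (use e1 e2 in simp)
qed

section \<open>From small charts to holonomy orbits\<close>

definition step :: "('x \<times> 'x) set" where
  "step = {(x, y). \<exists>a\<in>A. x \<in> V a \<and> y \<in> V a \<and> q a x = q a y}"

lemma locally_coarse_equiv:
  assumes x0: "x0 \<in> topspace X"
  shows "\<exists>G. openin X G \<and> x0 \<in> G \<and> (\<forall>y\<in>G. \<forall>y'\<in>G. C.TH y \<longrightarrow> C.TH y' \<longrightarrow>
     coarse_equiv (step\<^sup>* `` {y}) step (step\<^sup>* `` {y'}) step)"
proof -
  obtain \<epsilon>0 where e0: "\<epsilon>0 > 0"
    "\<And>a b x. a \<in> A \<Longrightarrow> b \<in> A \<Longrightarrow> x \<in> V a \<Longrightarrow> x \<in> V b \<Longrightarrow> \<exists>s\<in>S. \<forall>t\<in>mball_of (m a) (q a x) \<epsilon>0.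
       \<exists>w\<in>N a \<inter> N b. q a w = t \<and> s t = Some (q b w)"
    "\<And>a x t. a \<in> A \<Longrightarrow> x \<in> W a \<Longrightarrow> t \<in> mball_of (m a) (q a x) \<epsilon>0 \<Longrightarrow> \<exists>w\<in>V a. q a w = t"
    using common_radius by blast
  have in_ball: "q a u \<in> mball_of (m a) (q a x) r" if "a \<in> A" "x \<in> N a" "u \<in> N a" "mdist (m a) (q a x) (q a u) < r" for a x u r
    using N_mspace[OF that(1)] that by auto
  interpret K: equicontinuous_chains A W V N q "\<lambda>a. mdist (m a)" S "{y. C.TH y}" c \<epsilon>0
  proof
    show "W a \<subseteq> V a" "V a \<subseteq> N a" if "a \<in> A" for a using W_V V_N that by auto
    show "V a \<subseteq> (\<Union>a\<in>A. W a)" if "a \<in> A" for a using W_cover openin_subset[OF open_sets(2)[OF that]] by blast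
    show "mdist (m a) t t' = mdist (m a) t' t" for a t t' by (rule mdist_commute)
    show "f \<circ>\<^sub>m g \<in> S" if "f \<in> S" "g \<in> S" for f g using S_comp that .
    show "t = t'" if "f \<in> S" "f t = Some s" "f t' = Some s" for f t t' s
      using poe_inj[of T f t s t'] that by (simp add: S_def)
    show "\<exists>s\<in>S. s (q a x) = Some (q b x) \<and> (\<forall>u\<in>N a. mdist (m a) (q a x) (q a u) < \<epsilon>0 \<longrightarrow>
           (\<exists>w \<in> N a \<inter> N b. q a w = q a u \<and> s (q a u) = Some (q b w)))"
      if x: "a \<in> A" "b \<in> A" "x \<in> V a" "x \<in> V b" for a b x
    proof -
      obtain s where s: "s \<in> S" "\<forall>t\<in>mball_of (m a) (q a x) \<epsilon>0. \<exists>w\<in>N a \<inter> N b. q a w = t \<and> s t = Some (q b w)"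
        using e0(2)[OF x] by blast
      have xN: "x \<in> N a" "x \<in> N b" using x V_N by auto
      have "q a x \<in> mball_of (m a) (q a x) \<epsilon>0" using N_mspace[OF x(1)] xN e0(1) by (intro centre_in_mball_of) auto
      then obtain w where w: "w \<in> N a" "w \<in> N b" "q a w = q a x" "s (q a x) = Some (q b w)" using s(2) by blast
      \<comment> \<open>The radius condition at the centre of the ball yields only some
        \<open>w\<close> on the plaque of \<open>x\<close>. The overlap map sends equal projections
        to equal projections, so \<open>s\<close> has the required value at \<open>x\<close>
        itself.\<close>
      have "q b w = q b x"
        using R.P_change[OF \<alpha>[OF x(1)] \<alpha>[OF x(2)], of w x] w xN N_dom x(1,2) q_def by auto
      then show ?thesis using s w(4) in_ball[OF x(1) xN(1)] by (intro bexI[of _ s]) auto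
    qed
    show "\<exists>w\<in>V a. q a w = q a u" if x: "a \<in> A" "x \<in> W a" "u \<in> N a" "mdist (m a) (q a x) (q a u) < \<epsilon>0" for a x u
    proof -
      have "x \<in> N a" using W_V[OF x(1)] V_N[OF x(1)] x(2) by auto
      then show ?thesis using e0(3)[OF x(1,2) in_ball[OF x(1) _ x(3,4)]] by simp
    qed
    show "f t = Some t" if "f \<in> S" "a \<in> A" "y \<in> {y. C.TH y}" "y \<in> V a" "f (q a y) = Some (q a y)" "t \<in> dom f" for f a y t
      using S_rigid[OF that(1,2) _ that(4-6)] that(3) by simp
    show "(x, y) \<in> {(x, y). \<exists>a\<in>A. x \<in> V a \<and> y \<in> V a \<and> q a x = q a y} ^^ c"
      if "a \<in> A" "x \<in> N a" "y \<in> N a" "q a x = q a y" for a x y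
      using cstep_V N_cstep[OF that] by blast
  qed (fact S_equicont e0(1))+
  obtain \<delta> where \<delta>: "\<delta> > 0" "\<forall>a\<in>A. \<forall>y\<in>V a \<inter> {y. C.TH y}. \<forall>y'\<in>V a \<inter> {y. C.TH y}.
      mdist (m a) (q a y) (q a y') < \<delta> \<longrightarrow> coarse_equiv (K.Vstep\<^sup>* `` {y}) K.Vstep (K.Vstep\<^sup>* `` {y'}) K.Vstep"
    using K.nearby_coarse_equiv by (elim exE conjE)
  have [simp]: "K.Vstep = step" by (simp add: K.Vstep_def step_def)
  obtain a where a: "a \<in> A" "x0 \<in> V a" using x0 W_cover W_V by blast
  \<comment> \<open>Half of \<open>\<delta>\<close>, since two points of \<open>G\<close> are
    compared through \<open>x0\<close>.\<close>
  define G where "G = {x \<in> V a. q a x \<in> mball_of (m a) (q a x0) (\<delta> / 2)}"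
  have "openin X G" unfolding G_def using q_ball_open[OF a(1) open_sets(2) V_N] a(1) by blast
  moreover have "x0 \<in> G" unfolding G_def using a N_mspace[OF a(1)] V_N[OF a(1)] \<delta>(1) centre_in_mball_of[of "q a x0" "m a" "\<delta> / 2"] by auto
  moreover have "coarse_equiv (step\<^sup>* `` {y}) step (step\<^sup>* `` {y'}) step" if y: "y \<in> G" "y' \<in> G" "C.TH y" "C.TH y'" for y y'
  proof -
    have "mdist (m a) (q a y) (q a y') \<le> mdist (m a) (q a y) (q a x0) + mdist (m a) (q a x0) (q a y')"
      using y by (intro mdist_triangle) (auto simp: G_def)
    also have "\<dots> < \<delta>" using y mdist_commute[of "m a" "q a y" "q a x0"] by (auto simp: G_def)
    finally show ?thesis using \<delta>(2)[rule_format, OF a(1), of y y'] y by (simp add: G_def)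
  qed
  ultimately show ?thesis by blast
qed

text \<open>Together with \<open>cstep_step\<close>: a small step is one step of the cocycle, and a
  step of the cocycle is \<open>c\<close> small ones, so the two chain metrics are
  comparable.\<close>

lemma step_cstep: "step \<subseteq> C.cstep"
proof
  fix p assume "p \<in> step"
  then obtain x y a where "p = (x, y)" "a \<in> A" "x \<in> V a" "y \<in> V a" "q a x = q a y" by (auto simp: step_def)
  then show "p \<in> C.cstep" using N_cstep[of a x y] V_N[of a] by auto
qed

lemma cstep_step: "C.cstep \<subseteq> step ^^ c"
  using cstep_V by (simp add: step_def)

lemma step_rtrancl: "step\<^sup>* = C.cstep\<^sup>*"
proof
  show "step\<^sup>* \<subseteq> C.cstep\<^sup>*" by (rule rtrancl_mono[OF step_cstep])
  have "C.cstep \<subseteq> step\<^sup>*" using cstep_step by (auto dest: relpow_imp_rtrancl)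
  then show "C.cstep\<^sup>* \<subseteq> step\<^sup>*" by (rule rtrancl_subset_rtrancl)
qed

lemma step_conn_graph: assumes "y \<in> topspace X" shows "conn_graph (step\<^sup>* `` {y}) step"
proof -
  have s: "sym step" by (auto simp: sym_def step_def)
  have "(x, x') \<in> step\<^sup>*" if "(y, x) \<in> step\<^sup>*" "(y, x') \<in> step\<^sup>*" for x x'
    using that sym_rtrancl[OF s] by (meson rtrancl_trans symD)
  moreover have "(x, x) \<in> step" if "(y, x) \<in> step\<^sup>*" for x
  proof -
    have "x \<in> topspace X" using that assms C.cstep_rtrancl_topspace unfolding step_rtrancl by blast
    then obtain a where "a \<in> A" "x \<in> W a" using W_cover by auto
    then show ?thesis using W_V[of a] by (auto simp: step_def)
  qed
  ultimately show ?thesis unfolding conn_graph_def using s by (auto intro: rtrancl_into_rtrancl)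
qed

text \<open>Passage from a chain class in \<open>X\<close> to an orbit in the transversal: a point
  is related to all its projections, one for each chart that contains it.\<close>

lemma coarse_equiv_Orb:
  assumes y: "y \<in> topspace X"
  shows "coarse_equiv (step\<^sup>* `` {y}) step (C.Orb y) (map_step C.E)"
proof -
  define r where "r = {(x, P i x) | x i. (y, x) \<in> step\<^sup>* \<and> i \<in> I \<and> x \<in> U i}"
  \<comment> \<open>The 2 comes from \<open>cstep_imp_estep\<close>; \<open>c + c\<close> arises
    because a generator amounts to two steps of the cocycle, each of \<open>c\<close> small
    steps.\<close>
  define d where "d = max 2 (c + c)"
  have dom: "Domain r = step\<^sup>* `` {y}"
  proof
    show "step\<^sup>* `` {y} \<subseteq> Domain r"
    proof
      fix x assume x: "x \<in> step\<^sup>* `` {y}"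
      then have "x \<in> topspace X" using C.cstep_rtrancl_topspace y unfolding step_rtrancl by blast
      then obtain i where "i \<in> I" "x \<in> U i" using C.U_cover by auto
      then show "x \<in> Domain r" using x unfolding r_def by blast
    qed
  qed (auto simp: r_def)
  have ran: "Range r = C.Orb y" unfolding r_def C.Orb_def step_rtrancl by blast
  have "coarse_lip r step (map_step C.E) 2"
    unfolding coarse_lip_def
  proof (intro allI impI)
    fix u u' v v' assume "(u, u') \<in> r" "(v, v') \<in> r" "(u, v) \<in> step"
    then show "(u', v') \<in> map_step C.E ^^ 2"
      using C.cstep_imp_estep step_cstep unfolding r_def by blast
  qed
  then have l1: "coarse_lip r step (map_step C.E) d"
    by (rule coarse_lip_mono[OF _ _ C.Orb_conn_graph[OF y]]) (simp_all add: d_def ran)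
  have "coarse_lip (r\<inverse>) (map_step C.E) step (c + c)"
    unfolding coarse_lip_def
  proof (intro allI impI)
    fix u u' v v' assume uv: "(u, u') \<in> r\<inverse>" "(v, v') \<in> r\<inverse>" "(u, v) \<in> map_step C.E"
    then have "(u', v') \<in> C.cstep ^^ 2"
      using C.estep_imp_cstep[OF uv(3)] unfolding r_def by blast
    then obtain w where "(u', w) \<in> C.cstep" "(w, v') \<in> C.cstep" by (auto simp: numeral_2_eq_2)
    then have "(u', w) \<in> step ^^ c" "(w, v') \<in> step ^^ c" using cstep_step by auto
    then show "(u', v') \<in> step ^^ (c + c)" by (rule relpow_join)
  qed
  then have "coarse_lip (r\<inverse>) (map_step C.E) step d"
    by (rule coarse_lip_mono[OF _ _ step_conn_graph[OF y]]) (simp_all add: d_def dom)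
  then show ?thesis unfolding coarse_equiv_def using l1 dom ran by blast
qed

lemma locally_coarse_equiv_Orb:
  assumes x0: "x0 \<in> topspace X"
  shows "\<exists>G. openin X G \<and> x0 \<in> G \<and> (\<forall>y\<in>G. \<forall>y'\<in>G. C.TH y \<longrightarrow> C.TH y' \<longrightarrow>
     coarse_equiv (C.Orb y) (map_step C.E) (C.Orb y') (map_step C.E))"
proof -
  obtain G where G: "openin X G" "x0 \<in> G" "\<forall>y\<in>G. \<forall>y'\<in>G. C.TH y \<longrightarrow> C.TH y' \<longrightarrow>
     coarse_equiv (step\<^sup>* `` {y}) step (step\<^sup>* `` {y'}) step" using locally_coarse_equiv[OF x0] by blast
  have "coarse_equiv (C.Orb y) (map_step C.E) (C.Orb y') (map_step C.E)"
    if y: "y \<in> G" "y' \<in> G" "C.TH y" "C.TH y'" for y y'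
  proof -
    have t: "y \<in> topspace X" "y' \<in> topspace X" using y openin_subset[OF G(1)] by auto
    note g = step_conn_graph[OF t(1)] step_conn_graph[OF t(2)] C.Orb_conn_graph[OF t(1)] C.Orb_conn_graph[OF t(2)]
    have "coarse_equiv (step\<^sup>* `` {y}) step (C.Orb y') (map_step C.E)"
      by (rule coarse_equiv_trans[OF _ coarse_equiv_Orb[OF t(2)] g(1,2,4)]) (use G(3) y in blast)
    then show ?thesis
      by (rule coarse_equiv_trans[OF sym_coarse_equiv[OF coarse_equiv_Orb[OF t(1)]] _ g(3,1,4)])
  qed
  then show ?thesis using G(1,2) by blast
qed

end

section \<open>Connectedness of the leaf space\<close>

context transverse_cocycle
begin

text \<open>\<open>near v\<close> also contains points with nontrivial holonomy: only the trivial
  ones around them must have the coarse type of \<open>v\<close>. It is open and saturated. By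
  \<open>loc\<close> and \<open>dense\<close> such sets cover \<open>X\<close>, and if two of them
  meet, density provides a point of trivial holonomy in both, so their types agree.\<close>

lemma all_TH_coarse_equiv:
  assumes loc: "\<And>x. x \<in> topspace X \<Longrightarrow> \<exists>G. openin X G \<and> x \<in> G \<and> (\<forall>y\<in>G. \<forall>y'\<in>G. TH y \<longrightarrow> TH y' \<longrightarrow>
       coarse_equiv (Orb y) (map_step E) (Orb y') (map_step E))"
    and dense: "\<And>G. openin X G \<Longrightarrow> G \<noteq> {} \<Longrightarrow> \<exists>x\<in>G. TH x"
    and conn: "\<And>B B'. openin X B \<Longrightarrow> openin X B' \<Longrightarrow> B \<union> B' = topspace X \<Longrightarrow> B \<inter> B' = {} \<Longrightarrow>
       cstep `` B \<subseteq> B \<Longrightarrow> cstep `` B' \<subseteq> B' \<Longrightarrow> B = {} \<or> B' = {}"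
    and y: "y \<in> topspace X" "TH y" and y': "y' \<in> topspace X" "TH y'"
  shows "coarse_equiv (Orb y) (map_step E) (Orb y') (map_step E)"
proof -
  define ce where "ce w v \<longleftrightarrow> coarse_equiv (Orb w) (map_step E) (Orb v) (map_step E)" for w v
  have sym: "ce v w" if "ce w v" for v w using that sym_coarse_equiv by (auto simp: ce_def)
  have trans: "ce u w" if "ce u v" "ce v w" "u \<in> topspace X" "v \<in> topspace X" "w \<in> topspace X" for u v w
    using coarse_equiv_trans[OF that(1,2)[unfolded ce_def]] Orb_conn_graph that(3-5) by (simp add: ce_def)
  define near where "near v = {x \<in> topspace X. \<exists>G. openin X G \<and> x \<in> G \<and> (\<forall>w\<in>G. TH w \<longrightarrow> ce w v)}" for v
  have near_sub: "near v \<subseteq> topspace X" for v by (auto simp: near_def)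
  have near_open: "openin X (near v)" for v
  proof (subst openin_subopen, intro ballI)
    fix x assume "x \<in> near v"
    then obtain G where G: "openin X G" "x \<in> G" "\<forall>w\<in>G. TH w \<longrightarrow> ce w v" by (auto simp: near_def)
    then have "G \<subseteq> near v" using openin_subset[OF G(1)] by (auto simp: near_def)
    then show "\<exists>G. openin X G \<and> x \<in> G \<and> G \<subseteq> near v" using G by blast
  qed
  have near_sat: "cstep `` near v \<subseteq> near v" for v
  proof
    fix x2 assume "x2 \<in> cstep `` near v"
    then obtain x i where x: "x \<in> near v" and i: "i \<in> I" "x \<in> U i" "x2 \<in> U i" "P i x = P i x2"
      by (auto simp: cstep_def)
    obtain G where G: "openin X G" "x \<in> G" "\<forall>w\<in>G. TH w \<longrightarrow> ce w v" using x by (auto simp: near_def)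
    define G2 where "G2 = {w \<in> U i. P i w \<in> P i ` (G \<inter> U i)}"
    have G2: "openin X G2" "x2 \<in> G2"
      using plaque_nbhd[OF i(1) G(1), of x x2] G(2) i by (auto simp: G2_def)
    have "ce w2 v" if w2: "w2 \<in> G2" "TH w2" for w2
    proof -
      obtain w where w: "w \<in> G" "w \<in> U i" "w2 \<in> U i" "P i w = P i w2" using w2(1) by (auto simp: G2_def)
      then have "(w, w2) \<in> cstep" using i(1) by (auto simp: cstep_def)
      then have s: "(w, w2) \<in> cstep\<^sup>*" by auto
      have "ce w v" using G(3) w(1) w2(2) TH_cong[OF s] by blast
      then show ?thesis using Orb_cong[OF s] by (simp add: ce_def)
    qed
    then show "x2 \<in> near v" unfolding near_def using G2 U_topspace[OF i(1,3)] by blast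
  qed
  have near_self: "v \<in> near v" if v: "v \<in> topspace X" "TH v" for v
  proof -
    obtain G where G: "openin X G" "v \<in> G" "\<forall>y\<in>G. \<forall>y'\<in>G. TH y \<longrightarrow> TH y' \<longrightarrow> ce y y'"
      using loc[OF v(1)] unfolding ce_def by blast
    then show ?thesis unfolding near_def using v by blast
  qed
  define B where "B = near y"
  \<comment> \<open>All coarse types different from that of \<open>y\<close> are put together, which
    leaves a splitting into two sets.\<close>
  define B' where "B' = (\<Union>v\<in>{v \<in> topspace X. TH v \<and> \<not> ce v y}. near v)"
  have "B = {} \<or> B' = {}"
  proof (rule conn)
    show "openin X B" unfolding B_def by (rule near_open)
    show "openin X B'" unfolding B'_def using near_open by (intro openin_Union) auto
    show "cstep `` B \<subseteq> B" unfolding B_def by (rule near_sat)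
    show "cstep `` B' \<subseteq> B'"
    proof
      fix z assume "z \<in> cstep `` B'"
      then obtain x v where "v \<in> topspace X" "TH v" "\<not> ce v y" "x \<in> near v" "(x, z) \<in> cstep" by (auto simp: B'_def)
      moreover have "z \<in> near v" using near_sat[of v] calculation by blast
      ultimately show "z \<in> B'" unfolding B'_def by blast
    qed
    show "B \<inter> B' = {}"
    proof (rule equals0I)
      fix x assume "x \<in> B \<inter> B'"
      then obtain v where v: "v \<in> topspace X" "TH v" "\<not> ce v y" "x \<in> near v" "x \<in> near y" by (auto simp: B_def B'_def)
      obtain G where G: "openin X G" "x \<in> G" "\<forall>w\<in>G. TH w \<longrightarrow> ce w v" using v(4) by (auto simp: near_def)
      obtain G' where G': "openin X G'" "x \<in> G'" "\<forall>w\<in>G'. TH w \<longrightarrow> ce w y" using v(5) by (auto simp: near_def)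
      obtain w where w: "w \<in> G \<inter> G'" "TH w" using dense[of "G \<inter> G'"] G G' by auto
      have "w \<in> topspace X" using w openin_subset[OF G(1)] by auto
      then have "ce v y" using trans[OF sym, of w v y] G(3) G'(3) w v(1) y(1) by blast
      then show False using v(3) by simp
    qed
    show "B \<union> B' = topspace X"
    proof
      show "B \<union> B' \<subseteq> topspace X" using near_sub by (auto simp: B_def B'_def)
      show "topspace X \<subseteq> B \<union> B'"
      proof
        fix x assume x: "x \<in> topspace X"
        obtain G where G: "openin X G" "x \<in> G" "\<forall>y\<in>G. \<forall>y'\<in>G. TH y \<longrightarrow> TH y' \<longrightarrow> ce y y'"
          using loc[OF x] unfolding ce_def by blast
        obtain w where w: "w \<in> G" "TH w" using dense[OF G(1)] G(2) by auto
        have GX: "G \<subseteq> topspace X" using openin_subset[OF G(1)] .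
        show "x \<in> B \<union> B'"
        proof (cases "ce w y")
          case True
          have "\<forall>w'\<in>G. TH w' \<longrightarrow> ce w' y"
          proof (intro ballI impI)
            fix w' assume w': "w' \<in> G" "TH w'"
            then have "ce w' w" using G(3) w by blast
            then show "ce w' y" using trans[OF _ True] w' w GX y(1) by blast
          qed
          then have "x \<in> near y" unfolding near_def using G(1,2) x by blast
          then show ?thesis by (simp add: B_def)
        next
          case False
          have "\<forall>w'\<in>G. TH w' \<longrightarrow> ce w' w" using G(3) w by blast
          then have "x \<in> near w" unfolding near_def using G(1,2) x by blast
          then show ?thesis using False w GX by (auto simp: B'_def)
        qed
      qed
    qed
  qed
  moreover have "y \<in> B" unfolding B_def by (rule near_self[OF y])
  ultimately have "B' = {}" by auto
  then have "ce y' y" using near_self[OF y'] y' by (auto simp: B'_def)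
  then show ?thesis using sym by (simp add: ce_def)
qed

end

section \<open>Identities between metrics, shrinkings and leaves of the given cocycles\<close>

lemma (in quasi_local_space) local_identity_equicont:
  fixes q :: "'a \<Rightarrow> 't set"
  assumes fin: "finite A" and m: "\<And>a. a \<in> A \<Longrightarrow> m a \<in> Q" and q: "\<And>a. a \<in> A \<Longrightarrow> closedin T (q a)" "\<And>a. a \<in> A \<Longrightarrow> q a \<subseteq> mspace (m a)"
    and \<delta>: "\<And>m m' z. m \<in> Q \<Longrightarrow> m' \<in> Q \<Longrightarrow> z \<in> mspace m \<Longrightarrow> z \<in> mspace m' \<Longrightarrow> \<exists>\<rho>>0. mball_of m z \<rho> \<subseteq> mspace m' \<and>
      (\<forall>\<epsilon>>0. \<forall>x\<in>mball_of m z \<rho>. \<forall>y\<in>mball_of m z \<rho>. mdist m x y < \<delta> \<epsilon> \<longrightarrow> mdist m' x y < \<epsilon>)"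
    and t: "t \<in> topspace T"
  shows "\<exists>G. openin T G \<and> t \<in> G \<and> (\<forall>a\<in>A. \<forall>b\<in>A. \<forall>x\<in>G. \<forall>y\<in>G. x \<in> q a \<inter> q b \<longrightarrow> y \<in> q a \<inter> q b \<longrightarrow>
     (\<forall>\<epsilon>>0. mdist (m a) x y < \<delta> \<epsilon> \<longrightarrow> mdist (m b) x y < \<epsilon>))"
proof -
  have "\<exists>G. openin T G \<and> t \<in> G \<and> (\<forall>x\<in>G. \<forall>y\<in>G. x \<in> q (fst p) \<inter> q (snd p) \<longrightarrow> y \<in> q (fst p) \<inter> q (snd p) \<longrightarrow>
     (\<forall>\<epsilon>>0. mdist (m (fst p)) x y < \<delta> \<epsilon> \<longrightarrow> mdist (m (snd p)) x y < \<epsilon>))" if p: "p \<in> A \<times> A" for p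
  proof -
    obtain a b where ab: "p = (a, b)" "a \<in> A" "b \<in> A" using p by auto
    show ?thesis
    \<comment> \<open>If \<open>t\<close> lies in both sets, a ball around it on which the two
      metrics are comparable will do. Otherwise the complement of the closed set
      \<open>q a \<inter> q b\<close> is a neighbourhood of \<open>t\<close> on which the condition
      is void. In both cases the modulus is the given \<open>\<delta>\<close>.\<close>
    proof (cases "t \<in> q a \<inter> q b")
      case True
      then have "t \<in> mspace (m a)" "t \<in> mspace (m b)" using q(2) ab by auto
      from \<delta>[OF m[OF ab(2)] m[OF ab(3)] this] obtain \<rho> where \<rho>: "\<rho> > 0"
        "\<forall>\<epsilon>>0. \<forall>x\<in>mball_of (m a) t \<rho>. \<forall>y\<in>mball_of (m a) t \<rho>. mdist (m a) x y < \<delta> \<epsilon> \<longrightarrow> mdist (m b) x y < \<epsilon>"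
        by (elim exE conjE)
      have "t \<in> mball_of (m a) t \<rho>" using centre_in_mball_of \<rho>(1) \<open>t \<in> mspace (m a)\<close> by metis
      then show ?thesis using \<rho>(2) mball_open[OF m[OF ab(2)], of t \<rho>] ab(1)
        by (intro exI[of _ "mball_of (m a) t \<rho>"]) simp
    next
      case False
      have "openin T (topspace T - q a \<inter> q b)" using q(1) ab by (intro openin_diff openin_topspace closedin_Int) auto
      then show ?thesis using False t ab(1) by (intro exI[of _ "topspace T - q a \<inter> q b"]) auto
    qed
  qed
  then have "\<forall>p\<in>A \<times> A. \<exists>G. openin T G \<and> t \<in> G \<and> (\<forall>x\<in>G. \<forall>y\<in>G. x \<in> q (fst p) \<inter> q (snd p) \<longrightarrow> y \<in> q (fst p) \<inter> q (snd p) \<longrightarrow>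
     (\<forall>\<epsilon>>0. mdist (m (fst p)) x y < \<delta> \<epsilon> \<longrightarrow> mdist (m (snd p)) x y < \<epsilon>))" by blast
  from bchoice[OF this] obtain G where G: "\<forall>p\<in>A \<times> A. openin T (G p) \<and> t \<in> G p \<and> (\<forall>x\<in>G p. \<forall>y\<in>G p. x \<in> q (fst p) \<inter> q (snd p) \<longrightarrow> y \<in> q (fst p) \<inter> q (snd p) \<longrightarrow>
     (\<forall>\<epsilon>>0. mdist (m (fst p)) x y < \<delta> \<epsilon> \<longrightarrow> mdist (m (snd p)) x y < \<epsilon>))" by (elim exE)
  define B where "B = \<Inter>(insert (topspace T) (G ` (A \<times> A)))"
  have "openin T B" unfolding B_def using fin G by (intro openin_Inter) auto
  moreover have "t \<in> B" using t G by (auto simp: B_def)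
  moreover have c: "mdist (m b) x y < \<epsilon>" if x: "a \<in> A" "b \<in> A" "x \<in> B" "y \<in> B" "x \<in> q a \<inter> q b" "y \<in> q a \<inter> q b" "\<epsilon> > 0" "mdist (m a) x y < \<delta> \<epsilon>"
    for a b x y \<epsilon>
  proof -
    have ab: "(a, b) \<in> A \<times> A" "x \<in> G (a, b)" "y \<in> G (a, b)" using x by (auto simp: B_def)
    from bspec[OF G ab(1)] show ?thesis using ab x by simp
  qed
  ultimately show ?thesis by (intro exI[of _ B] conjI ballI allI impI) (assumption | rule c)+
qed

lemma locally_equiv_restrict:
  assumes "locally_equiv X D p D' p'" "openin X V" "V \<subseteq> D'"
  shows "locally_equiv X D p V p'"
  unfolding locally_equiv_def
proof
  fix x assume x: "x \<in> D \<inter> V"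
  then have "x \<in> D \<inter> D'" using assms(3) by auto
  from bspec[OF assms(1)[unfolded locally_equiv_def] this] obtain G where
    "openin X G" "x \<in> G" "G \<subseteq> D \<inter> D'" "\<forall>u\<in>G. \<forall>v\<in>G. p u = p v \<longleftrightarrow> p' u = p' v" by (elim exE conjE)
  then show "\<exists>G. openin X G \<and> x \<in> G \<and> G \<subseteq> D \<inter> V \<and> (\<forall>u\<in>G. \<forall>v\<in>G. p u = p v \<longleftrightarrow> p' u = p' v)"
    using x assms(2) by (intro exI[of _ "G \<inter> V"]) auto
qed

lemma Hausdorff_space_transversal:
  assumes "defining_cocycle n k X \<A> C" shows "Hausdorff_space (transversal C)"
  unfolding transversal_def
proof (rule Hausdorff_space_sum_topology)
  fix i assume "i \<in> idx C"
  then have "polish (ctrans C i)" using defining_cocycle_flow_box[OF assms] by (auto simp: is_flow_box_def)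
  then show "Hausdorff_space (ctrans C i)"
    unfolding polish_def using completely_metrizable_imp_metrizable_space metrizable_imp_Hausdorff_space by blast
qed

text \<open>Inside the open set \<open>cdom C i\<close> alone, the number of small charts needed
  could grow towards the boundary. The closure is compact and lies in \<open>cdom C' i\<close>,
  where the projections agree, so the chains are run in the larger plaques of
  \<open>C'\<close>.\<close>

lemma shrinking_chain_bound:
  fixes C C' :: "('x, 'w, 'i) cocycle" and V :: "'a \<Rightarrow> 'x set"
  assumes dc: "defining_cocycle n k X \<A> C" "defining_cocycle n k X \<A> C'" "shrinking X C C'"
    and cpt: "compact_space X" and fin: "finite (idx C)"
    and V: "\<And>a. a \<in> A \<Longrightarrow> openin X (V a)" "topspace X \<subseteq> (\<Union>a\<in>A. V a)"
    and equiv: "\<And>a i. a \<in> A \<Longrightarrow> i \<in> idx C' \<Longrightarrow> locally_equiv X (cdom C' i) (cpt C' i) (V a) (q a)"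
  shows "\<exists>c. transverse_cocycle.cstep (idx C) (cdom C) (cpt C) \<subseteq> {(x, y). \<exists>a\<in>A. x \<in> V a \<and> y \<in> V a \<and> q a x = q a y} ^^ c"
proof -
  interpret C: transverse_cocycle X "idx C" "cdom C" "cpt C" "transversal C" "hol_map C"
    using defining_cocycle_transverse[OF dc(1)] .
  interpret C': transverse_cocycle X "idx C'" "cdom C'" "cpt C'" "transversal C'" "hol_map C'"
    using defining_cocycle_transverse[OF dc(2)] .
  define s where "s = {(x, y). \<exists>a\<in>A. x \<in> V a \<and> y \<in> V a \<and> q a x = q a y}"
  have sh: "idx C = idx C'" "\<And>i. i \<in> idx C \<Longrightarrow> X closure_of cdom C i \<subseteq> cdom C' i"
    "\<And>i u. i \<in> idx C \<Longrightarrow> u \<in> cdom C i \<Longrightarrow> cproj C i u = cproj C' i u"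
    using dc(3) by (auto simp: shrinking_def)
  have "\<forall>i\<in>idx C. \<exists>k. \<forall>x\<in>X closure_of cdom C i. \<forall>y\<in>X closure_of cdom C i. cpt C' i x = cpt C' i y \<longrightarrow> (x, y) \<in> s ^^ k"
  proof
    fix i assume i: "i \<in> idx C"
    have "compactin X (X closure_of cdom C i)" by (intro closedin_compact_space cpt closedin_closure_of)
    then show "\<exists>k. \<forall>x\<in>X closure_of cdom C i. \<forall>y\<in>X closure_of cdom C i. cpt C' i x = cpt C' i y \<longrightarrow> (x, y) \<in> s ^^ k"
      using C'.compact_chain_bound[OF V equiv s_def Hausdorff_space_transversal[OF dc(2)], of i "X closure_of cdom C i"] i sh(1) sh(2)[OF i]
      by auto
  qed
  from bchoice[OF this] obtain k where k: "\<forall>i\<in>idx C. \<forall>x\<in>X closure_of cdom C i. \<forall>y\<in>X closure_of cdom C i. cpt C' i x = cpt C' i y \<longrightarrow> (x, y) \<in> s ^^ k i"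
    by (elim exE)
  define c where "c = Max (insert 0 (k ` idx C))"
  have refl: "(x, x) \<in> s" if "x \<in> topspace X" for x using that V(2) s_def by auto
  have closed: "s `` topspace X \<subseteq> topspace X" using V(1) openin_subset s_def by blast
  have "(x, y) \<in> s ^^ c" if xy: "(x, y) \<in> C.cstep" for x y
  proof -
    obtain i where i: "i \<in> idx C" "x \<in> cdom C i" "y \<in> cdom C i" "cpt C i x = cpt C i y" using xy by (auto simp: C.cstep_def)
    have "cpt C' i x = cpt C' i y" using i sh(3)[OF i(1)] by (simp add: cpt_def)
    moreover have "cdom C i \<subseteq> X closure_of cdom C i" using closure_of_subset[OF openin_subset[OF C.U_open[OF i(1)]]] .
    ultimately have "(x, y) \<in> s ^^ k i" using k[rule_format, OF i(1), of x y] i by auto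
    moreover have "k i \<le> c" unfolding c_def using fin i(1) by (intro Max_ge) auto
    moreover have "x \<in> topspace X" using C.cstep_topspace[OF xy] by simp
    ultimately show ?thesis using relpow_refl_mono[of "topspace X" s, OF refl closed] by simp
  qed
  then have "C.cstep \<subseteq> s ^^ c" by (rule subrelI)
  then show ?thesis unfolding s_def by (rule exI)
qed

lemma leaf_topology_topspace:
  assumes "foliated_atlas n k X \<A>" shows "topspace X \<subseteq> topspace (leaf_topology X \<A>)"
proof
  fix x assume x: "x \<in> topspace X"
  then have "x \<in> (\<Union>b\<in>\<A>. fb_dom b)" using assms by (simp add: foliated_atlas_def)
  then obtain b where b: "b \<in> \<A>" "x \<in> fb_dom b" by blast
  then have fb: "is_flow_box n X b" using assms by (auto simp: foliated_atlas_def)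
  have z: "fb_proj b x \<in> topspace (fb_trans b)" using fb_proj_image[OF fb] b by auto
  have "openin (subtopology X (plaque b (fb_proj b x))) (topspace X \<inter> plaque b (fb_proj b x))"
    by (simp add: openin_subtopology_Int)
  then show "x \<in> topspace (leaf_topology X \<A>)"
    unfolding leaf_topology_def topology_generated_by_topspace using b z x by (auto simp: plaque_def)
qed

text \<open>A leaf lies in one chain class, so sets closed under \<open>cstep\<close> are unions of
  leaves. Their images are therefore open in the quotient, and disjoint ones have disjoint
  images.\<close>

lemma leaf_space_no_saturated_splitting:
  assumes fs: "foliated_atlas n k X \<A>" and dc: "defining_cocycle n k X \<A> C" and conn: "connected_space (leaf_space X \<A>)"
    and B: "openin X B" "openin X B'" "B \<union> B' = topspace X" "B \<inter> B' = {}"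
    and sat: "transverse_cocycle.cstep (idx C) (cdom C) (cpt C) `` B \<subseteq> B" "transverse_cocycle.cstep (idx C) (cdom C) (cpt C) `` B' \<subseteq> B'"
  shows "B = {} \<or> B' = {}"
proof (rule ccontr)
  assume ne: "\<not> (B = {} \<or> B' = {})"
  interpret C: transverse_cocycle X "idx C" "cdom C" "cpt C" "transversal C" "hol_map C"
    using defining_cocycle_transverse[OF dc] .
  define q where "q = connected_component_of_set (leaf_topology X \<A>)"
  have in_q: "x \<in> q x" if "x \<in> topspace X" for x
    using that leaf_topology_topspace[OF fs] by (auto simp: q_def connected_component_of_refl)
  have q_sat: "x \<in> S" if S: "C.cstep `` S \<subseteq> S" "b \<in> S" "q x = q b" "x \<in> topspace X" for x b S
  proof -
    have "x \<in> q b" using in_q[OF S(4)] S(3) by simp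
    then have "(b, x) \<in> C.cstep\<^sup>*" using leaf_cstep[OF fs dc] by (simp add: q_def)
    then show ?thesis by (induction rule: rtrancl_induct) (use S(1,2) in auto)
  qed
  have open_q: "openin (leaf_space X \<A>) (q ` S)" if S: "openin X S" "C.cstep `` S \<subseteq> S" for S
  proof -
    have "S \<subseteq> topspace X" using S(1) openin_subset by blast
    then have "{x \<in> topspace X. q x \<in> q ` S} = S" using q_sat[OF S(2)] by auto
    then show ?thesis unfolding leaf_space_def q_def[symmetric] openin_quotient_topology
      using S(1) \<open>S \<subseteq> topspace X\<close> by auto
  qed
  have BX: "B \<subseteq> topspace X" "B' \<subseteq> topspace X" using B(3) by auto
  have "q ` B \<inter> q ` B' = {}"
  proof (rule equals0I)
    fix l assume "l \<in> q ` B \<inter> q ` B'"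
    then obtain b b' where "b \<in> B" "b' \<in> B'" "q b' = q b" by auto
    then show False using q_sat[OF sat(1), of b b'] BX B(4) by blast
  qed
  moreover have "q ` B \<noteq> {}" "q ` B' \<noteq> {}" using ne by auto
  moreover have "topspace (leaf_space X \<A>) \<subseteq> q ` B \<union> q ` B'"
  proof -
    have "openin (leaf_space X \<A>) (topspace (leaf_space X \<A>))" by simp
    then have "topspace (leaf_space X \<A>) \<subseteq> q ` topspace X"
      unfolding leaf_space_def q_def[symmetric] openin_quotient_topology by blast
    then show ?thesis using B(3) by blast
  qed
  ultimately show False
    using conn open_q[OF B(1) sat(1)] open_q[OF B(2) sat(2)] unfolding connected_space_def by metis
qed

text \<open>All points of a leaf are joined by chains, so the orbits united in
  \<open>leaf_orbit\<close> coincide whatever point and chart they start from.\<close>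

lemma leaf_orbit_eq_Orb:
  assumes fs: "foliated_atlas n k X \<A>" and dc: "defining_cocycle n k X \<A> C" and L: "L \<in> leaves X \<A>"
  shows "\<exists>y\<in>topspace X. leaf_orbit C L = transverse_cocycle.Orb (idx C) (cdom C) (cpt C) y"
proof -
  interpret C: transverse_cocycle X "idx C" "cdom C" "cpt C" "transversal C" "hol_map C"
    using defining_cocycle_transverse[OF dc] .
  have gens: "hol_gens C = C.E" by (simp add: hol_gens_def C.E_def)
  obtain y where y: "y \<in> topspace (leaf_topology X \<A>)" "L = connected_component_of_set (leaf_topology X \<A>) y"
    using L unfolding leaves_def connected_components_of_def by auto
  have "topspace (leaf_topology X \<A>) \<subseteq> topspace X"
  proof -
    have "P \<subseteq> topspace X" if "openin (subtopology X S) P" for P S using openin_subset[OF that] by auto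
    then show ?thesis unfolding leaf_topology_def topology_generated_by_topspace by blast
  qed
  then have yX: "y \<in> topspace X" using y(1) by auto
  have orbit: "pg_orbit (holonomy C) (i, cproj C i x) = C.Orb y" if "x \<in> L" "i \<in> idx C" "x \<in> cdom C i" for i x
  proof -
    have s: "(y, x) \<in> C.cstep\<^sup>*" using leaf_cstep[OF fs dc] that(1) y(2) by simp
    have "(i, cproj C i x) = cpt C i x" by (simp add: cpt_def)
    moreover have "pg_orbit C.H (cpt C i x) = C.Orb x"
      using pg_orbit_eq[OF C.E_poe C.E_inv C.P_topspace[OF that(2,3)]] C.Orb_eq[OF that(2,3)] by simp
    ultimately show ?thesis using C.Orb_cong[OF s] by (simp add: holonomy_def gens)
  qed
  have "leaf_orbit C L \<subseteq> C.Orb y" unfolding leaf_orbit_def using orbit by blast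
  moreover have "C.Orb y \<subseteq> leaf_orbit C L"
  proof -
    obtain i where i: "i \<in> idx C" "y \<in> cdom C i" using yX C.U_cover by auto
    have "y \<in> L" using y by (simp add: connected_component_of_refl)
    then show ?thesis unfolding leaf_orbit_def using orbit[OF _ i] i by blast
  qed
  ultimately show ?thesis using yX by blast
qed

text \<open>A small chart has to lie in one chart of \<open>C\<close>, with its plaques inside
  plaques of \<open>C\<close>, so that small steps are steps of \<open>C\<close>; and its projection
  has to lie in a single metric space of the family.\<close>

lemma chart_nbhds:
  assumes pair: "transverse_cocycle_pair X I U P Z hm J D Q T hr" and ql: "quasi_local_space T \<QQ> MM"
    and x: "x \<in> topspace X"
  shows "\<exists>M \<alpha> i m. openin X M \<and> x \<in> M \<and> \<alpha> \<in> J \<and> i \<in> I \<and> m \<in> MM \<and> M \<subseteq> D \<alpha> \<and> M \<subseteq> U i \<and>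
    Q \<alpha> ` M \<subseteq> mspace m \<and> (\<forall>u\<in>M. \<forall>v\<in>M. Q \<alpha> u = Q \<alpha> v \<longrightarrow> P i u = P i v)"
proof -
  interpret transverse_cocycle_pair X I U P Z hm J D Q T hr by (rule pair)
  interpret quasi_local_space T \<QQ> MM by (rule ql)
  obtain \<alpha> where \<alpha>: "\<alpha> \<in> J" "x \<in> D \<alpha>" using x R.U_cover by auto
  obtain i where i: "i \<in> I" "x \<in> U i" using x C.U_cover by auto
  obtain m where m: "m \<in> MM" "Q \<alpha> x \<in> mspace m" using R.P_topspace[OF \<alpha>] topspace_eq by auto
  have "x \<in> U i \<inter> D \<alpha>" using i \<alpha> by simp
  from bspec[OF compat[OF i(1) \<alpha>(1), unfolded locally_equiv_def] this] obtain G where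
    G: "openin X G" "x \<in> G" "G \<subseteq> U i \<inter> D \<alpha>" "\<forall>u\<in>G. \<forall>v\<in>G. P i u = P i v \<longleftrightarrow> Q \<alpha> u = Q \<alpha> v" by (elim exE conjE)
  define M where "M = G \<inter> {u \<in> D \<alpha>. Q \<alpha> u \<in> mspace m}"
  have "openin X M" unfolding M_def using G(1) R.P_cont[OF \<alpha>(1) mspace_open[OF m(1)]] by auto
  moreover have "x \<in> M" using G(2) \<alpha>(2) m(2) by (auto simp: M_def)
  moreover have "M \<subseteq> D \<alpha>" "M \<subseteq> U i" "Q \<alpha> ` M \<subseteq> mspace m" using G(3) by (auto simp: M_def)
  moreover have "\<forall>u\<in>M. \<forall>v\<in>M. Q \<alpha> u = Q \<alpha> v \<longrightarrow> P i u = P i v" using G(4) by (auto simp: M_def)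
  ultimately show ?thesis using \<alpha>(1) i(1) m(1) by (intro exI conjI)
qed

lemma locally_coarse_equiv_orbits:
  fixes R :: "('x, 'y, 'j) cocycle" and C C' :: "('x, 'w, 'i) cocycle"
  assumes fs: "foliated_space n k X \<F>" and cpt: "compact_space X"
    and dR: "defining_cocycle n k X \<F> R" and dC: "defining_cocycle n k X \<F> C" and dC': "defining_cocycle n k X \<F> C'"
    and fin: "finite (idx C)" and sh: "shrinking X C C'"
    and se: "strongly_equicontinuous (transversal R) (holonomy R)"
    and qe: "quasi_effective (transversal R) (holonomy R)"
    and x0: "x0 \<in> topspace X"
  shows "\<exists>G. openin X G \<and> x0 \<in> G \<and>
    (\<forall>y\<in>G. \<forall>y'\<in>G. transverse_cocycle.TH (idx C) (cdom C) (cpt C) (transversal C) (hol_map C) y \<longrightarrow>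
       transverse_cocycle.TH (idx C) (cdom C) (cpt C) (transversal C) (hol_map C) y' \<longrightarrow>
     coarse_equiv (transverse_cocycle.Orb (idx C) (cdom C) (cpt C) y) (map_step (hol_gens C))
       (transverse_cocycle.Orb (idx C) (cdom C) (cpt C) y') (map_step (hol_gens C)))"
proof -
  let ?T = "transversal R"
  have cov: "(\<Union>b\<in>\<F>. fb_dom b) = topspace X" using fs by (auto simp: foliated_space_def foliated_atlas_def)
  have reg: "regular_space X"
    using fs unfolding foliated_space_def polish_def
    using completely_metrizable_imp_metrizable_space metrizable_imp_regular_space by blast
  interpret C: transverse_cocycle X "idx C" "cdom C" "cpt C" "transversal C" "hol_map C"
    using defining_cocycle_transverse[OF dC] .
  interpret R: transverse_cocycle X "idx R" "cdom R" "cpt R" "transversal R" "hol_map R"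
    using defining_cocycle_transverse[OF dR] .
  interpret CR: transverse_cocycle_pair X "idx C" "cdom C" "cpt C" "transversal C" "hol_map C"
     "idx R" "cdom R" "cpt R" "transversal R" "hol_map R"
    by unfold_locales (rule cocycles_locally_equiv[OF dC dR cov])
  have CE: "hol_gens C = C.E" by (simp add: hol_gens_def C.E_def)
  have RH: "holonomy R = R.H" by (simp add: holonomy_def hol_gens_def R.E_def)
  obtain \<QQ> MM S1 where qlm: "quasi_local_metric (topspace ?T) \<QQ>" "quasi_local_topology \<QQ> = ?T" "MM \<in> \<QQ>"
    and S1: "S1 \<subseteq> holonomy R" "symmetric_maps S1" "comp_closed S1" "generated_pseudogroup ?T S1 = holonomy R"
    and S1_eq: "\<forall>\<epsilon>>0. \<exists>\<delta>>0. \<forall>h\<in>S1. \<forall>m\<in>MM. \<forall>m'\<in>MM. \<forall>x y x' y'.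
             x \<in> mspace m \<and> y \<in> mspace m \<and> h x = Some x' \<and> h y = Some y' \<and>
             x' \<in> mspace m' \<and> y' \<in> mspace m' \<and> mdist m x y < \<delta> \<longrightarrow> mdist m' x' y' < \<epsilon>"
    using se unfolding strongly_equicontinuous_def by (elim exE bexE conjE)
  obtain S2 where S2: "S2 \<subseteq> holonomy R" "symmetric_maps S2" "comp_closed S2" "generated_pseudogroup ?T S2 = holonomy R"
    and S2_eff: "\<forall>h\<in>S2. (\<exists>V. openin ?T V \<and> V \<noteq> {} \<and> V \<subseteq> dom h \<and> (\<forall>x\<in>V. h x = Some x)) \<longrightarrow>
               (\<forall>x \<in> dom h. h x = Some x)"
    using qe unfolding quasi_effective_def by (elim exE conjE)
  interpret L: quasi_local_space ?T \<QQ> MM by unfold_locales (fact qlm)+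
  obtain \<delta> :: "real \<Rightarrow> real" where \<delta>: "\<And>\<epsilon>. \<epsilon> > 0 \<Longrightarrow> \<delta> \<epsilon> > 0"
    and loc: "\<And>m m' z. m \<in> MM \<Longrightarrow> m' \<in> MM \<Longrightarrow> z \<in> mspace m \<Longrightarrow> z \<in> mspace m' \<Longrightarrow> \<exists>\<rho>>0. mball_of m z \<rho> \<subseteq> mspace m' \<and>
      (\<forall>\<epsilon>>0. \<forall>x\<in>mball_of m z \<rho>. \<forall>y\<in>mball_of m z \<rho>. mdist m x y < \<delta> \<epsilon> \<longrightarrow> mdist m' x y < \<epsilon>)"
    using quasi_local_cover_nbhd[OF L.cover] by blast
  define good where "good x M \<alpha> i m \<longleftrightarrow> openin X M \<and> x \<in> M \<and> \<alpha> \<in> idx R \<and> i \<in> idx C \<and> m \<in> MM \<and> M \<subseteq> cdom R \<alpha> \<and> M \<subseteq> cdom C i \<and>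
    cpt R \<alpha> ` M \<subseteq> mspace m \<and> (\<forall>u\<in>M. \<forall>v\<in>M. cpt R \<alpha> u = cpt R \<alpha> v \<longrightarrow> cpt C i u = cpt C i v)" for x M \<alpha> i m
  have "\<forall>x\<in>topspace X. \<exists>M \<alpha> i m. good x M \<alpha> i m"
    unfolding good_def using chart_nbhds[OF CR.transverse_cocycle_pair_axioms L.quasi_local_space_axioms] by blast
  then obtain M \<alpha> i m where good: "\<And>x. x \<in> topspace X \<Longrightarrow> good x (M x) (\<alpha> x) (i x) (m x)" by metis
  have M: "\<forall>x\<in>topspace X. openin X (M x) \<and> x \<in> M x"
    using good unfolding good_def by simp
  obtain A N V W where fA: "finite A" "A \<subseteq> topspace X" and W_cover: "topspace X \<subseteq> (\<Union>a\<in>A. W a)"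
    and nested: "\<forall>a\<in>A. openin X (N a) \<and> openin X (V a) \<and> openin X (W a) \<and>
       X closure_of N a \<subseteq> M a \<and> X closure_of V a \<subseteq> N a \<and> X closure_of W a \<subseteq> V a"
    using nested_finite_cover[OF cpt reg M] by (elim exE conjE)
  have A: "openin X (N a)" "openin X (V a)" "openin X (W a)"
    "X closure_of N a \<subseteq> M a" "X closure_of V a \<subseteq> N a" "X closure_of W a \<subseteq> V a" if "a \<in> A" for a
    using bspec[OF nested that] by simp_all
  define q where "q a = cpt R (\<alpha> a)" for a
  have cl: "G \<subseteq> X closure_of G" if "openin X G" for G using closure_of_subset[OF openin_subset[OF that]] .
  have NM: "N a \<subseteq> M a" "V a \<subseteq> N a" "W a \<subseteq> V a" if a: "a \<in> A" for a
    using cl[OF A(1)[OF a]] cl[OF A(2)[OF a]] cl[OF A(3)[OF a]] A(4-6)[OF a] by auto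
  have gA: "\<alpha> a \<in> idx R" "i a \<in> idx C" "m a \<in> MM" "M a \<subseteq> cdom R (\<alpha> a)" "M a \<subseteq> cdom C (i a)" "q a ` M a \<subseteq> mspace (m a)"
    and qP: "\<forall>u\<in>M a. \<forall>v\<in>M a. q a u = q a v \<longrightarrow> cpt C (i a) u = cpt C (i a) v" if "a \<in> A" for a
  proof -
    have "good a (M a) (\<alpha> a) (i a) (m a)" using good fA(2) that by blast
    note g = this[unfolded good_def, folded q_def]
    show "\<alpha> a \<in> idx R" "i a \<in> idx C" "m a \<in> MM" "M a \<subseteq> cdom R (\<alpha> a)" "M a \<subseteq> cdom C (i a)" "q a ` M a \<subseteq> mspace (m a)"
      "\<forall>u\<in>M a. \<forall>v\<in>M a. q a u = q a v \<longrightarrow> cpt C (i a) u = cpt C (i a) v"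
      using g by blast+
  qed
  have V_cover: "topspace X \<subseteq> (\<Union>a\<in>A. V a)" using W_cover NM(3) by blast
  have equiv: "locally_equiv X (cdom C' l) (cpt C' l) (V a) (q a)" if "a \<in> A" "l \<in> idx C'" for a l
    unfolding q_def using cocycles_locally_equiv[OF dC' dR cov that(2) gA(1)[OF that(1)]]
    by (rule locally_equiv_restrict[OF _ A(2)[OF that(1)]]) (use NM gA(4) that(1) in blast)
  obtain c where c: "C.cstep \<subseteq> {(x, y). \<exists>a\<in>A. x \<in> V a \<and> y \<in> V a \<and> q a x = q a y} ^^ c"
    using shrinking_chain_bound[OF dC dC' sh cpt fin A(2) V_cover equiv] by blast
  \<comment> \<open>Images of the closures are compact, hence closed in the Hausdorff transversal,
    whereas the image of \<open>N a\<close> is open. Closedness is what allows a point outside to be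
    separated from them.\<close>
  define K where "K a = q a ` (X closure_of N a)" for a
  have K: "closedin ?T (K a)" "K a \<subseteq> mspace (m a)" if a: "a \<in> A" for a
  proof -
    have "compactin X (X closure_of N a)" by (intro closedin_compact_space cpt closedin_closure_of)
    moreover have "X closure_of N a \<subseteq> cdom R (\<alpha> a)" using A(4)[OF a] gA(4)[OF a] by auto
    ultimately have "compactin ?T (K a)" unfolding K_def q_def by (rule R.P_compact[OF gA(1)[OF a]])
    then show "closedin ?T (K a)" by (rule compactin_imp_closedin[OF Hausdorff_space_transversal[OF dR]])
    show "K a \<subseteq> mspace (m a)" using A(4)[OF a] gA(6)[OF a] unfolding K_def by blast
  qed
  have NK: "q a ` N a \<subseteq> K a" if "a \<in> A" for a unfolding K_def using cl[OF A(1)[OF that]] by auto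
  \<comment> \<open>Smallness of a set means that on it the identity is equicontinuous between any
    two of the finitely many chosen metrics, with the common modulus \<open>\<delta>\<close>; every
    point has a neighbourhood of this kind.\<close>
  define small where "small B \<longleftrightarrow> (\<forall>a\<in>A. \<forall>b\<in>A. \<forall>x\<in>B. \<forall>y\<in>B. x \<in> K a \<inter> K b \<longrightarrow> y \<in> K a \<inter> K b \<longrightarrow>
     (\<forall>\<epsilon>>0. mdist (m a) x y < \<delta> \<epsilon> \<longrightarrow> mdist (m b) x y < \<epsilon>))" for B
  interpret F: small_chart_family X "idx C" "cdom C" "cpt C" "transversal C" "hol_map C"
     "idx R" "cdom R" "cpt R" ?T "hol_map R" \<QQ> MM S1 S2 A N V W q \<alpha> m small c
  proof
    show "S1 \<subseteq> R.H" "symmetric_maps S1" "comp_closed S1" "generated_pseudogroup ?T S1 = R.H" using S1 RH by auto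
    show "S2 \<subseteq> R.H" "symmetric_maps S2" "comp_closed S2" "generated_pseudogroup ?T S2 = R.H" using S2 RH by auto
    show "\<exists>\<delta>>0. \<forall>h\<in>S1. \<forall>m\<in>MM. \<forall>m'\<in>MM. \<forall>x y x' y'.
             x \<in> mspace m \<and> y \<in> mspace m \<and> h x = Some x' \<and> h y = Some y' \<and>
             x' \<in> mspace m' \<and> y' \<in> mspace m' \<and> mdist m x y < \<delta> \<longrightarrow> mdist m' x' y' < \<epsilon>" if "\<epsilon> > 0" for \<epsilon> :: real
      using S1_eq[rule_format, OF that] .
    show "\<forall>x\<in>dom h. h x = Some x" if "h \<in> S2" "openin ?T B" "B \<noteq> {}" "B \<subseteq> dom h" "\<forall>x\<in>B. h x = Some x" for h B
      using bspec[OF S2_eff that(1)] that(2-) by blast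
    show "small B'" if "small B" "B' \<subseteq> B" for B B' using that unfolding small_def by blast
    show "\<exists>B. openin ?T B \<and> t \<in> B \<and> small B" if "t \<in> topspace ?T" for t
      unfolding small_def by (rule L.local_identity_equicont[OF fA(1) gA(3) K loc that])
    show "\<exists>\<delta>>0. \<forall>B a b x y. small B \<longrightarrow> a \<in> A \<longrightarrow> b \<in> A \<longrightarrow> x \<in> B \<longrightarrow> y \<in> B \<longrightarrow>
        x \<in> q a ` N a \<inter> q b ` N b \<longrightarrow> y \<in> q a ` N a \<inter> q b ` N b \<longrightarrow> mdist (m a) x y < \<delta> \<longrightarrow> mdist (m b) x y < \<epsilon>"
      if e: "\<epsilon> > 0" for \<epsilon> :: real
    proof (intro exI[of _ "\<delta> \<epsilon>"] conjI allI impI)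
      fix B a b x y assume a: "small B" "a \<in> A" "b \<in> A" "x \<in> B" "y \<in> B" "x \<in> q a ` N a \<inter> q b ` N b" "y \<in> q a ` N a \<inter> q b ` N b"
        and d: "mdist (m a) x y < \<delta> \<epsilon>"
      have "x \<in> K a \<inter> K b" "y \<in> K a \<inter> K b" using a(6,7) NK[OF a(2)] NK[OF a(3)] by auto
      then show "mdist (m b) x y < \<epsilon>" using a(1)[unfolded small_def, rule_format, OF a(2-5) _ _ e d] by blast
    qed (rule \<delta>[OF e])
    show "(x, y) \<in> C.cstep" if "a \<in> A" "x \<in> N a" "y \<in> N a" "q a x = q a y" for a x y
    proof -
      have M: "x \<in> M a" "y \<in> M a" using NM(1)[OF that(1)] that(2,3) by auto
      then have "cpt C (i a) x = cpt C (i a) y" using qP[OF that(1)] that(4) by blast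
      then show ?thesis using M gA(2,5)[OF that(1)] unfolding C.cstep_def by blast
    qed
    show "q a ` N a \<subseteq> mspace (m a)" if "a \<in> A" for a using NK[OF that] K(2)[OF that] by auto
    show "N a \<subseteq> cdom R (\<alpha> a)" if "a \<in> A" for a using NM(1)[OF that] gA(4)[OF that] by auto
  qed (fact cpt fA(1) W_cover A gA(1,3) c | simp only: q_def)+
  show ?thesis unfolding CE using F.locally_coarse_equiv_Orb[OF x0] .
qed

theorem theorem17p1:
  fixes n :: nat and k :: enat
    and X :: "'x topology" and \<F> :: "('x, 'z) flow_box set"
    and R :: "('x, 'y, 'j) cocycle"
    and C C' :: "('x, 'w, 'i) cocycle"
    and L L' :: "'x set"
  assumes "foliated_space n k X \<F>"
    and "compact_space X"
    and "defining_cocycle n k X \<F> R"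
    and "strongly_equicontinuous (transversal R) (holonomy R)"
    and "quasi_effective (transversal R) (holonomy R)"
    and "connected_space (leaf_space X \<F>)"
    and "defining_cocycle n k X \<F> C"
    and "finite (idx C)"
    and "defining_cocycle n k X \<F> C'"
    and "shrinking X C C'"
    and "L \<in> leaves X \<F>" and "trivial_holonomy_group C L"
    and "L' \<in> leaves X \<F>" and "trivial_holonomy_group C L'"
  shows "same_coarse_qi_type (leaf_orbit C L) (orbit_dist C) (leaf_orbit C L') (orbit_dist C)"
proof -
  interpret C: transverse_cocycle X "idx C" "cdom C" "cpt C" "transversal C" "hol_map C"
    using defining_cocycle_transverse[OF assms(7)] .
  have CE: "hol_gens C = C.E" by (simp add: hol_gens_def C.E_def)
  have fa: "foliated_atlas n k X \<F>" and cm: "completely_metrizable_space X"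
    using assms(1) by (auto simp: foliated_space_def polish_def)
  have leaf: "\<exists>y\<in>topspace X. leaf_orbit C L = C.Orb y \<and> C.TH y" if L: "L \<in> leaves X \<F>" "trivial_holonomy_group C L" for L
  proof -
    obtain y where y: "y \<in> topspace X" "leaf_orbit C L = C.Orb y"
      using leaf_orbit_eq_Orb[OF fa assms(7) L(1)] by blast
    obtain p where p: "p \<in> C.Orb y" "trivial_group (germ_group (transversal C) C.H p)"
      using L(2) unfolding trivial_holonomy_group_def y(2) holonomy_def CE by blast
    then have "C.TH y" unfolding C.TH_def using trivial_group_imp_trivial_germs[OF p(2) C.H_poe] by blast
    then show ?thesis using y by blast
  qed
  obtain y where y: "y \<in> topspace X" "leaf_orbit C L = C.Orb y" "C.TH y" using leaf[OF assms(11,12)] by blast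
  obtain y' where y': "y' \<in> topspace X" "leaf_orbit C L' = C.Orb y'" "C.TH y'" using leaf[OF assms(13,14)] by blast
  have "coarse_equiv (C.Orb y) (map_step C.E) (C.Orb y') (map_step C.E)"
  proof (rule C.all_TH_coarse_equiv[OF _ _ _ y(1,3) y'(1,3)])
    show "\<exists>G. openin X G \<and> x \<in> G \<and> (\<forall>y\<in>G. \<forall>y'\<in>G. C.TH y \<longrightarrow> C.TH y' \<longrightarrow>
       coarse_equiv (C.Orb y) (map_step C.E) (C.Orb y') (map_step C.E))" if "x \<in> topspace X" for x
      using locally_coarse_equiv_orbits[OF assms(1-3,7,9,8,10,4,5) that] unfolding CE .
    show "\<exists>x\<in>G. C.TH x" if "openin X G" "G \<noteq> {}" for G
      by (rule C.TH_dense[OF cm assms(8) Hausdorff_space_transversal[OF assms(7)] that])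
    show "B = {} \<or> B' = {}" if "openin X B" "openin X B'" "B \<union> B' = topspace X" "B \<inter> B' = {}"
       "C.cstep `` B \<subseteq> B" "C.cstep `` B' \<subseteq> B'" for B B'
      by (rule leaf_space_no_saturated_splitting[OF fa assms(7,6) that])
  qed
  moreover have "orbit_dist C p p' = real (graph_dist (map_step C.E) p p')" if "p \<in> C.Orb v" for v p p'
    unfolding orbit_dist_def CE using gen_dist_eq[OF C.E_poe] C.Orb_subset that by blast
  ultimately show ?thesis unfolding y(2) y'(2)
    using C.Orb_conn_graph[OF y(1)] C.Orb_conn_graph[OF y'(1)]
    by (intro coarse_equiv_imp_same_coarse_qi_type) auto
qed

end
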